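(* Let $0<\beta<1$, $0<\alpha<n$ with $\alpha+\beta<n$, $1<p<n/(\alpha+\beta)$, $1/s=1/p-(\alpha+\beta)/n$, $0<\kappa<p/s$, and let $w$ be a weight with $w^{s/p}\in A_1$ and $r_w>\frac{1}{p/s-\kappa}$. If $b\in Lip_\beta(w)$, then $[b,I_\alpha]$ is bounded from $L^{p,\kappa}(w)$ to $L^{s,\kappa s/p}(w^{1-(1-\alpha/n)s},w)$; that is, there is $C$ independent of $f$ with $$\|[b,I_\alpha]f\|_{L^{s,\kappa s/p}(w^{1-(1-\alpha/n)s},w)}\le C\|b\|_{Lip_\beta(w)}\|f\|_{L^{p,\kappa}(w)}.$$
   Context: All cubes have sides parallel to the axes. A weight is a locally integrable function on $\mathbb R^n$ that is positive a.e.; for a weight $u$ and a cube $Q$, $u(Q)=\int_Q u(x)\,dx$. $w\in A_1$ means $\frac1{|Q|}\int_Q w\le C\,\mathrm{ess\,inf}_Q w$ for all cubes $Q$. $w\in RH_r$ ($r>1$) means $\big(\frac1{|Q|}\int_Q w^r\big)^{1/r}\le C\frac1{|Q|}\int_Q w$ for all cubes $Q$; $r_w=\sup\{r>1: w\in RH_r\}$. The fractional integral is $I_\alpha f(x)=c_{n,\alpha}\int_{\mathbb R^n}\frac{f(y)}{|x-y|^{n-\alpha}}dy$ ($0<\alpha<n$, $c_{n,\alpha}>0$ a normalizing constant), and $[b,I_\alpha]f(x)=b(x)I_\alpha f(x)-I_\alpha(bf)(x)$. For $0<\beta<1$ and a weight $w$, with $b_Q=\frac1{|Q|}\int_Q b$,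 $\|b\|_{Lip_\beta(w)}=\sup_Q\frac{1}{w(Q)^{\beta/n}}\frac1{w(Q)}\int_Q|b(x)-b_Q|\,dx$ and $Lip_\beta(w)$ is the set of locally integrable $b$ with this finite. For $1\le p<\infty$, $0<\kappa<1$ and weights $u,v$, the weighted Morrey space $L^{p,\kappa}(u,v)$ consists of $f\in L^p_{loc}(u)$ with $\|f\|_{L^{p,\kappa}(u,v)}=\sup_Q\big(\frac1{v(Q)^\kappa}\int_Q|f|^pu\big)^{1/p}<\infty$, and $L^{p,\kappa}(w)=L^{p,\kappa}(w,w)$. *)

theory Defs
  imports "HOL-Analysis.Analysis"
begin

definition cubes :: "(real^'n) set set" where
  "cubes = {Q. \<exists>a h. h > 0 \<and> Q = cbox a (a + h *\<^sub>R One)}"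

definition wmeas :: "(real^'n \<Rightarrow> real) \<Rightarrow> (real^'n) set \<Rightarrow> real" where
  "wmeas u Q = (LINT x:Q|lebesgue. u x)"

definition avg :: "(real^'n) set \<Rightarrow> (real^'n \<Rightarrow> real) \<Rightarrow> real" where
  "avg Q f = (LINT x:Q|lebesgue. f x) / measure lebesgue Q"

definition loc_integrable :: "(real^'n \<Rightarrow> real) \<Rightarrow> bool" where
  "loc_integrable f \<longleftrightarrow> f \<in> borel_measurable lebesgue \<and>
     (\<forall>K. compact K \<longrightarrow> set_integrable lebesgue K f)"

definition weight :: "(real^'n \<Rightarrow> real) \<Rightarrow> bool" where
  "weight w \<longleftrightarrow> loc_integrable w \<and> (AE x in lebesgue. w x > 0)"

text \<open>A_1: avg_Q w \<le> C ess inf_Q w, i.e. avg_Q w \<le> C w(x) for a.e. x in Q.\<close>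
definition A1 :: "(real^'n \<Rightarrow> real) \<Rightarrow> bool" where
  "A1 w \<longleftrightarrow> weight w \<and> (\<exists>C. \<forall>Q\<in>cubes. AE x in lebesgue. x \<in> Q \<longrightarrow> avg Q w \<le> C * w x)"

definition RH :: "real \<Rightarrow> (real^'n \<Rightarrow> real) \<Rightarrow> bool" where
  "RH r w \<longleftrightarrow> (\<exists>C. \<forall>Q\<in>cubes. set_integrable lebesgue Q (\<lambda>x. w x powr r) \<and>
      (avg Q (\<lambda>x. w x powr r)) powr (1/r) \<le> C * avg Q w)"

definition r_w :: "(real^'n \<Rightarrow> real) \<Rightarrow> ereal" where
  "r_w w = (SUP r\<in>{r. r > 1 \<and> RH r w}. ereal r)"

definition frac_int :: "real \<Rightarrow> real \<Rightarrow> (real^'n \<Rightarrow> real) \<Rightarrow> real^'n \<Rightarrow> real" where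
  "frac_int c \<alpha> f x = c * (LINT y|lebesgue. f y / dist x y powr (real CARD('n) - \<alpha>))"

definition commutator :: "real \<Rightarrow> real \<Rightarrow> (real^'n \<Rightarrow> real) \<Rightarrow> (real^'n \<Rightarrow> real) \<Rightarrow> real^'n \<Rightarrow> real" where
  "commutator c \<alpha> b f x = b x * frac_int c \<alpha> f x - frac_int c \<alpha> (\<lambda>y. b y * f y) x"

definition lip_quot :: "real \<Rightarrow> (real^'n \<Rightarrow> real) \<Rightarrow> (real^'n \<Rightarrow> real) \<Rightarrow> (real^'n) set \<Rightarrow> real" where
  "lip_quot \<beta> w b Q = 1 / wmeas w Q powr (\<beta> / real CARD('n)) * (1 / wmeas w Q) *
      (LINT x:Q|lebesgue. \<bar>b x - avg Q b\<bar>)"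

definition lip_norm :: "real \<Rightarrow> (real^'n \<Rightarrow> real) \<Rightarrow> (real^'n \<Rightarrow> real) \<Rightarrow> real" where
  "lip_norm \<beta> w b = (SUP Q\<in>cubes. lip_quot \<beta> w b Q)"

definition Lip :: "real \<Rightarrow> (real^'n \<Rightarrow> real) \<Rightarrow> (real^'n \<Rightarrow> real) set" where
  "Lip \<beta> w = {b. loc_integrable b \<and> bdd_above (lip_quot \<beta> w b ` cubes)}"

definition morrey_norm :: "real \<Rightarrow> real \<Rightarrow> (real^'n \<Rightarrow> real) \<Rightarrow> (real^'n \<Rightarrow> real) \<Rightarrow> (real^'n \<Rightarrow> real) \<Rightarrow> ereal" where
  "morrey_norm p \<kappa> u v f = (SUP Q\<in>cubes.
      (let I = (\<integral>\<^sup>+ x\<in>Q. ennreal (\<bar>f x\<bar> powr p * u x) \<partial>lebesgue) in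
       if I = \<infinity> then \<infinity> else ereal ((enn2real I / wmeas v Q powr \<kappa>) powr (1 / p))))"

definition Morrey :: "real \<Rightarrow> real \<Rightarrow> (real^'n \<Rightarrow> real) \<Rightarrow> (real^'n \<Rightarrow> real) \<Rightarrow> (real^'n \<Rightarrow> real) set" where
  "Morrey p \<kappa> u v = {f. f \<in> borel_measurable lebesgue \<and>
      (\<forall>K. compact K \<longrightarrow> set_integrable lebesgue K (\<lambda>x. \<bar>f x\<bar> powr p * u x)) \<and>
      morrey_norm p \<kappa> u v f < \<infinity>}"

end

theory Submission
  imports Defs "HOL-Library.Nat_Bijection"
begin

text \<open>
  The \<open>A\<^sub>1\<close> condition makes \<open>\<mu> = w dx\<close> and \<open>\<nu> = w powr (s/p) dx\<close> doubling measures with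
  \<open>\<mu>(B(x,r)) \<le> A r\<^sup>n w(y)\<close> for almost every \<open>y \<in> B(x,r)\<close>, and similarly for \<open>\<nu>\<close>. Telescoping averages
  over shrinking cubes turns membership of \<open>b\<close> in \<open>Lip\<close> into the pointwise bound
  \<open>|b x - b y| \<le> C |x - y| powr \<beta> * w x powr (\<beta>/n) * (w x + w y)\<close>, so the commutator is controlled by
  the fractional integrals of order \<open>\<alpha> + \<beta>\<close> of \<open>|f|\<close> and of \<open>w |f|\<close>. By the ball estimate their kernels
  are dominated by powers of \<open>\<nu>(B(x,|x-y|))\<close> and \<open>\<mu>(B(x,|x-y|))\<close>; fractional integrals with such kernels
  map \<open>L\<^sup>p\<close> to \<open>L\<^sup>s\<close> by Hedberg's inequality and the maximal theorem, which settles the part of \<open>f\<close>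
  near a given cube. The part away from the cube is summed over dyadic shells; there the reverse
  Hoelder exponent \<open>r > 1/(p/s - \<kappa>)\<close> forces geometric decay.
\<close>

text \<open>With \<theta> = (\<alpha>+\<beta>)/n the pointwise bound leaves w(x)^(\<beta>/n) times
  w(x) * (integral of |f| k dy) + (integral of |f| k w dy), where k = |x-y|^(n*(\<theta>-1)). In the
  s-th power, the output weight w^(1-(1-\<alpha>/n)*s) completes the weight of the first term to
  w^(s/p). In the second, trading k for a power of \<mu>(B(x,|x-y|)) costs w(x)^(1-\<theta>), and w
  itself remains. Hence the two measures. The trade may use the density at x or at y: x is taken for
  \<mu>, y for \<nu>.

  The obstacle is the far part of the first term. Its integral is with respect to Lebesgue measure,
  whereas f is controlled on \<mu>-balls, so a shell of radius t contributes t^(n*\<theta>) *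
  \<mu>(B)^(-(1-\<kappa>)/p). Doubling gives the second factor some decay, but at an unknown rate;
  the reverse Hoelder inequality gives a rate that beats n*\<theta>.

  Norm inequalities are proved by exhibiting a measurable majorant g, so that measurability of the
  integrals in x is never at issue.\<close>

section \<open>Sums and integrals\<close>

text \<open>The bound f <= t + t^(1-p) * f^p holds for every t > 0, and at t = (I / measure of
  B)^(1/p) the two resulting terms are equal. This is Hoelder's inequality with constant 2, in a
  form where \<open>I\<close> is only an upper bound for the integral.\<close>

lemma nn_integral_le_powr_mean:
  fixes f :: "'a \<Rightarrow> real"
  assumes f: "f \<in> borel_measurable M" "\<And>x. 0 \<le> f x"
    and B: "B \<in> sets M" "emeasure M B < \<infinity>" and p: "1 < p"
    and I: "0 \<le> I" "(\<integral>\<^sup>+x\<in>B. ennreal (f x powr p) \<partial>M) \<le> ennreal I"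
  shows "(\<integral>\<^sup>+x\<in>B. ennreal (f x) \<partial>M) \<le> ennreal (2 * I powr (1/p) * measure M B powr (1 - 1/p))"
proof -
  note [measurable] = f(1) B(1)
  let ?a = "measure M B"
  have eB: "emeasure M B = ennreal ?a" using B by (simp add: emeasure_eq_ennreal_measure less_top)
  have main: "(\<integral>\<^sup>+x\<in>B. ennreal (f x) \<partial>M) \<le> ennreal (t * ?a + t powr (1-p) * I)" if t: "t > 0" for t
  proof -
    have pw: "f x \<le> t + t powr (1-p) * f x powr p" for x
    proof (cases "f x \<le> t")
      case True
      then show ?thesis by (simp add: add_increasing2)
    next
      case False
      then have "f x = f x powr (1-p) * f x powr p"
        using t by (simp add: powr_add[symmetric])
      also have "\<dots> \<le> t powr (1-p) * f x powr p"
        using False t p by (intro mult_right_mono powr_mono2') auto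
      finally show ?thesis using t by simp
    qed
    have "(\<integral>\<^sup>+x\<in>B. ennreal (f x) \<partial>M)
        \<le> (\<integral>\<^sup>+x. ennreal t * indicator B x + ennreal (t powr (1-p)) * (ennreal (f x powr p) * indicator B x) \<partial>M)"
    proof (rule nn_integral_mono)
      fix x
      have "ennreal (f x) \<le> ennreal (t + t powr (1-p) * f x powr p)"
        using pw by (intro ennreal_leI)
      also have "\<dots> = ennreal t + ennreal (t powr (1-p)) * ennreal (f x powr p)"
        using t by (simp add: ennreal_plus ennreal_mult)
      finally show "ennreal (f x) * indicator B x \<le> ennreal t * indicator B x
          + ennreal (t powr (1-p)) * (ennreal (f x powr p) * indicator B x)"
        by (auto simp: indicator_def)
    qed
    also have "\<dots> = ennreal t * emeasure M B
        + ennreal (t powr (1-p)) * (\<integral>\<^sup>+x\<in>B. ennreal (f x powr p) \<partial>M)"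
      by (subst nn_integral_add) (auto simp: nn_integral_cmult nn_integral_cmult_indicator)
    also have "\<dots> \<le> ennreal t * ennreal ?a + ennreal (t powr (1-p)) * ennreal I"
      using I(2) by (intro add_mono mult_left_mono) (auto simp: eB)
    also have "\<dots> = ennreal (t * ?a + t powr (1-p) * I)"
      using t I(1) by (simp add: ennreal_plus ennreal_mult)
    finally show ?thesis .
  qed
  consider "?a = 0" | "?a > 0" "I = 0" | "?a > 0" "I > 0"
    using I(1) measure_nonneg[of M B] by linarith
  then show ?thesis
  proof cases
    case 1
    then have "B \<in> null_sets M" using eB B by auto
    then have "(\<integral>\<^sup>+x\<in>B. ennreal (f x) \<partial>M) = 0"
      by (intro nn_integral_null_set)
    then show ?thesis by simp
  next
    \<comment> \<open>The optimal t would be 0 here, so t = e / measure of B is taken with e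
      arbitrarily small.\<close>
    case 2
    have "(\<integral>\<^sup>+x\<in>B. ennreal (f x) \<partial>M) \<le> 0 + ennreal e" if "e > 0" for e
      using main[of "e / ?a"] that 2 by simp
    then have "(\<integral>\<^sup>+x\<in>B. ennreal (f x) \<partial>M) \<le> 0" by (rule ennreal_le_epsilon)
    then show ?thesis by simp
  next
    case 3
    let ?t = "(I / ?a) powr (1/p)"
    have ta: "?t * ?a = I powr (1/p) * ?a powr (1 - 1/p)"
      using 3 by (simp add: powr_divide powr_diff field_simps)
    have "?t powr (1-p) * I = I powr ((1-p)/p + 1) * ?a powr (- ((1-p)/p))"
      using 3 by (simp add: powr_powr powr_divide powr_add powr_minus field_simps)
    also have "(1-p)/p + 1 = 1/p" using p by (simp add: field_simps)
    also have "- ((1-p)/p) = 1 - 1/p" using p by (simp add: field_simps)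
    finally show ?thesis using main[of ?t] 3 ta by (simp add: mult.assoc)
  qed
qed

lemma ennreal_suminf_geometric_le:
  fixes t :: "nat \<Rightarrow> real"
  assumes t: "\<And>j. t j \<le> K * q ^ j" and "0 \<le> K" "0 \<le> q" "q < 1"
  shows "(\<Sum>j. ennreal (t j)) \<le> ennreal (K / (1 - q))"
proof -
  have "(\<Sum>j. ennreal (t j)) \<le> (\<Sum>j. ennreal (K * q ^ j))"
    using t by (intro suminf_le ennreal_leI) auto
  also have "\<dots> = ennreal (K / (1 - q))"
  proof (rule suminf_ennreal_eq)
    show "(\<lambda>j. K * q ^ j) sums (K / (1 - q))"
      using sums_mult[OF geometric_sums[of q], of K] assms by simp
  qed (use assms in auto)
  finally show ?thesis .
qed

text \<open>Each shell is charged with the integral over a whole ball \<open>B j\<close> containing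
  it; in the applications the geometric decay of \<open>c j * a j\<close> absorbs the overlap. The
  alternative \<open>k y \<le> 0\<close> takes care of the centre, where the kernel of
  \<open>kernel_near\<close> has the default value 0.\<close>

lemma nn_integral_shells_le:
  fixes f k :: "'a \<Rightarrow> real"
  assumes [measurable]: "f \<in> borel_measurable M" "\<And>j. B j \<in> sets M"
    and f: "\<And>y. 0 \<le> f y" and c: "\<And>j. 0 \<le> c j"
    and a: "\<And>j. (\<integral>\<^sup>+y\<in>B j. ennreal (f y) \<partial>M) \<le> ennreal (a j)"
    and k: "\<And>y. y \<in> S \<Longrightarrow> k y \<le> 0 \<or> (\<exists>j::nat. y \<in> B j \<and> k y \<le> c j)"
  shows "(\<integral>\<^sup>+y\<in>S. ennreal (f y * k y) \<partial>M) \<le> (\<Sum>j. ennreal (c j * a j))"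
proof -
  have "(\<integral>\<^sup>+y\<in>S. ennreal (f y * k y) \<partial>M)
      \<le> (\<integral>\<^sup>+y. (\<Sum>j. ennreal (c j) * (ennreal (f y) * indicator (B j) y)) \<partial>M)"
  proof (rule nn_integral_mono)
    fix y
    let ?g = "\<lambda>j. ennreal (c j) * (ennreal (f y) * indicator (B j) y)"
    show "ennreal (f y * k y) * indicator S y \<le> suminf ?g"
    proof (cases "y \<in> S \<and> k y > 0")
      case True
      then obtain j where j: "y \<in> B j" "k y \<le> c j" using k[of y] by force
      have "ennreal (f y * k y) \<le> ennreal (c j * f y)"
        using mult_right_mono[OF j(2) f[of y]] by (intro ennreal_leI) (simp add: mult.commute)
      also have "\<dots> = ?g j" using j f c by (simp add: ennreal_mult)
      also have "\<dots> \<le> suminf ?g" using sum_le_suminf[of ?g "{j}"] by simp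
      finally show ?thesis using True by simp
    next
      case False
      then have "ennreal (f y * k y) * indicator S y = 0"
        using f[of y] by (auto simp: indicator_def ennreal_eq_0_iff mult_nonneg_nonpos not_less)
      then show ?thesis by (metis zero_le)
    qed
  qed
  also have "\<dots> = (\<Sum>j. ennreal (c j) * (\<integral>\<^sup>+y\<in>B j. ennreal (f y) \<partial>M))"
    by (simp add: nn_integral_suminf nn_integral_cmult)
  also have "\<dots> \<le> (\<Sum>j. ennreal (c j * a j))"
  proof (intro suminf_le)
    fix j
    have "ennreal (c j) * (\<integral>\<^sup>+y\<in>B j. ennreal (f y) \<partial>M) \<le> ennreal (c j) * ennreal (a j)"
      using a by (intro mult_left_mono) auto
    also have "\<dots> = ennreal (c j * a j)" using c by (simp add: ennreal_mult')
    finally show "ennreal (c j) * (\<integral>\<^sup>+y\<in>B j. ennreal (f y) \<partial>M) \<le> ennreal (c j * a j)" .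
  qed auto
  finally show ?thesis .
qed

lemma dist_lebesgue_measurable [measurable]:
  "(\<lambda>y. dist x y) \<in> borel_measurable lebesgue" for x :: "'a::euclidean_space"
  by (intro measurable_completion) (auto intro!: borel_measurable_continuous_onI continuous_intros)

lemma nn_integral_split_near_far:
  fixes x :: "'a::euclidean_space"
  assumes h: "h \<in> borel_measurable M" and M: "sets M = sets lebesgue"
  shows "(\<integral>\<^sup>+y. h y \<partial>M) = (\<integral>\<^sup>+y\<in>cball x R. h y \<partial>M) + (\<integral>\<^sup>+y\<in>- cball x R. h y \<partial>M)"
proof -
  have [measurable]: "cball x R \<in> sets M" "- cball x R \<in> sets M" by (auto simp: M)
  note [measurable] = h
  have "(\<integral>\<^sup>+y. h y \<partial>M) = (\<integral>\<^sup>+y. h y * indicator (cball x R) y + h y * indicator (- cball x R) y \<partial>M)"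
    by (intro nn_integral_cong) (auto simp: indicator_def)
  also have "\<dots> = (\<integral>\<^sup>+y\<in>cball x R. h y \<partial>M) + (\<integral>\<^sup>+y\<in>- cball x R. h y \<partial>M)"
    by (rule nn_integral_add) measurable
  finally show ?thesis .
qed

section \<open>Dyadic radii and dyadic levels\<close>

lemma dyadic_shell_inner:
  fixes \<rho> d :: real
  assumes "0 < d" "d \<le> \<rho>"
  obtains j where "d \<le> (1/2)^j * \<rho>" "(1/2)^Suc j * \<rho> < d"
proof -
  have "\<exists>j. (1/2)^j * \<rho> < d"
    using real_arch_pow_inv[of "d/\<rho>" "1/2"] assms by (auto simp: field_simps)
  then have *: "(1/2)^(LEAST j. (1/2)^j * \<rho> < d) * \<rho> < d" (is "(1/2)^?m * \<rho> < d")
    by (rule LeastI_ex)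
  then have "?m \<noteq> 0" using assms by (intro notI) simp
  then obtain j where j: "?m = Suc j" using not0_implies_Suc by blast
  then have "\<not> (1/2)^j * \<rho> < d" by (metis lessI not_less_Least)
  then show thesis using that[of j] * j by auto
qed

lemma dyadic_shell_outer:
  fixes \<rho> d :: real
  assumes "0 < \<rho>" "\<rho> < d"
  obtains j where "2^j * \<rho> < d" "d \<le> 2^Suc j * \<rho>"
proof -
  have "\<exists>j. d \<le> 2^j * \<rho>"
    using real_arch_pow[of 2 "d/\<rho>"] assms by (auto simp: field_simps intro: less_imp_le)
  then have *: "d \<le> 2^(LEAST j. d \<le> 2^j * \<rho>) * \<rho>" (is "d \<le> 2^?m * \<rho>")
    by (rule LeastI_ex)
  then have "?m \<noteq> 0" using assms by (intro notI) simp
  then obtain j where j: "?m = Suc j" using not0_implies_Suc by blast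
  then have "\<not> d \<le> 2^j * \<rho>" by (metis lessI not_less_Least)
  then show thesis using that[of j] * j by auto
qed

text \<open>The Vitali covering lemma selects a countable set of pairs (centre, radius) and no
  sequence, so subadditivity is wanted with the sum written as an integral over the counting measure
  of the index set.\<close>

lemma emeasure_UN_countable_le:
  assumes I: "countable I" and X: "\<And>i. i \<in> I \<Longrightarrow> X i \<in> sets N"
  shows "emeasure N (\<Union>i\<in>I. X i) \<le> (\<integral>\<^sup>+i. emeasure N (X i) \<partial>count_space I)"
proof -
  have U: "(\<Union>i\<in>I. X i) \<in> sets N" using assms by (intro sets.countable_UN') auto
  have "emeasure N (\<Union>i\<in>I. X i) = (\<integral>\<^sup>+x. indicator (\<Union>i\<in>I. X i) x \<partial>N)" using U by simp
  also have "\<dots> \<le> (\<integral>\<^sup>+x. (\<integral>\<^sup>+i. indicator (X i) x \<partial>count_space I) \<partial>N)"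
  proof (rule nn_integral_mono)
    fix x
    show "indicator (\<Union>i\<in>I. X i) x \<le> (\<integral>\<^sup>+i. indicator (X i) x \<partial>count_space I)"
    proof (cases "x \<in> (\<Union>i\<in>I. X i)")
      case True
      then obtain i where i: "i \<in> I" "x \<in> X i" by auto
      have "(\<integral>\<^sup>+i. indicator (X i) x \<partial>count_space I) \<ge> (\<integral>\<^sup>+j. indicator {i} j \<partial>count_space I)"
        using i by (intro nn_integral_mono) (auto simp: indicator_def)
      moreover have "(\<integral>\<^sup>+j. indicator {i} j \<partial>count_space I) = (1::ennreal)" using i by simp
      ultimately show ?thesis using True by simp
    qed simp
  qed
  also have "\<dots> = (\<integral>\<^sup>+i. emeasure N (X i) \<partial>count_space I)"
    using I X by (subst nn_integral_count_space_nn_integral) (auto intro!: nn_integral_cong)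
  finally show ?thesis .
qed

text \<open>A discrete form of integrating t^(q-1) over 0 < t < 2y. The levels with 2^(k-1) < y are
  the k <= m, where m is log2 of y rounded up, so the sum is geometric downwards from its top term
  2^(m*q) <= (2y)^q.\<close>

lemma suminf_int_powr_le:
  fixes q y :: real
  assumes q: "0 < q" and y: "0 \<le> y"
  shows "(\<Sum>i. if 2 powr (real_of_int (int_decode i) - 1) < y
            then ennreal (2 powr (real_of_int (int_decode i) * q)) else 0)
     \<le> ennreal ((2*y) powr q / (1 - 2 powr (-q)))"
proof (cases "y = 0")
  case True
  then show ?thesis by simp
next
  case False
  then have y: "y > 0" using y by simp
  define m where "m = \<lceil>log 2 y\<rceil>"
  have iff: "2 powr (real_of_int k - 1) < y \<longleftrightarrow> k \<le> m" for k :: int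
  proof -
    have "2 powr (real_of_int k - 1) < y \<longleftrightarrow> real_of_int k - 1 < log 2 y"
      using y by (simp add: less_log_iff)
    also have "\<dots> \<longleftrightarrow> k \<le> m" unfolding m_def by linarith
    finally show ?thesis .
  qed
  let ?h = "\<lambda>k::int. if 2 powr (real_of_int k - 1) < y then ennreal (2 powr (real_of_int k * q)) else 0"
  have "(\<Sum>i. ?h (int_decode i)) = (\<integral>\<^sup>+i. ?h (int_decode i) \<partial>count_space UNIV)"
    by (simp add: nn_integral_count_space_nat)
  also have "\<dots> = (\<integral>\<^sup>+k. ?h k \<partial>count_space UNIV)"
    by (rule nn_integral_bij_count_space[OF bij_int_decode])
  also have "\<dots> = (\<integral>\<^sup>+k. ennreal (2 powr (real_of_int k * q)) * indicator {..m} k \<partial>count_space UNIV)"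
    by (intro nn_integral_cong) (auto simp: iff)
  also have "\<dots> = (\<integral>\<^sup>+k. ennreal (2 powr (real_of_int k * q)) \<partial>count_space {..m})"
    by (subst nn_integral_count_space_indicator) auto
  \<comment> \<open>Counting down from m by i = m - k turns the integers up to m into the natural
    numbers.\<close>
  also have "\<dots> = (\<integral>\<^sup>+i. ennreal (2 powr (real_of_int (m - int i) * q)) \<partial>count_space UNIV)"
  proof (rule nn_integral_bij_count_space[symmetric])
    show "bij_betw (\<lambda>i. m - int i) UNIV {..m}"
      by (rule bij_betwI[where g="\<lambda>k. nat (m - k)"]) auto
  qed
  also have "\<dots> = (\<Sum>i. ennreal (2 powr (real_of_int (m - int i) * q)))"
    by (simp add: nn_integral_count_space_nat)
  also have "\<dots> \<le> ennreal ((2*y) powr q / (1 - 2 powr (-q)))"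
  proof (rule ennreal_suminf_geometric_le)
    fix i
    have "2 powr (real_of_int m - 1) < y" using iff[of m] by simp
    then have "2 powr real_of_int m \<le> 2 * y" by (simp add: powr_diff)
    then have "(2 powr real_of_int m) powr q \<le> (2*y) powr q" using q by (intro powr_mono2) auto
    then have "2 powr (real_of_int m * q) \<le> (2*y) powr q" by (simp add: powr_powr)
    then have "2 powr (real_of_int m * q) * (2 powr (-q))^i \<le> (2*y) powr q * (2 powr (-q))^i"
      by (intro mult_right_mono) auto
    moreover have "2 powr (real_of_int (m - int i) * q) = 2 powr (real_of_int m * q) * (2 powr (-q))^i"
      by (simp add: powr_power powr_add[symmetric] algebra_simps)
    ultimately show "2 powr (real_of_int (m - int i) * q) \<le> (2*y) powr q * (2 powr (-q))^i" by simp
  qed (use q in \<open>auto simp: powr_less_one\<close>)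
  finally show ?thesis .
qed

lemma suminf_indicator_cmult:
  fixes a :: "nat \<Rightarrow> ennreal"
  shows "(\<Sum>i. a i * (c * indicator (S i) y)) = c * (\<Sum>i. if y \<in> S i then a i else 0)"
  by (subst ennreal_suminf_cmult[symmetric], rule suminf_cong) (simp add: indicator_def mult.commute)

section \<open>Doubling measures\<close>

text \<open>The locale is instantiated both with w dx and with w^(s/p) dx. Keeping the sigma-algebra
  of \<open>lebesgue\<close> lets a single measurability assumption on f serve both measures and
  Lebesgue measure itself.\<close>

locale doubling_measure =
  fixes M :: "'a::euclidean_space measure" and D :: real
  assumes sets_M: "sets M = sets lebesgue"
    and ball_pos: "0 < r \<Longrightarrow> 0 < emeasure M (cball x r)"
    and ball_finite: "emeasure M (cball x r) < \<infinity>"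
    and doubling: "0 < r \<Longrightarrow> measure M (cball x (2*r)) \<le> D * measure M (cball x r)"
begin

section \<open>Growth and decay of ball measures\<close>

abbreviation V :: "'a \<Rightarrow> real \<Rightarrow> real" where "V x r \<equiv> measure M (cball x r)"

lemma space_M [simp]: "space M = UNIV"
  using sets_eq_imp_space_eq[OF sets_M] by simp

lemma borel_sets_M: "A \<in> sets borel \<Longrightarrow> A \<in> sets M"
  by (simp add: sets_M)

lemma cball_sets_M [measurable, simp]: "cball x r \<in> sets M"
  by (simp add: borel_sets_M)

lemma emeasure_cball_eq: "emeasure M (cball x r) = ennreal (V x r)"
  using ball_finite[of x r] by (simp add: emeasure_eq_ennreal_measure less_top)

lemma V_pos: "0 < r \<Longrightarrow> 0 < V x r"
  using ball_pos[of r x] by (simp add: emeasure_cball_eq)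

lemma measure_le_V: "A \<in> sets M \<Longrightarrow> A \<subseteq> cball x r \<Longrightarrow> measure M A \<le> V x r"
  by (rule measure_mono_fmeasurable) (auto simp: fmeasurable_def ball_finite[simplified])

lemma V_mono: "cball x r \<subseteq> cball y R \<Longrightarrow> V x r \<le> V y R"
  by (rule measure_le_V) auto

lemma D_ge_1: "1 \<le> D"
proof -
  have "V (0::'a) 1 \<le> V 0 2" by (intro V_mono) auto
  also have "\<dots> \<le> D * V 0 1" using doubling[of 1 0] by simp
  finally show ?thesis using V_pos[of 1 0] by simp
qed

lemma V_pow2: "0 < r \<Longrightarrow> V x (2^k * r) \<le> D^k * V x r"
proof (induction k)
  case (Suc k)
  have "V x (2 * (2^k * r)) \<le> D * V x (2^k * r)" using Suc by (intro doubling) auto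
  also have "\<dots> \<le> D * (D^k * V x r)" using Suc D_ge_1 by (intro mult_left_mono) auto
  finally show ?case by (simp add: mult_ac)
qed simp

lemma V_compare:
  assumes "0 < r" "dist x y + R \<le> 2^k * r"
  shows "V y R \<le> D^k * V x r"
proof -
  have "V y R \<le> V x (2^k * r)"
    by (rule V_mono) (use assms in \<open>auto simp: cball_subset_cball_iff dist_commute\<close>)
  then show ?thesis using V_pow2[OF assms(1), of x k] by linarith
qed

text \<open>The factor of reverse doubling: B(x,2r) contains a ball of radius r/4 disjoint from
  B(x,r), and four doublings of that small ball cover B(x,2r), so it carries at least the fraction
  1/D^4.\<close>

definition \<eta> :: real where "\<eta> = 1 - 1 / D^4"

lemma V_reverse: "0 < r \<Longrightarrow> V x r \<le> \<eta> * V x (2*r)"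
proof -
  assume r: "0 < r"
  obtain e :: 'a where e: "norm e = 1" using vector_choose_size[of 1] by auto
  \<comment> \<open>At distance 3r/2 from x, a ball of radius r/4 stays between the spheres of
    radius r and 2r.\<close>
  define z where "z = x + (3/2 * r) *\<^sub>R e"
  have dz: "dist x z = 3/2 * r" using e r by (simp add: z_def dist_norm)
  have disj: "cball x r \<inter> cball z (r/4) = {}"
  proof -
    have False if "dist x y \<le> r" "dist z y \<le> r/4" for y
      using dist_triangle2[of x z y] that dz r by (simp add: dist_commute)
    then show ?thesis by auto
  qed
  have sub: "cball x r \<union> cball z (r/4) \<subseteq> cball x (2*r)"
    using dz r by (auto simp: cball_subset_cball_iff dist_commute)
  have "V x r + V z (r/4) = measure M (cball x r \<union> cball z (r/4))"
    by (rule measure_Union[symmetric]) (use disj in \<open>auto simp: emeasure_cball_eq\<close>)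
  also have "\<dots> \<le> V x (2*r)" using sub by (intro measure_le_V) auto
  finally have 1: "V x r + V z (r/4) \<le> V x (2*r)" .
  have "V x (2*r) \<le> D^4 * V z (r/4)"
    using dz r by (intro V_compare) (auto simp: dist_commute)
  then have "V x (2*r) / D^4 \<le> V z (r/4)" using D_ge_1 by (simp add: field_simps)
  then show ?thesis using 1 by (simp add: \<eta>_def algebra_simps)
qed

lemma \<eta>_bounds: "0 < \<eta>" "\<eta> < 1"
proof -
  show "\<eta> < 1" using D_ge_1 by (simp add: \<eta>_def)
  show "0 < \<eta>" using V_reverse[of 1 0] V_pos[of 1 0] V_pos[of 2 0]
    by (metis less_le_trans mult.right_neutral zero_less_mult_pos2 zero_less_numeral zero_less_one)
qed

lemma V_reverse_pow: "0 < r \<Longrightarrow> V x r \<le> \<eta>^j * V x (2^j * r)"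
proof (induction j)
  case (Suc j)
  have "V x r \<le> \<eta>^j * V x (2^j * r)" using Suc by simp
  also have "\<dots> \<le> \<eta>^j * (\<eta> * V x (2 * (2^j * r)))"
    using Suc \<eta>_bounds by (intro mult_left_mono V_reverse) auto
  finally show ?case by (simp add: mult_ac)
qed simp

lemma V_shrink_pow: "0 < r \<Longrightarrow> V x ((1/2)^j * r) \<le> \<eta>^j * V x r"
  using V_reverse_pow[of "(1/2)^j * r" x j] by (simp add: power_one_over)

text \<open>Reverse doubling excludes atoms. Hence V(x,|x-y|) powr (\<theta>-1) takes the default
  value \<open>0 powr _ = 0\<close> at y = x, where the kernel is really infinite; as {x} is a null
  set, integrals do not see the difference.\<close>

lemma V_dist_0: "V x 0 = 0"
proof -
  have "(\<lambda>j. \<eta>^j * V x 1) \<longlonglongrightarrow> 0 * V x 1"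
    using \<eta>_bounds by (intro tendsto_mult LIMSEQ_power_zero) auto
  moreover have "V x 0 \<le> \<eta>^j * V x 1" for j
    using V_mono[of x 0 x "(1/2)^j * 1"] V_shrink_pow[of 1 x j] by simp
  ultimately have "V x 0 \<le> 0" by (intro LIMSEQ_le_const) auto
  then show ?thesis by (simp add: measure_le_0_iff)
qed

subsection \<open>The maximal theorem\<close>

text \<open>The set where an uncentred maximal function of f exceeds t, built without that function.
  Averages run over closed balls, but the union is over open ones, which makes the set open and
  therefore measurable.\<close>

definition superlevel :: "('a \<Rightarrow> ennreal) \<Rightarrow> real \<Rightarrow> 'a set" where
  "superlevel f t = \<Union>{ball z r | z r. 0 < r \<and>
      ennreal t * emeasure M (cball z r) < (\<integral>\<^sup>+y\<in>cball z r. f y \<partial>M)}"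

lemma open_superlevel: "open (superlevel f t)"
  unfolding superlevel_def by (rule open_Union) auto

lemma superlevel_sets [measurable]: "superlevel f t \<in> sets M"
  by (rule borel_sets_M) (simp add: open_superlevel)

lemma not_in_superlevelD:
  assumes "x \<notin> superlevel f t" "0 < r"
  shows "(\<integral>\<^sup>+y\<in>cball x r. f y \<partial>M) \<le> ennreal t * emeasure M (cball x r)"
proof (rule ccontr)
  assume "\<not> ?thesis"
  then have "ball x r \<subseteq> superlevel f t" using assms(2) unfolding superlevel_def not_le by blast
  then show False using assms centre_in_ball[of x r] by blast
qed

text \<open>The weak (1,1) inequality by Vitali covering. Balls enlarged five times are reached by
  three doublings, which is the source of D^3.\<close>

lemma superlevel_weak_type:
  assumes [measurable]: "f \<in> borel_measurable M" and t: "0 < t"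
  shows "ennreal t * emeasure M (superlevel f t) \<le> ennreal (D^3) * (\<integral>\<^sup>+y. f y \<partial>M)"
proof -
  \<comment> \<open>The covering lemma wants bounded radii, so the set is exhausted by the unions
    \<open>U N\<close> of balls of radius at most N.\<close>
  define K where "K N = {(z,r). 0 < r \<and> r \<le> real N \<and>
      ennreal t * emeasure M (cball z r) < (\<integral>\<^sup>+y\<in>cball z r. f y \<partial>M)}" for N
  define U where "U N = (\<Union>(z,r)\<in>K N. ball z r)" for N
  have UM [measurable]: "U N \<in> sets M" for N
    unfolding U_def by (rule borel_sets_M) (auto intro!: borel_open)
  have bound: "ennreal t * emeasure M (U N) \<le> ennreal (D^3) * (\<integral>\<^sup>+y. f y \<partial>M)" for N
  proof -
    have 1: "U N \<subseteq> (\<Union>i\<in>K N. cball (fst i) (snd i))"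
      unfolding U_def by (force simp: less_imp_le)
    have 2: "0 < snd i \<and> snd i \<le> real N" if "i \<in> K N" for i using that by (auto simp: K_def)
    obtain C where C: "countable C" "C \<subseteq> K N"
        "pairwise (\<lambda>i j. disjnt (cball (fst i) (snd i)) (cball (fst j) (snd j))) C"
        "U N \<subseteq> (\<Union>i\<in>C. cball (fst i) (5 * snd i))"
      by (rule Vitali_covering_lemma_cballs[OF 1 2])
    have Cb: "emeasure M (cball (fst i) (5 * snd i)) \<le> ennreal (D^3) * emeasure M (cball (fst i) (snd i))"
      if "i \<in> C" for i
    proof -
      have "0 < snd i" using 2[of i] C(2) that by blast
      then have "V (fst i) (5 * snd i) \<le> D^3 * V (fst i) (snd i)" by (intro V_compare) auto
      then show ?thesis using D_ge_1
        by (simp add: emeasure_cball_eq ennreal_mult[symmetric] ennreal_leI)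
    qed
    have "ennreal t * emeasure M (U N)
        \<le> ennreal t * (\<integral>\<^sup>+i. emeasure M (cball (fst i) (5 * snd i)) \<partial>count_space C)"
    proof (rule mult_left_mono)
      have "emeasure M (U N) \<le> emeasure M (\<Union>i\<in>C. cball (fst i) (5 * snd i))"
        by (rule emeasure_mono[OF C(4)]) (use C(1) in \<open>auto intro!: sets.countable_UN'\<close>)
      also have "\<dots> \<le> (\<integral>\<^sup>+i. emeasure M (cball (fst i) (5 * snd i)) \<partial>count_space C)"
        by (rule emeasure_UN_countable_le[OF C(1)]) auto
      finally show "emeasure M (U N) \<le> \<dots>" .
    qed simp
    also have "\<dots> \<le> ennreal t * (\<integral>\<^sup>+i. ennreal (D^3) * emeasure M (cball (fst i) (snd i)) \<partial>count_space C)"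
      using Cb by (intro mult_left_mono nn_integral_mono) auto
    also have "\<dots> = ennreal (D^3) * (\<integral>\<^sup>+i. ennreal t * emeasure M (cball (fst i) (snd i)) \<partial>count_space C)"
      by (simp add: nn_integral_cmult mult_ac)
    \<comment> \<open>On each selected ball the mass of f exceeds t times the measure. The balls
      being disjoint, their masses add up under the measure with density f.\<close>
    also have "\<dots> \<le> ennreal (D^3) * (\<integral>\<^sup>+i. emeasure (density M f) (cball (fst i) (snd i)) \<partial>count_space C)"
      using C(2) by (intro mult_left_mono nn_integral_mono)
        (auto simp: emeasure_density K_def less_imp_le)
    also have "(\<integral>\<^sup>+i. emeasure (density M f) (cball (fst i) (snd i)) \<partial>count_space C)
        = emeasure (density M f) (\<Union>i\<in>C. cball (fst i) (snd i))"
      by (rule emeasure_UN_countable[symmetric])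
         (use C(1,3) in \<open>auto simp: disjoint_family_on_def pairwise_def disjnt_def\<close>)
    also have "\<dots> \<le> emeasure (density M f) (space (density M f))" by (rule emeasure_space)
    also have "\<dots> = (\<integral>\<^sup>+y. f y \<partial>M)" using sets.top[of M] by (simp add: emeasure_density)
    finally show ?thesis by (simp add: mult_left_mono)
  qed
  have "superlevel f t \<subseteq> (\<Union>N. U N)"
  proof
    fix x assume "x \<in> superlevel f t"
    then obtain z r where zr: "0 < r" "x \<in> ball z r"
      "ennreal t * emeasure M (cball z r) < (\<integral>\<^sup>+y\<in>cball z r. f y \<partial>M)"
      unfolding superlevel_def by auto
    obtain N :: nat where "r \<le> real N" using real_arch_simple by blast
    then show "x \<in> (\<Union>N. U N)" using zr unfolding U_def K_def by auto
  qed
  then have "emeasure M (superlevel f t) \<le> emeasure M (\<Union>N. U N)"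
    by (intro emeasure_mono) auto
  also have "\<dots> = (SUP N. emeasure M (U N))"
  proof (rule SUP_emeasure_incseq[symmetric])
    show "range U \<subseteq> sets M" using UM by auto
    show "incseq U" unfolding incseq_def U_def K_def by force
  qed
  finally have "ennreal t * emeasure M (superlevel f t) \<le> ennreal t * (SUP N. emeasure M (U N))"
    by (rule mult_left_mono) simp
  also have "\<dots> = (SUP N. ennreal t * emeasure M (U N))"
    by (rule SUP_mult_left_ennreal)
  also have "\<dots> \<le> ennreal (D^3) * (\<integral>\<^sup>+y. f y \<partial>M)" using bound by (intro SUP_least)
  finally show ?thesis .
qed

text \<open>Up to a constant factor this dominates the \<open>p\<close>-th power of the maximal function;
  \<open>int_decode\<close> enumerates the dyadic levels.\<close>
definition maximal_pow :: "real \<Rightarrow> ('a \<Rightarrow> real) \<Rightarrow> 'a \<Rightarrow> ennreal" where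
  "maximal_pow p f x = (\<Sum>i. ennreal (2 powr (real_of_int (int_decode i) * p)) *
      indicator (superlevel (\<lambda>y. ennreal (f y)) (2 powr real_of_int (int_decode i))) x)"

lemma maximal_pow_measurable [measurable]: "maximal_pow p f \<in> borel_measurable M"
  unfolding maximal_pow_def
  by (intro borel_measurable_suminf_order borel_measurable_times borel_measurable_indicator superlevel_sets) auto

lemma less_sets: "f \<in> borel_measurable M \<Longrightarrow> {y. t < f y} \<in> sets M" for f :: "'a \<Rightarrow> real"
  using measurable_sets[of f M borel "{t<..}"] by (simp add: vimage_def)

text \<open>The part of f below height t contributes at most t to any average, so an average above
  2t leaves more than t for the part above t.\<close>

lemma superlevel_truncate:
  assumes [measurable]: "f \<in> borel_measurable M" and f: "\<And>y. 0 \<le> f y" and t: "0 < t"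
  shows "superlevel (\<lambda>y. ennreal (f y)) (2 * t) \<subseteq>
    superlevel (\<lambda>y. ennreal (f y) * indicator {y. t < f y} y) t"
proof -
  have "ennreal t * emeasure M (cball z r)
      < (\<integral>\<^sup>+y\<in>cball z r. ennreal (f y) * indicator {y. t < f y} y \<partial>M)"
    if *: "ennreal (2*t) * emeasure M (cball z r) < (\<integral>\<^sup>+y\<in>cball z r. ennreal (f y) \<partial>M)" for z r
  proof (rule ccontr)
    assume neg: "\<not> ?thesis"
    have "(\<integral>\<^sup>+y\<in>cball z r. ennreal (f y) \<partial>M)
      \<le> (\<integral>\<^sup>+y. ennreal (f y) * indicator {y. t < f y} y * indicator (cball z r) y
            + ennreal t * indicator (cball z r) y \<partial>M)"
      by (intro nn_integral_mono) (auto simp: indicator_def ennreal_leI)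
    also have "\<dots> = (\<integral>\<^sup>+y\<in>cball z r. ennreal (f y) * indicator {y. t < f y} y \<partial>M)
        + ennreal t * emeasure M (cball z r)"
    proof (subst nn_integral_add)
      note less_sets[OF assms(1), of t, measurable]
      show "(\<lambda>y. ennreal (f y) * indicator {y. t < f y} y * indicator (cball z r) y) \<in> borel_measurable M"
        by measurable
    qed (auto simp: nn_integral_cmult_indicator)
    also have "\<dots> \<le> ennreal t * emeasure M (cball z r) + ennreal t * emeasure M (cball z r)"
      using neg by (intro add_mono) auto
    also have "\<dots> = ennreal (2*t) * emeasure M (cball z r)"
      using t by (simp add: ennreal_plus[symmetric] distrib_right[symmetric] del: ennreal_plus)
    finally show False using * by simp
  qed
  then show ?thesis unfolding superlevel_def by blast
qed

text \<open>Marcinkiewicz interpolation on dyadic levels. The weak bound, applied to the part of f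
  above 2^(k-1), gives the level 2^k the weight 2^(k*(p-1)) against f; at a point y only levels with
  2^(k-1) < f y count, and their weights sum to a multiple of (f y)^(p-1).\<close>

lemma maximal_pow_integral:
  assumes p: "1 < p"
  shows "\<exists>C>0. \<forall>f. f \<in> borel_measurable M \<longrightarrow> (\<forall>y. 0 \<le> f y) \<longrightarrow>
      (\<integral>\<^sup>+x. maximal_pow p f x \<partial>M) \<le> ennreal C * (\<integral>\<^sup>+x. ennreal (f x powr p) \<partial>M)"
proof -
  define q where "q = p - 1"
  have q: "q > 0" using p by (simp add: q_def)
  define C where "C = 2 * D^3 * (2 powr q / (1 - 2 powr (-q)))"
  have q1: "2 powr (-q) < 1" using q by (simp add: powr_less_one)
  have C: "C > 0" unfolding C_def using D_ge_1 q1 by (intro mult_pos_pos divide_pos_pos) auto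
  have "(\<integral>\<^sup>+x. maximal_pow p f x \<partial>M) \<le> ennreal C * (\<integral>\<^sup>+x. ennreal (f x powr p) \<partial>M)"
    if [measurable]: "f \<in> borel_measurable M" and f: "\<And>y. 0 \<le> f y" for f
  proof -
    let ?k = "\<lambda>i. real_of_int (int_decode i)"
    define S where "S i = {y. 2 powr (?k i - 1) < f y}" for i
    have [measurable]: "S i \<in> sets M" for i unfolding S_def by (rule less_sets[OF that(1)])
    have level: "ennreal (2 powr (?k i * p)) * emeasure M (superlevel (\<lambda>y. ennreal (f y)) (2 powr ?k i))
      \<le> ennreal (2 * D^3) * (\<integral>\<^sup>+y. ennreal (2 powr (?k i * q)) * (ennreal (f y) * indicator (S i) y) \<partial>M)" for i
    proof -
      let ?t = "2 powr (?k i - 1)"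
      have t2: "2 powr ?k i = 2 * ?t" by (simp add: powr_diff)
      \<comment> \<open>Splits off the factor 2^(k-1) that the weak type inequality at level
        \<open>?t\<close> consumes.\<close>
      have e: "2 powr (?k i * p) = 2 * 2 powr (?k i * q) * ?t"
      proof -
        have "?k i * p = 1 + (?k i * q + (?k i - 1))" by (simp add: q_def algebra_simps)
        then show ?thesis by (simp only: powr_add) simp
      qed
      have "ennreal (2 powr (?k i * p)) * emeasure M (superlevel (\<lambda>y. ennreal (f y)) (2 powr ?k i))
        \<le> ennreal (2 powr (?k i * p)) * emeasure M (superlevel (\<lambda>y. ennreal (f y) * indicator (S i) y) ?t)"
        unfolding t2 S_def using f by (intro mult_left_mono emeasure_mono superlevel_truncate superlevel_sets) auto
      also have "\<dots> = ennreal (2 * 2 powr (?k i * q)) *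
          (ennreal ?t * emeasure M (superlevel (\<lambda>y. ennreal (f y) * indicator (S i) y) ?t))"
        unfolding e by (subst ennreal_mult) (auto simp: mult.assoc)
      also have "\<dots> \<le> ennreal (2 * 2 powr (?k i * q)) *
          (ennreal (D^3) * (\<integral>\<^sup>+y. ennreal (f y) * indicator (S i) y \<partial>M))"
        by (intro mult_left_mono superlevel_weak_type) auto
      also have "\<dots> = ennreal (2 * D^3) * (\<integral>\<^sup>+y. ennreal (2 powr (?k i * q)) * (ennreal (f y) * indicator (S i) y) \<partial>M)"
        using D_ge_1 by (subst nn_integral_cmult) (auto simp: ennreal_mult mult_ac)
      finally show ?thesis .
    qed
    have "(\<integral>\<^sup>+x. maximal_pow p f x \<partial>M) =
      (\<Sum>i. ennreal (2 powr (?k i * p)) * emeasure M (superlevel (\<lambda>y. ennreal (f y)) (2 powr ?k i)))"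
      unfolding maximal_pow_def
      by (subst nn_integral_suminf, measurable) (intro suminf_cong nn_integral_cmult_indicator, measurable)
    also have "\<dots> \<le> (\<Sum>i. ennreal (2 * D^3) * (\<integral>\<^sup>+y. ennreal (2 powr (?k i * q)) * (ennreal (f y) * indicator (S i) y) \<partial>M))"
      by (intro suminf_le level) auto
    also have "\<dots> = ennreal (2 * D^3) * (\<integral>\<^sup>+y. (\<Sum>i. ennreal (2 powr (?k i * q)) * (ennreal (f y) * indicator (S i) y)) \<partial>M)"
    proof -
      have "(\<integral>\<^sup>+y. (\<Sum>i. ennreal (2 powr (?k i * q)) * (ennreal (f y) * indicator (S i) y)) \<partial>M)
          = (\<Sum>i. \<integral>\<^sup>+y. ennreal (2 powr (?k i * q)) * (ennreal (f y) * indicator (S i) y) \<partial>M)"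
        by (rule nn_integral_suminf) measurable
      then show ?thesis by (simp only: ennreal_suminf_cmult)
    qed
    also have "\<dots> \<le> ennreal (2 * D^3) * (\<integral>\<^sup>+y. ennreal (2 powr q / (1 - 2 powr (-q))) * ennreal (f y powr p) \<partial>M)"
    proof (rule mult_left_mono, rule nn_integral_mono)
      fix y
      have "(\<Sum>i. ennreal (2 powr (?k i * q)) * (ennreal (f y) * indicator (S i) y))
        = ennreal (f y) * (\<Sum>i. if 2 powr (?k i - 1) < f y then ennreal (2 powr (?k i * q)) else 0)"
        by (subst suminf_indicator_cmult) (simp add: S_def)
      also have "\<dots> \<le> ennreal (f y) * ennreal ((2 * f y) powr q / (1 - 2 powr (-q)))"
        by (intro mult_left_mono suminf_int_powr_le q f) auto
      also have "\<dots> = ennreal (2 powr q / (1 - 2 powr (-q)) * (f y * f y powr q))"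
        using q1 f[of y] by (subst ennreal_mult''[symmetric]) (auto simp: powr_mult mult_ac)
      also have "f y * f y powr q = f y powr p"
        using f[of y] by (cases "f y = 0") (auto simp: q_def powr_diff)
      also have "ennreal (2 powr q / (1 - 2 powr (-q)) * f y powr p)
        = ennreal (2 powr q / (1 - 2 powr (-q))) * ennreal (f y powr p)"
        using q1 by (intro ennreal_mult) auto
      finally show "(\<Sum>i. ennreal (2 powr (?k i * q)) * (ennreal (f y) * indicator (S i) y))
        \<le> ennreal (2 powr q / (1 - 2 powr (-q))) * ennreal (f y powr p)" .
    qed simp
    also have "\<dots> = ennreal C * (\<integral>\<^sup>+x. ennreal (f x powr p) \<partial>M)"
    proof -
      have "ennreal C = ennreal (2 * D^3) * ennreal (2 powr q / (1 - 2 powr (-q)))"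
        unfolding C_def using D_ge_1 q1 by (intro ennreal_mult) auto
      moreover have "(\<lambda>y. ennreal (f y powr p)) \<in> borel_measurable M" by measurable
      ultimately show ?thesis by (simp only: nn_integral_cmult mult.assoc)
    qed
    finally show ?thesis .
  qed
  then show ?thesis using C by blast
qed

subsection \<open>Fractional integrals with respect to a doubling measure\<close>

lemma dist_measurable_M [measurable]: "(\<lambda>y. dist x y) \<in> borel_measurable M"
  using dist_lebesgue_measurable[of x] by (simp cong: measurable_cong_sets add: sets_M)

lemma V_dist_measurable [measurable]: "(\<lambda>y. V x (dist x y)) \<in> borel_measurable M"
proof -
  have "mono (V x)" by (intro monoI V_mono) auto
  then have "V x \<in> borel_measurable borel" by (rule borel_measurable_mono)
  then show ?thesis using measurable_compose[OF dist_measurable_M] by simp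
qed

text \<open>The number \<open>m\<close> stands for the value of the maximal function at x. On the
  shell of outer radius r_j = \<rho>/2^j the kernel is at most (V(x,r_j)/D)^(\<theta>-1), and the
  mean bound leaves m * V(x,r_j)^\<theta>, which decays like \<eta>^(\<theta>*j) by reverse
  doubling.\<close>

lemma kernel_near:
  assumes \<theta>: "0 < \<theta>" "\<theta> < 1"
  shows "\<exists>C>0. \<forall>f x \<rho> m. f \<in> borel_measurable M \<longrightarrow> (\<forall>y. 0 \<le> f y) \<longrightarrow> 0 < \<rho> \<longrightarrow> 0 \<le> m \<longrightarrow>
     (\<forall>r. 0 < r \<longrightarrow> (\<integral>\<^sup>+y\<in>cball x r. ennreal (f y) \<partial>M) \<le> ennreal (m * V x r)) \<longrightarrow>
     (\<integral>\<^sup>+y\<in>cball x \<rho>. ennreal (f y * V x (dist x y) powr (\<theta>-1)) \<partial>M) \<le> ennreal (C * m * V x \<rho> powr \<theta>)"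
proof -
  let ?K = "\<lambda>x y. V x (dist x y) powr (\<theta>-1)"
  have q: "0 < \<eta> powr \<theta>" "\<eta> powr \<theta> < 1" using \<eta>_bounds \<theta> powr_less_mono2[of \<theta> \<eta> 1] by auto
  define C where "C = D powr (1-\<theta>) / (1 - \<eta> powr \<theta>)"
  have C: "C > 0" unfolding C_def using D_ge_1 q by auto
  have "(\<integral>\<^sup>+y\<in>cball x \<rho>. ennreal (f y * ?K x y) \<partial>M) \<le> ennreal (C * m * V x \<rho> powr \<theta>)"
    if f: "f \<in> borel_measurable M" "\<And>y. 0 \<le> f y" and \<rho>: "0 < \<rho>" and m: "0 \<le> m"
      and avg: "\<And>r. 0 < r \<Longrightarrow> (\<integral>\<^sup>+y\<in>cball x r. ennreal (f y) \<partial>M) \<le> ennreal (m * V x r)" for f x \<rho> m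
  proof -
    let ?r = "\<lambda>j. (1/2)^j * \<rho>"
    have r: "0 < ?r j" for j using \<rho> by simp
    have "(\<integral>\<^sup>+y\<in>cball x \<rho>. ennreal (f y * ?K x y) \<partial>M)
        \<le> (\<Sum>j. ennreal ((V x (?r j) / D) powr (\<theta>-1) * (m * V x (?r j))))"
    proof (rule nn_integral_shells_le[where B="\<lambda>j. cball x (?r j)"])
      fix y assume y: "y \<in> cball x \<rho>"
      show "?K x y \<le> 0 \<or> (\<exists>j. y \<in> cball x (?r j) \<and>
          ?K x y \<le> (V x (?r j) / D) powr (\<theta>-1))"
      proof (cases "y = x")
        case True
        then show ?thesis using V_dist_0[of x] by simp
      next
        case False
        then obtain j where j: "dist x y \<le> ?r j" "?r (Suc j) < dist x y"
          using dyadic_shell_inner[of "dist x y" \<rho>] y by auto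
        have "V x (?r j) \<le> D * V x (?r (Suc j))"
          using doubling[of "?r (Suc j)" x] \<rho> by simp
        also have "\<dots> \<le> D * V x (dist x y)"
          using j D_ge_1 by (intro mult_left_mono V_mono) auto
        finally have "V x (?r j) / D \<le> V x (dist x y)" using D_ge_1 by (simp add: field_simps)
        then have "?K x y \<le> (V x (?r j) / D) powr (\<theta>-1)"
          using V_pos[OF r] D_ge_1 \<theta> by (intro powr_mono2') auto
        then show ?thesis using j by auto
      qed
    qed (use f avg r in auto)
    also have "\<dots> \<le> ennreal (D powr (1-\<theta>) * m * V x \<rho> powr \<theta> / (1 - \<eta> powr \<theta>))"
    proof (rule ennreal_suminf_geometric_le)
      fix j
      have V: "0 < V x (?r j)" by (rule V_pos[OF r])
      have "(V x (?r j) / D) powr (\<theta>-1) * (m * V x (?r j)) = D powr (1-\<theta>) * m * V x (?r j) powr \<theta>"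
        using V D_ge_1 by (simp add: powr_divide powr_diff field_simps)
      also have "\<dots> \<le> D powr (1-\<theta>) * m * (\<eta>^j * V x \<rho>) powr \<theta>"
        using V_shrink_pow[OF \<rho>, of x j] \<theta> m V by (intro mult_left_mono powr_mono2) auto
      also have "(\<eta>^j * V x \<rho>) powr \<theta> = V x \<rho> powr \<theta> * (\<eta> powr \<theta>)^j"
        using \<eta>_bounds by (simp add: powr_mult powr_realpow[symmetric] powr_powr mult.commute)
      finally show "(V x (?r j) / D) powr (\<theta>-1) * (m * V x (?r j)) \<le>
          D powr (1-\<theta>) * m * V x \<rho> powr \<theta> * (\<eta> powr \<theta>)^j" by simp
    qed (use q m in auto)
    finally show ?thesis by (simp add: C_def)
  qed
  then show ?thesis using C by blast
qed

lemma ball_Holder: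
  fixes f :: "'a \<Rightarrow> real"
  assumes f: "f \<in> borel_measurable M" "\<And>y. 0 \<le> f y" and p: "1 < p" and N: "0 \<le> N"
    and r: "(\<integral>\<^sup>+y\<in>cball x r. ennreal (f y powr p) \<partial>M) \<le> ennreal (N powr p * V x r powr \<kappa>)"
  shows "(\<integral>\<^sup>+y\<in>cball x r. ennreal (f y) \<partial>M) \<le> ennreal (2 * N * V x r powr (\<kappa>/p + 1 - 1/p))"
proof -
  have "(N powr p * V x r powr \<kappa>) powr (1/p) = N * V x r powr (\<kappa>/p)"
    using N p by (simp add: powr_mult powr_powr)
  moreover have "\<kappa>/p + (1 - 1/p) = \<kappa>/p + 1 - 1/p" by simp
  ultimately show ?thesis
    using nn_integral_le_powr_mean[OF f _ _ p _ r] ball_finite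
    by (simp add: powr_add[symmetric] mult.assoc add_diff_eq)
qed

text \<open>Hoelder on the ball of radius 2^(j+1)*\<rho> gives V^d with d = \<kappa>/p + 1 - 1/p;
  the kernel gives V^(\<theta>-1). The product is V^(-\<epsilon>) with \<epsilon> = 1/p - \<theta> -
  \<kappa>/p > 0, and reverse doubling makes it decay geometrically outwards. The exponent \<kappa>
  allows two uses: \<kappa> = 0 for functions in L^p, and \<kappa> of the Morrey space.\<close>

lemma kernel_far:
  assumes p: "1 < p" and \<theta>: "\<theta> < 1" and \<kappa>: "0 \<le> \<kappa>" "\<kappa>/p < 1/p - \<theta>"
  shows "\<exists>C>0. \<forall>f x \<rho> N. f \<in> borel_measurable M \<longrightarrow> (\<forall>y. 0 \<le> f y) \<longrightarrow> 0 < \<rho> \<longrightarrow> 0 \<le> N \<longrightarrow>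
     (\<forall>r. 0 < r \<longrightarrow> (\<integral>\<^sup>+y\<in>cball x r. ennreal (f y powr p) \<partial>M) \<le> ennreal (N powr p * V x r powr \<kappa>)) \<longrightarrow>
     (\<integral>\<^sup>+y\<in>- cball x \<rho>. ennreal (f y * V x (dist x y) powr (\<theta>-1)) \<partial>M)
       \<le> ennreal (C * N * V x \<rho> powr (\<kappa>/p + \<theta> - 1/p))"
proof -
  let ?K = "\<lambda>x y. V x (dist x y) powr (\<theta>-1)"
  define \<epsilon> where "\<epsilon> = 1/p - \<theta> - \<kappa>/p"
  have \<epsilon>: "\<epsilon> > 0" using \<kappa> by (simp add: \<epsilon>_def)
  define d where "d = \<kappa>/p + 1 - 1/p"
  have d: "d \<ge> 0" using \<kappa> p unfolding d_def by (simp add: add_nonneg_nonneg add_diff_eq[symmetric])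
  have q: "0 < \<eta> powr \<epsilon>" "\<eta> powr \<epsilon> < 1" using \<eta>_bounds \<epsilon> powr_less_mono2[of \<epsilon> \<eta> 1] by auto
  define C where "C = 2 * D powr d / (1 - \<eta> powr \<epsilon>)"
  have C: "C > 0" unfolding C_def using D_ge_1 q by auto
  have "(\<integral>\<^sup>+y\<in>- cball x \<rho>. ennreal (f y * ?K x y) \<partial>M)
       \<le> ennreal (C * N * V x \<rho> powr (-\<epsilon>))"
    if f: "f \<in> borel_measurable M" "\<And>y. 0 \<le> f y" and \<rho>: "0 < \<rho>" and N: "0 \<le> N"
      and mor: "\<And>r. 0 < r \<Longrightarrow> (\<integral>\<^sup>+y\<in>cball x r. ennreal (f y powr p) \<partial>M) \<le> ennreal (N powr p * V x r powr \<kappa>)"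
    for f x \<rho> N
  proof -
    let ?r = "\<lambda>j. 2^j * \<rho>"
    have r: "0 < ?r j" for j using \<rho> by simp
    have "(\<integral>\<^sup>+y\<in>- cball x \<rho>. ennreal (f y * ?K x y) \<partial>M)
        \<le> (\<Sum>j. ennreal (V x (?r j) powr (\<theta>-1) * (2 * N * V x (?r (Suc j)) powr d)))"
    proof (rule nn_integral_shells_le[where B="\<lambda>j. cball x (?r (Suc j))"])
      fix y assume y: "y \<in> - cball x \<rho>"
      then obtain j where j: "?r j < dist x y" "dist x y \<le> ?r (Suc j)"
        using dyadic_shell_outer[OF \<rho>, of "dist x y"] by auto
      have "?K x y \<le> V x (?r j) powr (\<theta>-1)"
        using V_pos[OF r] j \<theta> by (intro powr_mono2' V_mono) auto
      then show "?K x y \<le> 0 \<or> (\<exists>j. y \<in> cball x (?r (Suc j)) \<and>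
          ?K x y \<le> V x (?r j) powr (\<theta>-1))" using j by auto
    next
      fix j
      show "(\<integral>\<^sup>+y\<in>cball x (?r (Suc j)). ennreal (f y) \<partial>M) \<le> ennreal (2 * N * V x (?r (Suc j)) powr d)"
        unfolding d_def by (rule ball_Holder[OF f p N mor[OF r]])
    qed (use f in auto)
    also have "\<dots> \<le> ennreal (2 * N * D powr d * V x \<rho> powr (-\<epsilon>) / (1 - \<eta> powr \<epsilon>))"
    proof (rule ennreal_suminf_geometric_le)
      fix j
      have V: "0 < V x (?r j)" by (rule V_pos[OF r])
      have "V x (?r (Suc j)) powr d \<le> (D * V x (?r j)) powr d"
        using doubling[OF r, of x j] d by (intro powr_mono2) (auto simp: mult_ac)
      also have "\<dots> = D powr d * V x (?r j) powr d" using D_ge_1 by (simp add: powr_mult)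
      finally have "V x (?r j) powr (\<theta>-1) * (2 * N * V x (?r (Suc j)) powr d)
          \<le> V x (?r j) powr (\<theta>-1) * (2 * N * (D powr d * V x (?r j) powr d))"
        using N by (intro mult_left_mono) auto
      also have "\<dots> = 2 * N * D powr d * V x (?r j) powr (\<theta>-1+d)"
        by (simp add: powr_add)
      also have "\<theta>-1+d = -\<epsilon>" by (simp add: d_def \<epsilon>_def)
      also have "2 * N * D powr d * V x (?r j) powr (-\<epsilon>) \<le> 2 * N * D powr d * (V x \<rho> / \<eta>^j) powr (-\<epsilon>)"
      proof -
        have "V x \<rho> / \<eta>^j \<le> V x (?r j)"
          using V_reverse_pow[OF \<rho>, of x j] \<eta>_bounds by (simp add: field_simps)
        then show ?thesis using V_pos[OF \<rho>] \<eta>_bounds \<epsilon> N by (intro mult_left_mono powr_mono2') auto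
      qed
      also have "(V x \<rho> / \<eta>^j) powr (-\<epsilon>) = V x \<rho> powr (-\<epsilon>) * (\<eta> powr \<epsilon>)^j"
        using \<eta>_bounds by (simp add: powr_divide powr_realpow[symmetric] powr_powr mult.commute powr_minus field_simps)
      finally show "V x (?r j) powr (\<theta>-1) * (2 * N * V x (?r (Suc j)) powr d)
          \<le> 2 * N * D powr d * V x \<rho> powr (-\<epsilon>) * (\<eta> powr \<epsilon>)^j" by simp
    qed (use q N in auto)
    finally show ?thesis by (simp add: C_def mult_ac)
  qed
  moreover have "\<kappa>/p + \<theta> - 1/p = -\<epsilon>" by (simp add: \<epsilon>_def)
  ultimately show ?thesis using C by (simp only:) blast
qed

text \<open>\<open>V x\<close> may jump past T, so the intermediate value theorem is replaced by a
  search through dyadic radii, which costs one doubling. Reverse doubling guarantees that the search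
  ends, outwards as well as inwards.\<close>

lemma radius_exists:
  assumes T: "0 < T"
  shows "\<exists>\<rho>>0. V x \<rho> \<le> T \<and> T \<le> D * V x \<rho>"
proof (cases "V x 1 \<le> T")
  case True
  obtain j where "\<eta>^j < V x 1 / T"
    using real_arch_pow_inv[of "V x 1 / T" \<eta>] V_pos[of 1 x] T \<eta>_bounds by auto
  then have "T * \<eta>^j < V x 1" using T by (simp add: field_simps)
  also have "\<dots> \<le> \<eta>^j * V x (2^j)" using V_reverse_pow[of 1 x j] by simp
  finally have "T < V x (2^j)" using \<eta>_bounds by (simp add: mult.commute)
  \<comment> \<open>The predecessor of this first radius beyond T is the witness, and one doubling
    joins the two.\<close>
  then have *: "T < V x (2^(LEAST j. T < V x (2^j)))" (is "T < V x (2^?m)")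
    by (rule LeastI)
  then have "?m \<noteq> 0" using True by (intro notI) simp
  then obtain i where i: "?m = Suc i" using not0_implies_Suc by blast
  then have "\<not> T < V x (2^i)" by (metis lessI not_less_Least)
  moreover have "V x (2^?m) \<le> D * V x (2^i)" using doubling[of "2^i" x] i by simp
  ultimately show ?thesis using * by (intro exI[of _ "2^i"]) auto
next
  case False
  obtain j where "\<eta>^j < T / V x 1"
    using real_arch_pow_inv[of "T / V x 1" \<eta>] V_pos[of 1 x] T \<eta>_bounds by auto
  then have "\<eta>^j * V x 1 < T" using V_pos[of 1 x] by (simp add: field_simps)
  then have "V x ((1/2)^j) \<le> T" using V_shrink_pow[of 1 x j] by simp
  then have *: "V x ((1/2)^(LEAST j. V x ((1/2)^j) \<le> T)) \<le> T" (is "V x ((1/2)^?m) \<le> T")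
    by (rule LeastI)
  then have "?m \<noteq> 0" using False by (intro notI) simp
  then obtain i where i: "?m = Suc i" using not0_implies_Suc by blast
  then have "\<not> V x ((1/2)^i) \<le> T" by (metis lessI not_less_Least)
  moreover have "V x ((1/2)^i) \<le> D * V x ((1/2)^?m)" using doubling[of "(1/2)^?m" x] i by simp
  ultimately show ?thesis using * by (intro exI[of _ "(1/2)^?m"]) auto
qed

text \<open>Hedberg's inequality: the radius at which the kernel is split balances the maximal
  function bound of the inner part against the \<open>L\<^sup>p\<close> bound of the outer part.\<close>
lemma Hedberg_pointwise:
  assumes p: "1 < p" and \<theta>: "0 < \<theta>" "\<theta> < 1/p"
  shows "\<exists>C>0. \<forall>f x F m. f \<in> borel_measurable M \<longrightarrow> (\<forall>y. 0 \<le> f y) \<longrightarrow> 0 < F \<longrightarrow> 0 < m \<longrightarrow>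
     (\<integral>\<^sup>+y. ennreal (f y powr p) \<partial>M) \<le> ennreal (F powr p) \<longrightarrow>
     x \<notin> superlevel (\<lambda>y. ennreal (f y)) m \<longrightarrow>
     (\<integral>\<^sup>+y. ennreal (f y * V x (dist x y) powr (\<theta>-1)) \<partial>M) \<le> ennreal (C * F powr (p*\<theta>) * m powr (1 - p*\<theta>))"
proof -
  let ?K = "\<lambda>x y. V x (dist x y) powr (\<theta>-1)"
  have \<theta>1: "\<theta> < 1" using \<theta> p by (smt (verit) divide_less_eq_1)
  obtain C1 where C1: "C1 > 0" "\<And>f x \<rho> m. f \<in> borel_measurable M \<Longrightarrow> (\<And>y. 0 \<le> f y) \<Longrightarrow> 0 < \<rho> \<Longrightarrow> 0 \<le> m \<Longrightarrow>
     (\<And>r. 0 < r \<Longrightarrow> (\<integral>\<^sup>+y\<in>cball x r. ennreal (f y) \<partial>M) \<le> ennreal (m * V x r)) \<Longrightarrow>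
     (\<integral>\<^sup>+y\<in>cball x \<rho>. ennreal (f y * ?K x y) \<partial>M) \<le> ennreal (C1 * m * V x \<rho> powr \<theta>)"
    using kernel_near[OF \<theta>(1) \<theta>1] by blast
  \<comment> \<open>For \<kappa> = 0 the hypothesis of \<open>kernel_far\<close> on balls is just a
    global L^p bound, as \<open>V x r powr 0 = 1\<close>.\<close>
  have "0/p < 1/p - \<theta>" using \<theta> by simp
  then obtain C2 where C2: "C2 > 0" "\<And>f x \<rho> N. f \<in> borel_measurable M \<Longrightarrow> (\<And>y. 0 \<le> f y) \<Longrightarrow> 0 < \<rho> \<Longrightarrow> 0 \<le> N \<Longrightarrow>
     (\<And>r. 0 < r \<Longrightarrow> (\<integral>\<^sup>+y\<in>cball x r. ennreal (f y powr p) \<partial>M) \<le> ennreal (N powr p * V x r powr 0)) \<Longrightarrow>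
     (\<integral>\<^sup>+y\<in>- cball x \<rho>. ennreal (f y * ?K x y) \<partial>M)
       \<le> ennreal (C2 * N * V x \<rho> powr (0/p + \<theta> - 1/p))"
    using kernel_far[OF p \<theta>1, of 0] by blast
  define e where "e = 1/p - \<theta>"
  have e: "e > 0" using \<theta> by (simp add: e_def)
  define C where "C = C1 + C2 * D powr e"
  have C: "C > 0" unfolding C_def using C1(1) C2(1) by (simp add: add_pos_nonneg)
  have "(\<integral>\<^sup>+y. ennreal (f y * ?K x y) \<partial>M) \<le> ennreal (C * F powr (p*\<theta>) * m powr (1 - p*\<theta>))"
    if f [measurable]: "f \<in> borel_measurable M" and f0: "\<And>y. 0 \<le> f y" and F: "0 < F" and m: "0 < m"
      and fF: "(\<integral>\<^sup>+y. ennreal (f y powr p) \<partial>M) \<le> ennreal (F powr p)"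
      and x: "x \<notin> superlevel (\<lambda>y. ennreal (f y)) m" for f x F m
  proof -
    \<comment> \<open>The volume at which the inner bound m * T^\<theta> equals the outer bound F *
      T^(-(1/p-\<theta>)).\<close>
    define T where "T = (F/m) powr p"
    have T: "T > 0" using F m by (simp add: T_def)
    obtain \<rho> where \<rho>: "0 < \<rho>" "V x \<rho> \<le> T" "T \<le> D * V x \<rho>" using radius_exists[OF T] by blast
    let ?X = "F powr (p*\<theta>) * m powr (1 - p*\<theta>)"
    have TX1: "m * T powr \<theta> = ?X"
      using F m by (simp add: T_def powr_powr powr_divide powr_diff field_simps)
    have pe: "p * e = 1 - p*\<theta>" using p by (simp add: e_def field_simps)
    have "F * T powr (-e) = F * (F/m) powr (-(1 - p*\<theta>))"
      using pe by (simp add: T_def powr_powr)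
    also have "\<dots> = ?X"
      using F m by (simp add: powr_divide powr_minus powr_diff field_simps)
    finally have TX2: "F * T powr (-e) = ?X" .
    have near: "(\<integral>\<^sup>+y\<in>cball x \<rho>. ennreal (f y * ?K x y) \<partial>M) \<le> ennreal (C1 * ?X)"
    proof -
      have "(\<integral>\<^sup>+y\<in>cball x \<rho>. ennreal (f y * ?K x y) \<partial>M) \<le> ennreal (C1 * m * V x \<rho> powr \<theta>)"
      proof (rule C1(2)[OF f f0 \<rho>(1)])
        fix r :: real assume "0 < r"
        then show "(\<integral>\<^sup>+y\<in>cball x r. ennreal (f y) \<partial>M) \<le> ennreal (m * V x r)"
          using not_in_superlevelD[OF x, of r] m by (simp add: emeasure_cball_eq ennreal_mult)
      qed (use m in auto)
      also have "\<dots> \<le> ennreal (C1 * m * T powr \<theta>)"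
        using \<rho> C1(1) m \<theta> by (intro ennreal_leI mult_left_mono powr_mono2) auto
      finally show ?thesis using TX1 by (simp add: mult.assoc)
    qed
    have far: "(\<integral>\<^sup>+y\<in>- cball x \<rho>. ennreal (f y * ?K x y) \<partial>M) \<le> ennreal (C2 * D powr e * ?X)"
    proof -
      have "(\<integral>\<^sup>+y\<in>- cball x \<rho>. ennreal (f y * ?K x y) \<partial>M)
          \<le> ennreal (C2 * F * V x \<rho> powr (0/p + \<theta> - 1/p))"
      proof (rule C2(2)[OF f f0 \<rho>(1)])
        fix r :: real assume r: "0 < r"
        have "(\<integral>\<^sup>+y\<in>cball x r. ennreal (f y powr p) \<partial>M) \<le> (\<integral>\<^sup>+y. ennreal (f y powr p) \<partial>M)"
          by (intro nn_integral_mono) (auto simp: indicator_def)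
        then show "(\<integral>\<^sup>+y\<in>cball x r. ennreal (f y powr p) \<partial>M) \<le> ennreal (F powr p * V x r powr 0)"
          using fF V_pos[OF r, of x] by simp
      qed (use F in auto)
      also have "0/p + \<theta> - 1/p = -e" by (simp add: e_def)
      also have "ennreal (C2 * F * V x \<rho> powr (-e)) \<le> ennreal (C2 * F * (T/D) powr (-e))"
      proof -
        have "T/D \<le> V x \<rho>" using \<rho>(3) D_ge_1 by (simp add: field_simps)
        then show ?thesis using C2(1) F T D_ge_1 e
          by (intro ennreal_leI mult_left_mono powr_mono2') auto
      qed
      also have "C2 * F * (T/D) powr (-e) = C2 * D powr e * (F * T powr (-e))"
        using T D_ge_1 by (simp add: powr_divide powr_minus field_simps)
      finally show ?thesis using TX2 by simp
    qed
    have "(\<integral>\<^sup>+y. ennreal (f y * ?K x y) \<partial>M)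
      = (\<integral>\<^sup>+y\<in>cball x \<rho>. ennreal (f y * ?K x y) \<partial>M)
        + (\<integral>\<^sup>+y\<in>- cball x \<rho>. ennreal (f y * ?K x y) \<partial>M)"
      by (rule nn_integral_split_near_far[OF _ sets_M]) measurable
    also have "\<dots> \<le> ennreal (C1 * ?X) + ennreal (C2 * D powr e * ?X)"
      by (intro add_mono near far)
    also have "\<dots> = ennreal (C * ?X)"
      using C1(1) C2(1) by (simp add: C_def ennreal_plus[symmetric] distrib_right del: ennreal_plus)
    finally show ?thesis by (simp add: mult.assoc)
  qed
  then show ?thesis using C by blast
qed

text \<open>Hedberg's inequality bounds the potential by F^(p*\<theta>) times the power 1 -
  p*\<theta> = p/s of the maximal function. Its s-th power is thus a multiple of the p-th power of
  the maximal function, which \<open>maximal_pow_integral\<close> integrates. Accordingly g is a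
  multiple of \<open>maximal_pow p f\<close> to the power 1/s.\<close>

theorem fractional_integral_strong_type:
  assumes p: "1 < p" and \<theta>: "0 < \<theta>" "\<theta> < 1/p" and s: "1/s = 1/p - \<theta>"
  shows "\<exists>C>0. \<forall>f F. f \<in> borel_measurable M \<longrightarrow> (\<forall>y. 0 \<le> f y) \<longrightarrow> 0 < F \<longrightarrow>
     (\<integral>\<^sup>+y. ennreal (f y powr p) \<partial>M) \<le> ennreal (F powr p) \<longrightarrow>
     (\<exists>g. g \<in> borel_measurable M \<and> (\<forall>x. 0 \<le> g x) \<and>
       (AE x in M. (\<integral>\<^sup>+y. ennreal (f y * V x (dist x y) powr (\<theta>-1)) \<partial>M) \<le> ennreal (g x)) \<and>
       (\<integral>\<^sup>+x. ennreal (g x powr s) \<partial>M) \<le> ennreal (C * F powr s))"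
proof -
  let ?K = "\<lambda>x y. V x (dist x y) powr (\<theta>-1)"
  have s0: "s > 0" using s \<theta> by (metis diff_gt_0_iff_gt zero_less_divide_1_iff)
  obtain C1 where C1: "C1 > 0" "\<And>f x F m. f \<in> borel_measurable M \<Longrightarrow> (\<And>y. 0 \<le> f y) \<Longrightarrow> 0 < F \<Longrightarrow> 0 < m \<Longrightarrow>
     (\<integral>\<^sup>+y. ennreal (f y powr p) \<partial>M) \<le> ennreal (F powr p) \<Longrightarrow>
     x \<notin> superlevel (\<lambda>y. ennreal (f y)) m \<Longrightarrow>
     (\<integral>\<^sup>+y. ennreal (f y * ?K x y) \<partial>M) \<le> ennreal (C1 * F powr (p*\<theta>) * m powr (1 - p*\<theta>))"
    using Hedberg_pointwise[OF p \<theta>] by blast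
  obtain C2 where C2: "C2 > 0" "\<And>f. f \<in> borel_measurable M \<Longrightarrow> (\<And>y. 0 \<le> f y) \<Longrightarrow>
      (\<integral>\<^sup>+x. maximal_pow p f x \<partial>M) \<le> ennreal C2 * (\<integral>\<^sup>+x. ennreal (f x powr p) \<partial>M)"
    using maximal_pow_integral[OF p] by blast
  have p\<theta>: "1 - p*\<theta> = p/s" "0 < 1 - p*\<theta>"
  proof -
    have "p/s = p * (1/s)" by simp
    also have "\<dots> = 1 - p*\<theta>" unfolding s using p by (simp add: field_simps)
    finally show "1 - p*\<theta> = p/s" by simp
    then show "0 < 1 - p*\<theta>" using p s0 by simp
  qed
  define C where "C = (C1 * 2 powr (1 - p*\<theta>)) powr s * C2"
  have C: "C > 0" unfolding C_def using C1(1) C2(1) by auto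
  have "\<exists>g. g \<in> borel_measurable M \<and> (\<forall>x. 0 \<le> g x) \<and>
       (AE x in M. (\<integral>\<^sup>+y. ennreal (f y * ?K x y) \<partial>M) \<le> ennreal (g x)) \<and>
       (\<integral>\<^sup>+x. ennreal (g x powr s) \<partial>M) \<le> ennreal (C * F powr s)"
    if f [measurable]: "f \<in> borel_measurable M" and f0: "\<And>y. 0 \<le> f y" and F: "0 < F"
      and fF: "(\<integral>\<^sup>+y. ennreal (f y powr p) \<partial>M) \<le> ennreal (F powr p)" for f F
  proof -
    let ?G = "maximal_pow p f"
    define c where "c = C1 * F powr (p*\<theta>) * 2 powr (1 - p*\<theta>)"
    have c: "c > 0" using C1 F by (simp add: c_def)
    define g where "g x = c * enn2real (?G x) powr (1/s)" for x
    have intG: "(\<integral>\<^sup>+x. ?G x \<partial>M) \<le> ennreal (C2 * F powr p)"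
    proof -
      have "(\<integral>\<^sup>+x. ?G x \<partial>M) \<le> ennreal C2 * (\<integral>\<^sup>+x. ennreal (f x powr p) \<partial>M)" by (rule C2(2)[OF f f0])
      also have "\<dots> \<le> ennreal C2 * ennreal (F powr p)" using fF by (rule mult_left_mono) simp
      finally show ?thesis using C2(1) by (simp add: ennreal_mult)
    qed
    have gm: "g \<in> borel_measurable M" unfolding g_def by measurable
    have "(\<integral>\<^sup>+x. ?G x \<partial>M) \<noteq> \<infinity>" using intG by (auto simp: top_unique)
    then have fin: "AE x in M. ?G x \<noteq> \<infinity>" by (intro nn_integral_PInf_AE) auto
    have pw: "(\<integral>\<^sup>+y. ennreal (f y * ?K x y) \<partial>M) \<le> ennreal (g x)" if Gx: "?G x \<noteq> \<infinity>" for x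
    proof (rule ennreal_le_epsilon)
      fix e :: real assume e: "0 < e"
      define h where "h = enn2real (?G x)"
      have h: "?G x = ennreal h" "h \<ge> 0" using Gx by (auto simp: h_def less_top)
      \<comment> \<open>A strict excess over h is what excludes x from a superlevel set below, and
        it keeps the level positive when h = 0. It is tuned so that the resulting bound is exactly g
        x + e.\<close>
      define h' where "h' = (h powr (1/s) + e/c) powr s"
      have hpos: "0 < h powr (1/s) + e/c" using e c by (simp add: add_nonneg_pos)
      have h'0: "h' > 0" unfolding h'_def using hpos by simp
      have "h = (h powr (1/s)) powr s" using h(2) s0 by (simp add: powr_powr)
      also have "\<dots> < h'" unfolding h'_def using e c s0 by (intro powr_less_mono2) auto
      finally have hh': "h < h'" .
      \<comment> \<open>\<open>maximal_pow\<close> records dyadic levels only, so the level is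
        rounded up to a power of 2. The loss is the power of 2 in \<open>c\<close>.\<close>
      define k where "k = \<lceil>log 2 (h' powr (1/p))\<rceil>"
      define m where "m = 2 powr real_of_int k"
      have m1: "h' powr (1/p) \<le> m"
      proof -
        have "log 2 (h' powr (1/p)) \<le> real_of_int k" unfolding k_def by linarith
        then show ?thesis unfolding m_def using h'0 by (simp add: log_le_iff)
      qed
      have m2: "m \<le> 2 * h' powr (1/p)"
      proof -
        have "real_of_int k \<le> 1 + log 2 (h' powr (1/p))" unfolding k_def by linarith
        then have "m \<le> 2 powr (1 + log 2 (h' powr (1/p)))" unfolding m_def by simp
        also have "\<dots> = 2 * h' powr (1/p)" using h'0 by (simp only: powr_add) simp
        finally show ?thesis .
      qed
      \<comment> \<open>Otherwise the one summand m^p >= h' > h would exceed the whole series, whose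
        value is h.\<close>
      have x: "x \<notin> superlevel (\<lambda>y. ennreal (f y)) m"
      proof
        assume xin: "x \<in> superlevel (\<lambda>y. ennreal (f y)) m"
        let ?t = "\<lambda>i. ennreal (2 powr (real_of_int (int_decode i) * p)) *
            indicator (superlevel (\<lambda>y. ennreal (f y)) (2 powr real_of_int (int_decode i))) x :: ennreal"
        have "h' = (h' powr (1/p)) powr p" using p h'0 by (simp add: powr_powr)
        also have "\<dots> \<le> m powr p" using m1 p by (intro powr_mono2) auto
        finally have "ennreal h' \<le> ennreal (m powr p)" by (rule ennreal_leI)
        also have "\<dots> = ?t (int_encode k)" using xin by (simp add: m_def powr_powr)
        also have "\<dots> \<le> suminf ?t" using sum_le_suminf[of ?t "{int_encode k}"] by simp
        also have "\<dots> = ennreal h" using h(1) by (simp add: maximal_pow_def)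
        finally show False using hh' h(2) by (simp add: ennreal_le_iff)
      qed
      have m0: "m > 0" by (simp add: m_def)
      have "(\<integral>\<^sup>+y. ennreal (f y * ?K x y) \<partial>M) \<le> ennreal (C1 * F powr (p*\<theta>) * m powr (1 - p*\<theta>))"
        by (rule C1(2)[OF f f0 F m0 fF x])
      also have "\<dots> \<le> ennreal (C1 * F powr (p*\<theta>) * (2 * h' powr (1/p)) powr (1 - p*\<theta>))"
        using C1(1) m0 m2 p\<theta>(2) by (intro ennreal_leI mult_left_mono powr_mono2) auto
      also have "C1 * F powr (p*\<theta>) * (2 * h' powr (1/p)) powr (1 - p*\<theta>) = c * h' powr (1/s)"
        using p by (simp add: c_def powr_mult powr_powr p\<theta>(1))
      also have "h' powr (1/s) = h powr (1/s) + e/c"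
        unfolding h'_def using hpos s0 by (simp add: powr_powr)
      also have "c * (h powr (1/s) + e/c) = g x + e" using c by (simp add: g_def h_def field_simps)
      also have "ennreal (g x + e) = ennreal (g x) + ennreal e"
        using e c by (intro ennreal_plus) (auto simp: g_def)
      finally show "(\<integral>\<^sup>+y. ennreal (f y * ?K x y) \<partial>M) \<le> ennreal (g x) + ennreal e" .
    qed
    have "(\<integral>\<^sup>+x. ennreal (g x powr s) \<partial>M) \<le> (\<integral>\<^sup>+x. ennreal (c powr s) * ?G x \<partial>M)"
    proof (rule nn_integral_mono_AE)
      show "AE x in M. ennreal (g x powr s) \<le> ennreal (c powr s) * ?G x"
        using fin
      proof eventually_elim
        case (elim x)
        have "g x powr s = c powr s * enn2real (?G x)"
          unfolding g_def using c s0 by (simp add: powr_mult powr_powr)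
        then have "ennreal (g x powr s) = ennreal (c powr s) * ennreal (enn2real (?G x))"
          by (simp add: ennreal_mult)
        also have "ennreal (enn2real (?G x)) = ?G x" using elim by (simp add: less_top)
        finally show ?case by simp
      qed
    qed
    also have "\<dots> = ennreal (c powr s) * (\<integral>\<^sup>+x. ?G x \<partial>M)" by (rule nn_integral_cmult) simp
    also have "\<dots> \<le> ennreal (c powr s) * ennreal (C2 * F powr p)"
      by (intro mult_left_mono intG) simp
    also have "\<dots> = ennreal (c powr s * (C2 * F powr p))"
      using C2(1) by (simp add: ennreal_mult)
    also have "c powr s * (C2 * F powr p) = C * F powr s"
    proof -
      \<comment> \<open>Homogeneity in F: Hedberg's inequality contributes F^(p*\<theta>*s), the
        maximal theorem F^p.\<close>
      have "p*\<theta> * s + p = s"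
      proof -
        have "p*\<theta> = 1 - p/s" using p\<theta>(1) by simp
        then show ?thesis using s0 by (simp add: field_simps)
      qed
      then have "F powr (p*\<theta> * s) * F powr p = F powr s" by (simp add: powr_add[symmetric])
      moreover have "c powr s = (C1 * 2 powr (1 - p*\<theta>)) powr s * F powr (p*\<theta> * s)"
        using C1(1) by (simp add: c_def powr_mult powr_powr mult_ac)
      ultimately show ?thesis by (simp add: C_def mult_ac)
    qed
    finally have "(\<integral>\<^sup>+x. ennreal (g x powr s) \<partial>M) \<le> ennreal (C * F powr s)" .
    moreover have "AE x in M. (\<integral>\<^sup>+y. ennreal (f y * ?K x y) \<partial>M) \<le> ennreal (g x)"
      using fin by eventually_elim (rule pw)
    moreover have "\<forall>x. 0 \<le> g x" using c by (simp add: g_def)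
    ultimately show ?thesis using gm by blast
  qed
  then show ?thesis using C by blast
qed

end

section \<open>Cubes and weighted measures\<close>

text \<open>\<open>ennreal\<close> cuts negative values of w to 0; for a weight they occur only on a
  null set.\<close>

definition wm :: "(real^'n \<Rightarrow> real) \<Rightarrow> (real^'n) measure" where
  "wm w = density lebesgue (\<lambda>x. ennreal (w x))"

lemma sets_wm [simp]: "sets (wm w) = sets lebesgue"
  by (simp add: wm_def)

lemma borel_measurable_wm [simp]: "borel_measurable (wm w) = borel_measurable lebesgue"
  by (rule measurable_cong_sets) auto

lemma weight_measurable: "weight w \<Longrightarrow> w \<in> borel_measurable lebesgue"
  by (simp add: weight_def loc_integrable_def)

lemma nn_integral_wm:
  assumes "weight w" "f \<in> borel_measurable lebesgue"
  shows "(\<integral>\<^sup>+x. f x \<partial>wm w) = (\<integral>\<^sup>+x. ennreal (w x) * f x \<partial>lebesgue)"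
  unfolding wm_def using assms weight_measurable[OF assms(1)] by (intro nn_integral_density) auto

lemma AE_wm_iff:
  assumes "weight w"
  shows "(AE x in wm w. P x) \<longleftrightarrow> (AE x in lebesgue. P x)"
proof -
  have "(AE x in wm w. P x) \<longleftrightarrow> (AE x in lebesgue. 0 < ennreal (w x) \<longrightarrow> P x)"
    unfolding wm_def using weight_measurable[OF assms] by (intro AE_density) auto
  also have "\<dots> \<longleftrightarrow> (AE x in lebesgue. P x)"
  proof
    have pos: "AE x in lebesgue. 0 < w x" using assms by (simp add: weight_def)
    assume "AE x in lebesgue. 0 < ennreal (w x) \<longrightarrow> P x"
    with pos show "AE x in lebesgue. P x" by eventually_elim auto
  next
    assume "AE x in lebesgue. P x"
    then show "AE x in lebesgue. 0 < ennreal (w x) \<longrightarrow> P x" by eventually_elim auto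
  qed
  finally show ?thesis .
qed

lemma compact_lebesgue_sets: "compact K \<Longrightarrow> K \<in> sets lebesgue"
  by (simp add: compact_imp_closed)

lemma emeasure_wm:
  assumes w: "weight w" and K: "compact K"
  shows "emeasure (wm w) K = ennreal (wmeas w K)"
proof -
  have int: "set_integrable lebesgue K w" using w K by (simp add: weight_def loc_integrable_def)
  have pos: "AE x in lebesgue. 0 < w x" using w by (simp add: weight_def)
  have "emeasure (wm w) K = (\<integral>\<^sup>+x\<in>K. ennreal (w x) \<partial>lebesgue)"
    unfolding wm_def using weight_measurable[OF w] compact_lebesgue_sets[OF K]
    by (intro emeasure_density) auto
  also have "\<dots> = (\<integral>\<^sup>+x. ennreal (indicator K x *\<^sub>R w x) \<partial>lebesgue)"
    by (intro nn_integral_cong) (auto simp: indicator_def)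
  also have "\<dots> = ennreal (integral\<^sup>L lebesgue (\<lambda>x. indicator K x *\<^sub>R w x))"
    using int pos unfolding set_integrable_def
    by (intro nn_integral_eq_integral) (auto simp: indicator_def elim: eventually_mono)
  finally show ?thesis by (simp add: wmeas_def set_lebesgue_integral_def)
qed

lemma wmeas_nonneg: "weight w \<Longrightarrow> 0 \<le> wmeas w K"
  unfolding wmeas_def set_lebesgue_integral_def weight_def
  by (intro integral_nonneg_AE) (auto simp: indicator_def elim: eventually_mono)

lemma measure_wm: "weight w \<Longrightarrow> compact K \<Longrightarrow> measure (wm w) K = wmeas w K"
  by (simp add: measure_def emeasure_wm wmeas_nonneg)

section \<open>Inclusions between cubes and balls\<close>

abbreviation cube :: "real^'n \<Rightarrow> real \<Rightarrow> (real^'n) set" where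
  "cube a h \<equiv> cbox a (a + h *\<^sub>R One)"

lemma cube_in_cubes: "0 < h \<Longrightarrow> cube a h \<in> cubes"
  unfolding cubes_def by blast

lemma mem_cube: "y \<in> cube a h \<longleftrightarrow> (\<forall>i\<in>Basis. a \<bullet> i \<le> y \<bullet> i \<and> y \<bullet> i \<le> a \<bullet> i + h)"
  by (simp add: mem_box inner_add_left)

lemma content_cube [simp]: "0 \<le> h \<Longrightarrow> measure lborel (cube (a::real^'n) h) = h ^ CARD('n)"
  by (subst content_cbox') (auto simp: inner_add_left box_ne_empty)

lemma dist_le_coordinates:
  fixes x y :: "real^'n"
  assumes "\<And>i. i \<in> Basis \<Longrightarrow> \<bar>x \<bullet> i - y \<bullet> i\<bar> \<le> d"
  shows "dist x y \<le> real CARD('n) * d"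
proof -
  have "dist x y \<le> (\<Sum>i\<in>Basis. \<bar>(x - y) \<bullet> i\<bar>)" unfolding dist_norm by (rule norm_le_l1)
  also have "\<dots> \<le> (\<Sum>i\<in>(Basis::(real^'n) set). d)"
    using assms by (intro sum_mono) (auto simp: inner_diff_left)
  also have "\<dots> = real CARD('n) * d" by simp
  finally show ?thesis .
qed

lemma coordinate_dist: "i \<in> Basis \<Longrightarrow> \<bar>x \<bullet> i - y \<bullet> i\<bar> \<le> dist x y"
  using Basis_le_norm[of i "x - y"] by (simp add: dist_norm inner_diff_left)

lemma cube_subset_cball:
  assumes "\<And>i. i \<in> Basis \<Longrightarrow> \<bar>z \<bullet> i - a \<bullet> i\<bar> \<le> d" "\<And>i. i \<in> Basis \<Longrightarrow> \<bar>z \<bullet> i - (a \<bullet> i + h)\<bar> \<le> d"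
  shows "cube a h \<subseteq> cball (z::real^'n) (real CARD('n) * d)"
proof
  fix y assume y: "y \<in> cube a h"
  have "dist z y \<le> real CARD('n) * d"
  proof (rule dist_le_coordinates)
    fix i :: "real^'n" assume "i \<in> Basis"
    then show "\<bar>z \<bullet> i - y \<bullet> i\<bar> \<le> d" using assms[of i] y by (auto simp: mem_cube)
  qed
  then show "y \<in> cball z (real CARD('n) * d)" by simp
qed

lemma cball_subset_cube:
  assumes "\<And>i. i \<in> Basis \<Longrightarrow> a \<bullet> i \<le> x \<bullet> i - r" "\<And>i. i \<in> Basis \<Longrightarrow> x \<bullet> i + r \<le> a \<bullet> i + h"
  shows "cball x r \<subseteq> cube a h"
proof
  fix y assume "y \<in> cball x r"
  then have "dist x y \<le> r" by simp
  show "y \<in> cube a h" unfolding mem_cube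
  proof
    fix i assume i: "i \<in> (Basis::(real^'a) set)"
    then show "a \<bullet> i \<le> y \<bullet> i \<and> y \<bullet> i \<le> a \<bullet> i + h"
      using assms[OF i] coordinate_dist[OF i, of x y] \<open>dist x y \<le> r\<close> by auto
  qed
qed

lemma cball_subset_centered_cube: "cball x r \<subseteq> cube (x - r *\<^sub>R One) (2 * r)"
  by (rule cball_subset_cube) (auto simp: inner_diff_left)

lemma centered_cube_subset_cball:
  "0 \<le> r \<Longrightarrow> cube (x - r *\<^sub>R One) (2 * r) \<subseteq> cball (x::real^'n) (real CARD('n) * r)"
  by (rule cube_subset_cball) (auto simp: inner_diff_left)

section \<open>\<open>A\<^sub>1\<close> weights\<close>

text \<open>The A_1 condition comes with an exceptional null set for each cube. Restricting to cubes
  with corner in a countable dense set and rational side leaves countably many null sets, and every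
  ball lies in such a cube of comparable size; so one null set serves all balls.\<close>

lemma A1_all_balls:
  fixes w :: "real^'n \<Rightarrow> real"
  assumes "A1 w"
  shows "\<exists>A>0. AE y in lebesgue. 0 < w y \<and>
      (\<forall>x r. 0 < r \<longrightarrow> y \<in> cball x r \<longrightarrow> measure (wm w) (cball x r) \<le> A * r ^ CARD('n) * w y)"
proof -
  have w: "weight w" using assms by (simp add: A1_def)
  obtain C where C: "\<And>Q. Q \<in> cubes \<Longrightarrow> AE x in lebesgue. x \<in> Q \<longrightarrow> avg Q w \<le> C * w x"
    using assms unfolding A1_def by blast
  \<comment> \<open>The maximum secures positivity; 4^n is the volume of a cube of side 4r divided
    by r^n.\<close>
  define A where "A = max C 1 * 4 ^ CARD('n)"
  have A: "A > 0" by (simp add: A_def)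
  obtain E :: "(real^'n) set" where E: "countable E" "\<And>X. open X \<Longrightarrow> X \<noteq> {} \<Longrightarrow> \<exists>d\<in>E. d \<in> X"
    by (rule countable_dense_setE) blast
  define H where "H = (\<rat> \<inter> {0<..} :: real set)"
  have H: "countable H" unfolding H_def using countable_rat by (intro countable_Int1)
  have "AE y in lebesgue. \<forall>(a,h)\<in>E \<times> H. y \<in> cube a h \<longrightarrow> avg (cube a h) w \<le> C * w y"
    by (subst AE_ball_countable) (use E H C in \<open>auto simp: H_def intro!: cube_in_cubes\<close>)
  moreover have "AE y in lebesgue. 0 < w y" using w by (simp add: weight_def)
  ultimately have "AE y in lebesgue. 0 < w y \<and>
      (\<forall>x r. 0 < r \<longrightarrow> y \<in> cball x r \<longrightarrow> measure (wm w) (cball x r) \<le> A * r ^ CARD('n) * w y)"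
  proof eventually_elim
    case (elim y)
    have "measure (wm w) (cball x r) \<le> A * r ^ CARD('n) * w y" if r: "0 < r" and y: "y \<in> cball x r" for x r
    proof -
      \<comment> \<open>A corner with coordinates between x - 2r and x - r and a side h between 3r
        and 4r make the cube contain the ball: a <= x - r and a + h >= x + r in each
        coordinate.\<close>
      have "x - (3/2 * r) *\<^sub>R One \<in> box (x - (2*r) *\<^sub>R One) (x - r *\<^sub>R One)"
        using r by (auto simp: mem_box inner_diff_left)
      then have "box (x - (2*r) *\<^sub>R One) (x - r *\<^sub>R One) \<noteq> {}" by blast
      then obtain a where a: "a \<in> E" "a \<in> box (x - (2*r) *\<^sub>R One) (x - r *\<^sub>R One)"
        using E(2)[OF open_box] by blast
      obtain h where h: "h \<in> \<rat>" "3*r < h" "h < 4*r" using Rats_dense_in_real[of "3*r" "4*r"] r by auto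
      have h0: "0 < h" using h r by linarith
      have sub: "cball x r \<subseteq> cube a h"
        using a(2) h by (intro cball_subset_cube) (force simp: mem_box inner_diff_left)+
      have av: "avg (cube a h) w \<le> C * w y"
        using elim a h h0 sub y by (auto simp: H_def)
      have "measure (wm w) (cball x r) \<le> measure (wm w) (cube a h)"
        using sub w by (intro measure_mono_fmeasurable) (auto simp: fmeasurable_def emeasure_wm)
      also have "\<dots> = avg (cube a h) w * h ^ CARD('n)"
        using w h0 by (simp add: avg_def measure_wm wmeas_def)
      also have "\<dots> \<le> (max C 1 * w y) * (4*r) ^ CARD('n)"
      proof (rule mult_mono)
        have "C * w y \<le> max C 1 * w y" using elim by (intro mult_right_mono) auto
        then show "avg (cube a h) w \<le> max C 1 * w y" using av by linarith
        show "h ^ CARD('n) \<le> (4*r) ^ CARD('n)" using h h0 by (intro power_mono) auto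
      qed (use elim h0 in auto)
      also have "\<dots> = A * r ^ CARD('n) * w y" by (simp add: A_def power_mult_distrib)
      finally show ?thesis .
    qed
    then show ?case using elim by blast
  qed
  then show ?thesis using A by blast
qed

lemma wmeas_le_powr_mean:
  fixes w :: "real^'n \<Rightarrow> real"
  assumes w: "weight w" and q: "1 < q" and Q: "compact Q"
    and int: "set_integrable lebesgue Q (\<lambda>x. w x powr q)"
  shows "wmeas w Q \<le> 2 * (LINT x:Q|lebesgue. w x powr q) powr (1/q) * measure lebesgue Q powr (1 - 1/q)"
proof -
  let ?I = "LINT x:Q|lebesgue. w x powr q"
  have [measurable]: "w \<in> borel_measurable lebesgue" using w by (rule weight_measurable)
  have QM: "Q \<in> sets lebesgue" using Q by (rule compact_lebesgue_sets)
  have pos: "AE x in lebesgue. 0 < w x" using w by (simp add: weight_def)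
  have I: "0 \<le> ?I" unfolding set_lebesgue_integral_def by (intro integral_nonneg_AE) auto
  \<comment> \<open>\<open>nn_integral_le_powr_mean\<close> asks for nonnegativity everywhere, a
    weight has it almost everywhere; the absolute value bridges this.\<close>
  have "(\<integral>\<^sup>+x\<in>Q. ennreal (\<bar>w x\<bar> powr q) \<partial>lebesgue) = (\<integral>\<^sup>+x. ennreal (indicator Q x *\<^sub>R (w x powr q)) \<partial>lebesgue)"
    using pos by (intro nn_integral_cong_AE) (auto simp: indicator_def elim: eventually_mono)
  also have "\<dots> = ennreal ?I"
    using int unfolding set_integrable_def set_lebesgue_integral_def
    by (intro nn_integral_eq_integral) (auto simp: indicator_def)
  finally have *: "(\<integral>\<^sup>+x\<in>Q. ennreal (\<bar>w x\<bar> powr q) \<partial>lebesgue) \<le> ennreal ?I" by simp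
  have "ennreal (wmeas w Q) = emeasure (wm w) Q" using w Q by (simp add: emeasure_wm)
  also have "\<dots> = (\<integral>\<^sup>+x\<in>Q. ennreal (w x) \<partial>lebesgue)"
    unfolding wm_def using QM by (intro emeasure_density) auto
  also have "\<dots> = (\<integral>\<^sup>+x\<in>Q. ennreal \<bar>w x\<bar> \<partial>lebesgue)"
    using pos by (intro nn_integral_cong_AE) (auto elim: eventually_mono)
  also have "\<dots> \<le> ennreal (2 * ?I powr (1/q) * measure lebesgue Q powr (1 - 1/q))"
    using lmeasurable_compact[OF Q] by (intro nn_integral_le_powr_mean * q I QM) (auto simp: fmeasurable_def)
  finally show ?thesis by (simp add: ennreal_le_iff)
qed

text \<open>The mean of w is at most twice its q-mean, and the pointwise lower bound for w^q
  survives taking the q-th root. The main theorem assumes A_1 for w^(s/p) only, while \<mu> = w dx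
  must be doubling as well.\<close>

lemma A1_of_A1_powr:
  fixes w :: "real^'n \<Rightarrow> real"
  assumes w: "weight w" and q: "1 < q" and A1: "A1 (\<lambda>x. w x powr q)"
  shows "A1 w"
proof -
  let ?W = "\<lambda>x. w x powr q"
  have W: "weight ?W" using A1 by (simp add: A1_def)
  obtain C where C: "\<And>Q. Q \<in> cubes \<Longrightarrow> AE x in lebesgue. x \<in> Q \<longrightarrow> avg Q ?W \<le> C * ?W x"
    using A1 unfolding A1_def by blast
  have "AE x in lebesgue. x \<in> Q \<longrightarrow> avg Q w \<le> 2 * \<bar>C\<bar> powr (1/q) * w x" if Q: "Q \<in> cubes" for Q
  proof -
    obtain a h where h: "0 < h" "Q = cube a h" using Q unfolding cubes_def by blast
    let ?m = "measure lebesgue Q"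
    have m: "0 < ?m" using h by simp
    have cQ: "compact Q" using h by simp
    have "wmeas w Q \<le> 2 * (LINT x:Q|lebesgue. ?W x) powr (1/q) * ?m powr (1 - 1/q)"
      using W cQ by (intro wmeas_le_powr_mean w q) (auto simp: weight_def loc_integrable_def)
    also have "\<dots> = 2 * (avg Q ?W) powr (1/q) * ?m"
      using m by (simp add: avg_def powr_divide powr_diff)
    finally have 1: "avg Q w \<le> 2 * (avg Q ?W) powr (1/q)"
      using m by (simp add: avg_def wmeas_def field_simps)
    have 0: "0 \<le> avg Q ?W" using wmeas_nonneg[OF W, of Q] by (simp add: avg_def wmeas_def)
    have "AE x in lebesgue. 0 < w x" using w by (simp add: weight_def)
    with C[OF Q] show ?thesis
    proof eventually_elim
      case (elim x)
      show ?case
      proof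
        assume "x \<in> Q"
        then have "avg Q ?W \<le> C * ?W x" using elim by simp
        also have "\<dots> \<le> \<bar>C\<bar> * ?W x" by (intro mult_right_mono) auto
        finally have "(avg Q ?W) powr (1/q) \<le> (\<bar>C\<bar> * ?W x) powr (1/q)"
          using 0 q by (intro powr_mono2) auto
        also have "\<dots> = \<bar>C\<bar> powr (1/q) * w x" using elim q by (simp add: powr_mult powr_powr)
        finally show "avg Q w \<le> 2 * \<bar>C\<bar> powr (1/q) * w x" using 1 by linarith
      qed
    qed
  qed
  then show ?thesis using w unfolding A1_def by blast
qed

text \<open>Fixes the constant of \<open>A1_all_balls\<close> and keeps A_1 in the form in which it
  is applied: at almost every y, simultaneously for all balls containing y.\<close>

locale A1_weight =
  fixes w :: "real^'n \<Rightarrow> real" and A :: real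
  assumes A_pos: "0 < A" and weight: "weight w"
    and all_balls: "AE y in lebesgue. 0 < w y \<and>
      (\<forall>x r. 0 < r \<longrightarrow> y \<in> cball x r \<longrightarrow> measure (wm w) (cball x r) \<le> A * r ^ CARD('n) * w y)"

lemma A1_weight_exists: "A1 w \<Longrightarrow> \<exists>A. A1_weight w A"
  using A1_all_balls[of w] by (auto simp: A1_weight_def A1_def)

text \<open>The measure of B(x,2r) is at most A * (2r)^n * w(y) for almost every y in B(x,r).
  Integrating over these y, a set of volume \<open>unit_ball_vol\<close> * r^n, gives this doubling
  constant.\<close>

definition (in A1_weight) D :: real where
  "D = A * 2 ^ CARD('n) / unit_ball_vol (real CARD('n))"

sublocale A1_weight \<subseteq> doubling_measure "wm w" D
proof
  have wM [measurable]: "w \<in> borel_measurable lebesgue" by (rule weight_measurable[OF weight])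
  have [measurable]: "cball x r \<in> sets lebesgue" for x :: "real^'n" and r by simp
  show "sets (wm w) = sets lebesgue" by simp
  have fin: "emeasure (wm w) (cball x r) = ennreal (wmeas w (cball x r))" for x r
    using weight by (simp add: emeasure_wm)
  show "emeasure (wm w) (cball x r) < \<infinity>" for x r by (simp add: fin)
  show pos: "0 < emeasure (wm w) (cball x r)" if r: "0 < r" for x r
  proof (rule ccontr)
    assume "\<not> ?thesis"
    then have "emeasure (wm w) (cball x r) = 0" by simp
    then have "(\<integral>\<^sup>+y\<in>cball x r. ennreal (w y) \<partial>lebesgue) = 0"
      unfolding wm_def by (subst (asm) emeasure_density) auto
    then have "AE y in lebesgue. ennreal (w y) * indicator (cball x r) y = 0"
      by (subst (asm) nn_integral_0_iff_AE) measurable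
    then have "AE y in lebesgue. y \<notin> cball x r"
      using all_balls by eventually_elim (auto simp: indicator_def ennreal_eq_0_iff split: if_splits)
    then have "cball x r \<in> null_sets lebesgue"
      by (subst AE_iff_null_sets) auto
    then show False using r content_cball_pos[of r x] by (auto simp: null_sets_def measure_def)
  qed
  show "measure (wm w) (cball x (2 * r)) \<le> D * measure (wm w) (cball x r)"
    if r: "0 < r" for x r
  proof -
    let ?V2 = "measure (wm w) (cball x (2 * r))" and ?V = "measure (wm w) (cball x r)"
    let ?n = "CARD('n)" and ?\<omega> = "unit_ball_vol (real CARD('n))"
    have \<omega>: "0 < ?\<omega>" by (simp add: unit_ball_vol_pos)
    have vol: "emeasure lebesgue (cball x r) = ennreal (?\<omega> * r ^ ?n)"
      using r by (simp add: emeasure_cball)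
    have "ennreal (?V2 * (?\<omega> * r ^ ?n)) = (\<integral>\<^sup>+y. ennreal ?V2 * indicator (cball x r) y \<partial>lebesgue)"
      using r \<omega> by (subst nn_integral_cmult_indicator) (auto simp: vol ennreal_mult)
    also have "\<dots> \<le> (\<integral>\<^sup>+y. ennreal (A * (2*r) ^ ?n) * (ennreal (w y) * indicator (cball x r) y) \<partial>lebesgue)"
    proof (rule nn_integral_mono_AE)
      show "AE y in lebesgue. ennreal ?V2 * indicator (cball x r) y
          \<le> ennreal (A * (2*r) ^ ?n) * (ennreal (w y) * indicator (cball x r) y)"
        using all_balls
      proof eventually_elim
        case (elim y)
        have "y \<in> cball x r \<Longrightarrow> ?V2 \<le> A * (2*r) ^ ?n * w y"
          using elim[THEN conjunct2, rule_format, of "2*r" x] r by simp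
        then have "y \<in> cball x r \<Longrightarrow> ennreal ?V2 \<le> ennreal (A * (2*r) ^ ?n * w y)" by (rule ennreal_leI)
        moreover have "ennreal (A * (2*r) ^ ?n * w y) = ennreal (A * (2*r) ^ ?n) * ennreal (w y)"
          using elim A_pos r by (intro ennreal_mult) auto
        ultimately show ?case by (auto simp: indicator_def)
      qed
    qed
    also have "\<dots> = ennreal (A * (2*r) ^ ?n) * (\<integral>\<^sup>+y\<in>cball x r. ennreal (w y) \<partial>lebesgue)"
      by (rule nn_integral_cmult) auto
    also have "(\<integral>\<^sup>+y\<in>cball x r. ennreal (w y) \<partial>lebesgue) = emeasure (wm w) (cball x r)"
      unfolding wm_def by (rule emeasure_density[symmetric]) auto
    also have "\<dots> = ennreal ?V" using weight by (simp add: fin measure_wm)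
    also have "ennreal (A * (2*r) ^ ?n) * ennreal ?V = ennreal (A * (2*r) ^ ?n * ?V)"
      using A_pos r by (intro ennreal_mult[symmetric]) auto
    finally have "?V2 * (?\<omega> * r ^ ?n) \<le> A * (2*r) ^ ?n * ?V"
      using A_pos r by (subst (asm) ennreal_le_iff) auto
    then show ?thesis using r \<omega> by (simp add: D_def field_simps power_mult_distrib)
  qed
qed

section \<open>Growth of ball measures under the reverse Hoelder inequality\<close>

context A1_weight begin

text \<open>A cube of half side r sits in the ball of radius n*r about its centre; as n < 2^n, n
  doublings lead back to radius r.\<close>

lemma V_card: "0 < r \<Longrightarrow> V x (real CARD('n) * r) \<le> D ^ CARD('n) * V x r"
  by (rule V_compare) (use of_nat_less_two_power[of "CARD('n)", where 'a=real] in \<open>auto intro!: mult_right_mono less_imp_le\<close>)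

text \<open>A quantitative reverse doubling. On the small cube, Hoelder bounds w(Q) by the integral
  of w^r to the power 1/r times |Q|^(1-1/r). That integral is enlarged to the big cube Q', where RH
  turns it into w(Q') * |Q'|^(1/r-1). What remains is (|Q|/|Q'|)^(1-1/r), an explicit rate in place
  of \<eta>.\<close>

lemma RH_growth:
  assumes r: "1 < r" and RH: "RH r w"
  shows "\<exists>C>0. \<forall>x R R'. 0 < R \<longrightarrow> R \<le> R' \<longrightarrow>
     V x R \<le> C * (R / R') powr (real CARD('n) * (1 - 1/r)) * V x R'"
proof -
  let ?n = "CARD('n)"
  obtain C where C: "\<And>Q. Q \<in> cubes \<Longrightarrow> set_integrable lebesgue Q (\<lambda>x. w x powr r) \<and>
      (avg Q (\<lambda>x. w x powr r)) powr (1/r) \<le> C * avg Q w"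
    using RH unfolding RH_def by blast
  let ?D = "D ^ CARD('n)"
  define C' where "C' = 2 * max C 1 * ?D"
  have D: "?D > 0" using D_ge_1 by simp
  have C': "C' > 0" using D by (simp add: C'_def)
  have "V x R \<le> C' * (R / R') powr (real ?n * (1 - 1/r)) * V x R'" if R: "0 < R" "R \<le> R'" for x R R'
  proof -
    have R': "0 < R'" using R by simp
    let ?Q = "cube (x - R *\<^sub>R One) (2 * R)" and ?Q' = "cube (x - R' *\<^sub>R One) (2 * R')"
    have QQ: "?Q \<subseteq> ?Q'" using R by (auto simp: mem_cube inner_diff_left) force+
    have Q: "?Q \<in> cubes" "?Q' \<in> cubes" using R R' by (auto intro!: cube_in_cubes)
    have v: "measure lebesgue ?Q = (2*R) ^ ?n" "measure lebesgue ?Q' = (2*R') ^ ?n"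
      using R R' by (auto simp: simp del: power_mult_distrib)
    let ?I = "LINT x:?Q|lebesgue. w x powr r" and ?I' = "LINT x:?Q'|lebesgue. w x powr r"
    have I0: "0 \<le> ?I" "0 \<le> ?I'"
      unfolding set_lebesgue_integral_def by (auto intro!: integral_nonneg_AE)
    have II: "?I \<le> ?I'"
      using C[OF Q(1)] C[OF Q(2)] QQ unfolding set_lebesgue_integral_def set_integrable_def
      by (intro integral_mono) (auto simp: indicator_def)
    have "V x R \<le> measure (wm w) ?Q"
      by (rule measure_mono_fmeasurable) (use cball_subset_centered_cube weight in \<open>auto simp: fmeasurable_def emeasure_wm\<close>)
    also have "\<dots> = wmeas w ?Q" using weight by (simp add: measure_wm)
    also have "\<dots> \<le> 2 * ?I powr (1/r) * measure lebesgue ?Q powr (1 - 1/r)"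
      using C[OF Q(1)] by (intro wmeas_le_powr_mean weight r) auto
    also have "\<dots> \<le> 2 * ?I' powr (1/r) * measure lebesgue ?Q powr (1 - 1/r)"
      using II I0 r by (intro mult_right_mono mult_left_mono powr_mono2) auto
    also have "?I' powr (1/r) = (avg ?Q' (\<lambda>x. w x powr r)) powr (1/r) * measure lebesgue ?Q' powr (1/r)"
      using R' I0 by (simp add: avg_def powr_mult[symmetric] v)
    also have "2 * (avg ?Q' (\<lambda>x. w x powr r) powr (1/r) * measure lebesgue ?Q' powr (1/r)) * measure lebesgue ?Q powr (1 - 1/r)
      \<le> 2 * ((max C 1 * avg ?Q' w) * measure lebesgue ?Q' powr (1/r)) * measure lebesgue ?Q powr (1 - 1/r)"
    proof -
      have "0 \<le> avg ?Q' w" using wmeas_nonneg[OF weight, of ?Q'] by (simp add: avg_def wmeas_def)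
      then have "C * avg ?Q' w \<le> max C 1 * avg ?Q' w" by (intro mult_right_mono) auto
      then have "avg ?Q' (\<lambda>x. w x powr r) powr (1/r) \<le> max C 1 * avg ?Q' w" using C[OF Q(2)] by linarith
      then show ?thesis by (intro mult_right_mono mult_left_mono) auto
    qed
    also have "\<dots> = 2 * max C 1 * (measure lebesgue ?Q / measure lebesgue ?Q') powr (1 - 1/r) * wmeas w ?Q'"
      using R R' by (simp add: avg_def wmeas_def v powr_divide powr_diff field_simps)
    also have "(measure lebesgue ?Q / measure lebesgue ?Q') powr (1 - 1/r) = (R / R') powr (real ?n * (1 - 1/r))"
    proof -
      have "measure lebesgue ?Q / measure lebesgue ?Q' = (R / R') powr real ?n"
        using R R' by (simp add: v powr_realpow power_divide power_mult_distrib)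
      then show ?thesis by (simp add: powr_powr)
    qed
    also have "wmeas w ?Q' = measure (wm w) ?Q'" using weight by (simp add: measure_wm)
    also have "2 * max C 1 * (R / R') powr (real ?n * (1 - 1/r)) * measure (wm w) ?Q'
       \<le> 2 * max C 1 * (R / R') powr (real ?n * (1 - 1/r)) * (?D * V x R')"
    proof (rule mult_left_mono)
      have "measure (wm w) ?Q' \<le> V x (real ?n * R')"
        using R' by (intro measure_le_V centered_cube_subset_cball) auto
      then show "measure (wm w) ?Q' \<le> ?D * V x R'" using V_card[OF R', of x] by linarith
    qed auto
    finally show ?thesis by (simp add: C'_def mult_ac)
  qed
  then show ?thesis using C' by blast
qed

end

section \<open>Pointwise estimates\<close>

lemma loc_integrable_cube: "loc_integrable b \<Longrightarrow> set_integrable lebesgue (cube a h) b"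
  by (simp add: loc_integrable_def)

lemma set_integrable_const_cube: "set_integrable lebesgue (cube a h) (\<lambda>x. c::real)"
  by (rule absolutely_integrable_continuous) simp

text \<open>The number c is meant to be the average over the large cube. The lemma serves both the
  halving steps of a telescoping sum and the comparison with a cube of three times the side.\<close>

lemma avg_diff_le:
  fixes b :: "real^'n \<Rightarrow> real"
  assumes b: "loc_integrable b" and sub: "cube a' h' \<subseteq> cube a h" and h': "0 < h'"
  shows "\<bar>avg (cube a' h') b - c\<bar> \<le> (LINT x:cube a h|lebesgue. \<bar>b x - c\<bar>) / h' ^ CARD('n)"
proof -
  let ?Q' = "cube a' h'" and ?Q = "cube a h"
  note ints = loc_integrable_cube[OF b] set_integrable_const_cube
  have i: "set_integrable lebesgue (cube a h) (\<lambda>x. \<bar>b x - c\<bar>)" for a h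
    by (intro set_integrable_abs set_integral_diff(1) ints)
  have cst: "(LINT x:?Q'|lebesgue. c) = c * h' ^ CARD('n)"
    unfolding set_lebesgue_integral_def using h' by simp
  have "avg ?Q' b - c = ((LINT x:?Q'|lebesgue. b x) - (LINT x:?Q'|lebesgue. c)) / h' ^ CARD('n)"
    using h' by (simp add: avg_def cst field_simps)
  also have "(LINT x:?Q'|lebesgue. b x) - (LINT x:?Q'|lebesgue. c) = (LINT x:?Q'|lebesgue. b x - c)"
    by (intro set_integral_diff(2)[symmetric] ints)
  finally have "\<bar>avg ?Q' b - c\<bar> = \<bar>LINT x:?Q'|lebesgue. b x - c\<bar> / h' ^ CARD('n)"
    using h' by simp
  also have "\<dots> \<le> (LINT x:?Q|lebesgue. \<bar>b x - c\<bar>) / h' ^ CARD('n)"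
  proof (rule divide_right_mono)
    have "\<bar>LINT x:?Q'|lebesgue. b x - c\<bar> \<le> (LINT x|lebesgue. \<bar>indicator ?Q' x *\<^sub>R (b x - c)\<bar>)"
      unfolding set_lebesgue_integral_def by (rule integral_abs_bound)
    also have "\<dots> = (LINT x:?Q'|lebesgue. \<bar>b x - c\<bar>)"
      unfolding set_lebesgue_integral_def by (intro Bochner_Integration.integral_cong) (auto simp: indicator_def)
    also have "\<dots> \<le> (LINT x:?Q|lebesgue. \<bar>b x - c\<bar>)"
      using i[of a h] i[of a' h'] sub unfolding set_lebesgue_integral_def set_integrable_def
      by (intro integral_mono) (auto simp: indicator_def)
    finally show "\<bar>LINT x:?Q'|lebesgue. b x - c\<bar> \<le> (LINT x:?Q|lebesgue. \<bar>b x - c\<bar>)" .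
  qed (use h' in simp)
  finally show ?thesis .
qed

lemma avg_cube_eq:
  fixes b :: "real^'n \<Rightarrow> real"
  assumes "loc_integrable b" "0 < t"
  shows "avg (cube z t) b = integral (cube z t) b /\<^sub>R t ^ DIM(real^'n)"
  using assms set_lebesgue_integral_eq_integral(2)[OF loc_integrable_cube[OF assms(1), of z t]]
  by (simp add: avg_def divide_inverse mult.commute)

text \<open>Lebesgue differentiation along cubes whose lower corner, not centre, is z. The
  exceptional set does not depend on the initial side h.\<close>

lemma AE_avg_cube_tendsto:
  fixes b :: "real^'n \<Rightarrow> real"
  assumes b: "loc_integrable b"
  shows "AE z in lebesgue. \<forall>h>0. (\<lambda>j. avg (cube z ((1/2)^j * h)) b) \<longlonglongrightarrow> b z"
proof -
  have "b integrable_on cbox u v" for u v :: "real^'n"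
    using b by (intro set_lebesgue_integral_eq_integral(1)) (simp add: loc_integrable_def)
  then obtain N where N: "negligible N"
    "\<And>x e. x \<notin> N \<Longrightarrow> 0 < e \<Longrightarrow> \<exists>d>0. \<forall>h. 0 < h \<and> h < d \<longrightarrow>
        norm (integral (cube x h) b /\<^sub>R h ^ DIM(real^'n) - b x) < e"
    using integrable_ccontinuous_explicit[of b] by blast
  have "(\<lambda>j. avg (cube z ((1/2)^j * h)) b) \<longlonglongrightarrow> b z" if z: "z \<notin> N" and h: "0 < h" for z h
  proof (rule LIMSEQ_I)
    fix e :: real assume "0 < e"
    then obtain d where d: "0 < d" "\<And>t. 0 < t \<Longrightarrow> t < d \<Longrightarrow> norm (integral (cube z t) b /\<^sub>R t ^ DIM(real^'n) - b z) < e"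
      using N(2)[OF z] by blast
    obtain k where k: "(1/2)^k < d/h" using real_arch_pow_inv[of "d/h" "1/2"] d h by auto
    have "norm (avg (cube z ((1/2)^j * h)) b - b z) < e" if j: "k \<le> j" for j
    proof -
      let ?t = "(1/2)^j * h"
      have t: "0 < ?t" using h by simp
      have "(1/2::real)^j \<le> (1/2)^k" using j by (intro power_decreasing) auto
      then have "(1/2)^j < d/h" using k by linarith
      then have "?t < d" using h by (simp add: field_simps)
      moreover have "avg (cube z ?t) b = integral (cube z ?t) b /\<^sub>R ?t ^ DIM(real^'n)"
        by (rule avg_cube_eq[OF b t])
      ultimately show ?thesis using d(2)[OF t] by simp
    qed
    then show "\<exists>no. \<forall>j\<ge>no. norm (avg (cube z ((1/2)^j * h)) b - b z) < e" by blast
  qed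
  moreover have "AE z in lebesgue. z \<notin> N"
    using N(1) by (intro AE_not_in) (simp add: negligible_iff_null_sets)
  ultimately show ?thesis by (auto elim: eventually_mono)
qed

section \<open>The Lipschitz condition in pointwise form\<close>

context A1_weight begin

lemma measure_cube_pos: "0 < h \<Longrightarrow> 0 < measure (wm w) (cube a h)"
proof -
  assume h: "0 < h"
  have "cball (a + (h/2) *\<^sub>R One) (h/2) \<subseteq> cube a h"
    by (rule cball_subset_cube) (auto simp: inner_add_left)
  then have "V (a + (h/2) *\<^sub>R One) (h/2) \<le> measure (wm w) (cube a h)"
    using weight by (intro measure_mono_fmeasurable) (auto simp: fmeasurable_def emeasure_wm)
  then show ?thesis using V_pos[of "h/2" "a + (h/2) *\<^sub>R One"] h by simp
qed

lemma lip_norm_nonneg: "b \<in> Lip \<beta> w \<Longrightarrow> 0 \<le> lip_norm \<beta> w b"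
  and oscillation_le: "b \<in> Lip \<beta> w \<Longrightarrow> 0 < h \<Longrightarrow>
     (LINT x:cube a h|lebesgue. \<bar>b x - avg (cube a h) b\<bar>)
        \<le> lip_norm \<beta> w b * measure (wm w) (cube a h) powr (1 + \<beta> / real CARD('n))"
proof -
  assume b: "b \<in> Lip \<beta> w"
  \<comment> \<open>Boundedness makes the real supremum \<open>lip_norm\<close> an upper bound of
    its family.\<close>
  have bdd: "bdd_above (lip_quot \<beta> w b ` cubes)" using b by (simp add: Lip_def)
  have le: "lip_quot \<beta> w b (cube a h) \<le> lip_norm \<beta> w b" if "0 < h" for a h
    unfolding lip_norm_def using bdd cube_in_cubes[OF that] by (intro cSUP_upper)
  have "0 \<le> lip_quot \<beta> w b (cube 0 1)"
    unfolding lip_quot_def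
    by (intro mult_nonneg_nonneg) (auto simp: wmeas_nonneg[OF weight] set_lebesgue_integral_def intro!: integral_nonneg_AE)
  then show "0 \<le> lip_norm \<beta> w b" using le[of 1 0] by simp
  assume h: "0 < h"
  let ?Q = "cube a h"
  have m: "0 < wmeas w ?Q" using measure_cube_pos[OF h, of a] weight by (simp add: measure_wm)
  have e: "wmeas w ?Q powr (1 + \<beta> / real CARD('n)) = wmeas w ?Q * wmeas w ?Q powr (\<beta> / real CARD('n))"
    using m by (simp add: powr_add)
  show "(LINT x:?Q|lebesgue. \<bar>b x - avg ?Q b\<bar>)
        \<le> lip_norm \<beta> w b * measure (wm w) ?Q powr (1 + \<beta> / real CARD('n))"
    unfolding measure_wm[OF weight compact_cbox] e
    using le[OF h, of a] m by (simp add: lip_quot_def field_simps)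
qed

text \<open>Telescoping over halved cubes Q_j with corner z: an increment is at most the norm of b
  times \<mu>(Q_j)^(1+\<delta>) over the volume of the next cube, where \<delta> = \<beta>/n. One
  factor \<mu>(Q_j) against the volume is bounded by a multiple of w(z) through A_1; the remaining
  \<mu>(Q_j)^\<delta> decays geometrically by reverse doubling.\<close>

lemma Lip_avg_limit:
  fixes \<beta> :: real
  assumes \<beta>: "0 < \<beta>"
  shows "\<exists>C>0. \<forall>b. b \<in> Lip \<beta> w \<longrightarrow> (AE z in lebesgue. \<forall>h>0. \<bar>b z - avg (cube z h) b\<bar>
     \<le> C * lip_norm \<beta> w b * V z (real CARD('n) * h) powr (\<beta> / real CARD('n)) * w z)"
proof -
  let ?n = "CARD('n)"
  define \<delta> where "\<delta> = \<beta> / real ?n"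
  have \<delta>: "\<delta> > 0" using \<beta> by (simp add: \<delta>_def)
  define q where "q = \<eta> powr \<delta>"
  have q: "0 < q" "q < 1" unfolding q_def using \<eta>_bounds \<delta> powr_less_mono2[of \<delta> \<eta> 1] by auto
  \<comment> \<open>The divisor is the volume of the halved cube, hence 2^n; A * n^n comes from A_1
    on the ball of radius n*t around the cube of side t.\<close>
  define C0 where "C0 = 2 ^ ?n * A * real ?n ^ ?n"
  have C0: "C0 > 0" using A_pos by (simp add: C0_def)
  have "AE z in lebesgue. \<forall>h>0. \<bar>b z - avg (cube z h) b\<bar>
     \<le> C0 / (1 - q) * lip_norm \<beta> w b * V z (real ?n * h) powr \<delta> * w z" if b: "b \<in> Lip \<beta> w" for b
  proof -
    let ?L = "lip_norm \<beta> w b"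
    have L: "0 \<le> ?L" by (rule lip_norm_nonneg[OF b])
    have bl: "loc_integrable b" using b by (simp add: Lip_def)
    show ?thesis using AE_avg_cube_tendsto[OF bl] all_balls
    proof eventually_elim
      case (elim z)
      show ?case
      proof (intro allI impI)
        fix h :: real assume h: "0 < h"
        let ?t = "\<lambda>j. (1/2)^j * h"
        let ?m = "\<lambda>j. avg (cube z (?t j)) b"
        have t: "0 < ?t j" for j using h by simp
        define K where "K = C0 * ?L * V z (real ?n * h) powr \<delta> * w z"
        have K: "0 \<le> K" using C0 L elim by (simp add: K_def)
        have step: "\<bar>?m (Suc j) - ?m j\<bar> \<le> K * q ^ j" for j
        proof -
          let ?\<mu> = "measure (wm w) (cube z (?t j))"
          have sub: "cube z (?t (Suc j)) \<subseteq> cube z (?t j)"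
          proof
            fix y assume "y \<in> cube z (?t (Suc j))"
            then show "y \<in> cube z (?t j)" using h unfolding mem_cube by (auto intro: order_trans)
          qed
          have \<mu>0: "0 \<le> ?\<mu>" by simp
          have \<mu>V: "?\<mu> \<le> V z (real ?n * ?t j)"
            using h by (intro measure_le_V cube_subset_cball) auto
          have "z \<in> cball z (real ?n * ?t j)" using h by simp
          then have VA: "V z (real ?n * ?t j) \<le> A * (real ?n * ?t j) ^ ?n * w z"
            using elim(2) t[of j] by (metis mult_pos_pos of_nat_0_less_iff zero_less_card_finite)
          have V\<eta>: "V z (real ?n * ?t j) \<le> \<eta>^j * V z (real ?n * h)"
            using V_shrink_pow[of "real ?n * h" z j] h by (simp add: mult_ac)
          have "\<bar>?m (Suc j) - ?m j\<bar> \<le> (LINT x:cube z (?t j)|lebesgue. \<bar>b x - ?m j\<bar>) / ?t (Suc j) ^ ?n"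
            by (rule avg_diff_le[OF bl sub t])
          also have "\<dots> \<le> (?L * ?\<mu> powr (1 + \<delta>)) / ?t (Suc j) ^ ?n"
            unfolding \<delta>_def using t by (intro divide_right_mono oscillation_le[OF b] zero_le_power less_imp_le) auto
          also have "?\<mu> powr (1 + \<delta>) = ?\<mu> * ?\<mu> powr \<delta>" using \<mu>0 by (simp add: powr_add)
          also have "?L * (?\<mu> * ?\<mu> powr \<delta>) / ?t (Suc j) ^ ?n
              \<le> ?L * ((A * (real ?n * ?t j) ^ ?n * w z) * (\<eta>^j * V z (real ?n * h)) powr \<delta>) / ?t (Suc j) ^ ?n"
            using \<mu>0 order_trans[OF \<mu>V VA] order_trans[OF \<mu>V V\<eta>] \<delta> L t[of "Suc j"] elim A_pos h
            by (intro divide_right_mono mult_left_mono mult_mono powr_mono2) auto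
          also have "\<dots> = K * q ^ j"
          proof -
            have 1: "(\<eta>^j * V z (real ?n * h)) powr \<delta> = V z (real ?n * h) powr \<delta> * q ^ j"
              using \<eta>_bounds by (simp add: q_def powr_mult powr_realpow[symmetric] powr_powr mult.commute)
            have 2: "(real ?n * ?t j) ^ ?n / ?t (Suc j) ^ ?n = 2 ^ ?n * real ?n ^ ?n"
            proof -
              have "(u * t) ^ k / (t / 2) ^ k = 2 ^ k * u ^ k" if "0 < t" for u t :: real and k :: nat
                using that by (simp add: power_mult_distrib power_divide)
              from this[OF t[of j], of "real ?n" ?n] show ?thesis by simp
            qed
            have "?L * ((A * (real ?n * ?t j) ^ ?n * w z) * (V z (real ?n * h) powr \<delta> * q ^ j)) / ?t (Suc j) ^ ?n
              = ?L * A * w z * V z (real ?n * h) powr \<delta> * q ^ j * ((real ?n * ?t j) ^ ?n / ?t (Suc j) ^ ?n)"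
              by simp
            also have "\<dots> = K * q ^ j" unfolding 2 by (simp add: K_def C0_def mult_ac)
            finally show ?thesis unfolding 1 .
          qed
          finally show ?thesis .
        qed
        have sums: "\<bar>?m k - ?m 0\<bar> \<le> K * (\<Sum>j<k. q ^ j)" for k
        proof (induction k)
          case (Suc k)
          have "\<bar>?m (Suc k) - ?m 0\<bar> \<le> \<bar>?m (Suc k) - ?m k\<bar> + \<bar>?m k - ?m 0\<bar>" by linarith
          also have "\<dots> \<le> K * q ^ k + K * (\<Sum>j<k. q ^ j)" using step[of k] Suc by linarith
          finally show ?case by (simp add: distrib_left)
        qed simp
        have le: "\<bar>?m k - ?m 0\<bar> \<le> K / (1 - q)" for k
        proof -
          have "(\<Sum>j<k. q ^ j) \<le> (\<Sum>j. q ^ j)" using q by (intro sum_le_suminf summable_geometric) auto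
          also have "\<dots> = 1 / (1 - q)" using q by (intro suminf_geometric) auto
          finally have "K * (\<Sum>j<k. q ^ j) \<le> K * (1 / (1 - q))" using K by (rule mult_left_mono)
          then show ?thesis using sums[of k] by simp
        qed
        have "?m \<longlonglongrightarrow> b z" using elim h by blast
        then have "(\<lambda>k. \<bar>?m k - ?m 0\<bar>) \<longlonglongrightarrow> \<bar>b z - ?m 0\<bar>" by (intro tendsto_intros)
        then have "\<bar>b z - ?m 0\<bar> \<le> K / (1 - q)" using le by (intro LIMSEQ_le_const2) auto
        then show "\<bar>b z - avg (cube z h) b\<bar> \<le> C0 / (1 - q) * ?L * V z (real ?n * h) powr \<delta> * w z"
          by (simp add: K_def)
      qed
    qed
  qed
  moreover have "C0 / (1 - q) > 0" using C0 q by simp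
  ultimately show ?thesis unfolding \<delta>_def by blast
qed

text \<open>With h = |x-y|, b x is joined to b y through the averages over the cubes of side h at x
  and y and over a common cube of side 3h. All powers V^(\<beta>/n) are estimated by A_1 at the
  single point x, which contributes h^\<beta> * w(x)^(\<beta>/n). Only a linear dependence on w(y)
  is left, so that integrating in y produces the measure w dy.\<close>

lemma Lip_pointwise:
  assumes \<beta>: "0 < \<beta>"
  shows "\<exists>C>0. \<forall>b. b \<in> Lip \<beta> w \<longrightarrow> (\<exists>G. (AE z in lebesgue. z \<in> G) \<and> (\<forall>x\<in>G. \<forall>y\<in>G.
     \<bar>b x - b y\<bar> \<le> C * lip_norm \<beta> w b * dist x y powr \<beta> * w x powr (\<beta> / real CARD('n)) * (w x + w y)))"
proof -
  let ?n = "CARD('n)"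
  define N where "N = real ?n"
  have N: "N \<ge> 1" by (simp add: N_def Suc_le_eq)
  define \<delta> where "\<delta> = \<beta> / N"
  have \<delta>: "\<delta> > 0" using \<beta> N by (simp add: \<delta>_def)
  obtain C0 where C0: "C0 > 0" "\<And>b. b \<in> Lip \<beta> w \<Longrightarrow> AE z in lebesgue. \<forall>h>0. \<bar>b z - avg (cube z h) b\<bar>
     \<le> C0 * lip_norm \<beta> w b * V z (N * h) powr \<delta> * w z"
    using Lip_avg_limit[OF \<beta>] unfolding N_def \<delta>_def by blast
  define K1 where "K1 = (A * N ^ ?n) powr \<delta>"
  define K2 where "K2 = A * (2 * N) ^ ?n"
  \<comment> \<open>\<open>K1\<close> stems from V(z,N*h)^\<delta> in the passage from b to its
    averages, \<open>K2\<close> from the measure of the common cube; the 2 counts the two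
    comparisons with that cube.\<close>
  define C where "C = C0 * K1 + 2 * (K2 * K2 powr \<delta>)"
  have K: "0 < K1" "0 < K2" using A_pos N by (auto simp: K1_def K2_def)
  have C: "C > 0" unfolding C_def using C0 K by (intro add_pos_pos mult_pos_pos) auto
  have "\<exists>G. (AE z in lebesgue. z \<in> G) \<and> (\<forall>x\<in>G. \<forall>y\<in>G.
     \<bar>b x - b y\<bar> \<le> C * lip_norm \<beta> w b * dist x y powr \<beta> * w x powr \<delta> * (w x + w y))" if b: "b \<in> Lip \<beta> w" for b
  proof -
    let ?L = "lip_norm \<beta> w b"
    have L: "0 \<le> ?L" by (rule lip_norm_nonneg[OF b])
    have bl: "loc_integrable b" using b by (simp add: Lip_def)
    define G where "G = {z. (\<forall>h>0. \<bar>b z - avg (cube z h) b\<bar> \<le> C0 * ?L * V z (N * h) powr \<delta> * w z) \<and> 0 < w z \<and>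
      (\<forall>x r. 0 < r \<longrightarrow> z \<in> cball x r \<longrightarrow> V x r \<le> A * r ^ ?n * w z)}"
    have "AE z in lebesgue. z \<in> G" using C0(2)[OF b] all_balls by eventually_elim (auto simp: G_def)
    moreover have "\<bar>b x - b y\<bar> \<le> C * ?L * dist x y powr \<beta> * w x powr \<delta> * (w x + w y)"
      if x: "x \<in> G" and y: "y \<in> G" for x y
    proof (cases "x = y")
      case False
      define h where "h = dist x y"
      have h: "h > 0" using False by (simp add: h_def)
      have wx: "0 < w x" "0 < w y" using x y by (auto simp: G_def)
      have VV: "V z r \<le> A * r ^ ?n * w x" if "0 < r" "dist z x \<le> r" for z r
        using x that by (auto simp: G_def)
      have hn: "(h ^ ?n) powr \<delta> = h powr \<beta>"
        using h N by (simp add: powr_realpow[symmetric] powr_powr \<delta>_def N_def)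
      have hNh: "h \<le> N * h" using N h by simp
      have small: "\<bar>b z - avg (cube z h) b\<bar> \<le> C0 * K1 * ?L * h powr \<beta> * w x powr \<delta> * w z"
        if z: "z \<in> G" and d: "dist z x \<le> h" for z
      proof -
        have "V z (N * h) \<le> A * (N * h) ^ ?n * w x" using order_trans[OF d hNh] h N by (intro VV) auto
        then have "V z (N * h) powr \<delta> \<le> (A * (N * h) ^ ?n * w x) powr \<delta>" using \<delta> by (intro powr_mono2) auto
        also have "A * (N * h) ^ ?n * w x = (A * N ^ ?n) * h ^ ?n * w x" by (simp add: power_mult_distrib)
        also have "\<dots> powr \<delta> = K1 * h powr \<beta> * w x powr \<delta>"
          using A_pos N h wx hn by (simp only: powr_mult K1_def)
        finally have "C0 * ?L * V z (N * h) powr \<delta> * w z \<le> C0 * ?L * (K1 * h powr \<beta> * w x powr \<delta>) * w z"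
          using C0 L z by (intro mult_right_mono mult_left_mono) (auto simp: G_def)
        moreover have "\<bar>b z - avg (cube z h) b\<bar> \<le> C0 * ?L * V z (N * h) powr \<delta> * w z"
          using z h by (auto simp: G_def)
        ultimately show ?thesis by (simp add: mult_ac)
      qed
      \<comment> \<open>Its coordinates run from x - h to x + 2h, enough for every cube of side h
        with lower corner within h of x.\<close>
      let ?Q = "cube (x - h *\<^sub>R One) (3 * h)"
      have big: "\<bar>avg (cube z h) b - avg ?Q b\<bar> \<le> (K2 * K2 powr \<delta>) * ?L * h powr \<beta> * w x powr \<delta> * w x"
        if d: "dist z x \<le> h" for z
      proof -
        have sub: "cube z h \<subseteq> ?Q"
        proof
          fix u assume u: "u \<in> cube z h"
          show "u \<in> ?Q" unfolding mem_cube
          proof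
            fix i assume i: "i \<in> (Basis::(real^'n) set)"
            show "(x - h *\<^sub>R One) \<bullet> i \<le> u \<bullet> i \<and> u \<bullet> i \<le> (x - h *\<^sub>R One) \<bullet> i + 3 * h"
              using coordinate_dist[OF i, of z x] d u i by (auto simp: mem_cube inner_diff_left)
          qed
        qed
        have \<mu>: "measure (wm w) ?Q \<le> K2 * h ^ ?n * w x"
        proof -
          have "measure (wm w) ?Q \<le> V x (real ?n * (2 * h))"
            using h by (intro measure_le_V cube_subset_cball) (auto simp: inner_diff_left)
          also have "\<dots> = V x (2 * N * h)" by (simp add: N_def mult_ac)
          also have "\<dots> \<le> A * (2 * N * h) ^ ?n * w x" using h N by (intro VV) auto
          finally show ?thesis by (simp add: K2_def power_mult_distrib)
        qed
        have "\<bar>avg (cube z h) b - avg ?Q b\<bar> \<le> (LINT u:?Q|lebesgue. \<bar>b u - avg ?Q b\<bar>) / h ^ ?n"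
          by (rule avg_diff_le[OF bl sub h])
        also have "\<dots> \<le> (?L * measure (wm w) ?Q powr (1 + \<delta>)) / h ^ ?n"
          unfolding \<delta>_def N_def using h by (intro divide_right_mono oscillation_le[OF b]) auto
        also have "\<dots> \<le> (?L * (K2 * h ^ ?n * w x) powr (1 + \<delta>)) / h ^ ?n"
          using \<mu> h L \<delta> by (intro divide_right_mono mult_left_mono powr_mono2) auto
        also have "(K2 * h ^ ?n * w x) powr (1 + \<delta>) = (K2 * h ^ ?n * w x) * (K2 powr \<delta> * h powr \<beta> * w x powr \<delta>)"
          using K wx h hn by (simp add: powr_add powr_mult)
        also have "?L * ((K2 * h ^ ?n * w x) * (K2 powr \<delta> * h powr \<beta> * w x powr \<delta>)) / h ^ ?n
           = (K2 * K2 powr \<delta>) * ?L * h powr \<beta> * w x powr \<delta> * w x"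
          using h by (simp add: mult_ac)
        finally show ?thesis .
      qed
      let ?P = "?L * h powr \<beta> * w x powr \<delta>"
      have P: "0 \<le> ?P" using L by simp
      have "\<bar>b x - b y\<bar> \<le> C0 * K1 * (?P * w x) + C0 * K1 * (?P * w y)
          + 2 * ((K2 * K2 powr \<delta>) * (?P * w x))"
        using small[OF x] small[OF y] big[of x] big[of y] h by (simp add: h_def dist_commute mult_ac)
      also have "\<dots> \<le> C * (?P * (w x + w y))"
        unfolding C_def using P K wx by (simp add: algebra_simps)
      finally show ?thesis by (simp add: h_def mult_ac)
    qed (use C L in simp)
    ultimately show ?thesis by blast
  qed
  then show ?thesis using C unfolding \<delta>_def N_def by blast
qed

end

text \<open>This holds without any integrability assumption: if the right-hand side is finite and
  \<open>f\<close> times the kernel is not integrable, then either both fractional integrals are the junk value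
  \<open>0\<close> or \<open>b x = 0\<close>.\<close>
lemma commutator_le:
  fixes f b :: "real^'n \<Rightarrow> real"
  assumes [measurable]: "f \<in> borel_measurable lebesgue" "b \<in> borel_measurable lebesgue" and c: "0 < c"
  shows "ennreal \<bar>commutator c \<alpha> b f x\<bar> \<le>
    ennreal c * (\<integral>\<^sup>+y. ennreal (\<bar>b x - b y\<bar> * \<bar>f y\<bar> / dist x y powr (real CARD('n) - \<alpha>)) \<partial>lebesgue)"
proof -
  let ?k = "\<lambda>y. f y / dist x y powr (real CARD('n) - \<alpha>)"
  let ?bk = "\<lambda>y. b y * f y / dist x y powr (real CARD('n) - \<alpha>)"
  let ?d = "\<lambda>y. (b x - b y) * ?k y"
  have norm_d: "norm (?d y) = \<bar>b x - b y\<bar> * \<bar>f y\<bar> / dist x y powr (real CARD('n) - \<alpha>)" for y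
    by (simp add: abs_mult)
  have comm: "commutator c \<alpha> b f x = c * (b x * (LINT y|lebesgue. ?k y) - (LINT y|lebesgue. ?bk y))"
    by (simp add: commutator_def frac_int_def algebra_simps)
  show ?thesis
  proof (cases "integrable lebesgue ?d")
    case False
    then have "\<not> (\<integral>\<^sup>+y. ennreal (norm (?d y)) \<partial>lebesgue) < \<infinity>"
      by (intro notI, elim notE, intro integrableI_bounded) auto
    then have "(\<integral>\<^sup>+y. ennreal (norm (?d y)) \<partial>lebesgue) = \<infinity>"
      by (simp only: less_top[symmetric] infinity_ennreal_def not_not)
    then show ?thesis using c unfolding norm_d by (simp add: ennreal_mult_top)
  next
    case True
    have bk: "?bk = (\<lambda>y. b x * ?k y - ?d y)"
      by (rule ext) (simp add: left_diff_distrib diff_divide_distrib)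
    have "\<bar>commutator c \<alpha> b f x\<bar> \<le> c * \<bar>LINT y|lebesgue. ?d y\<bar>"
    proof (cases "integrable lebesgue ?k")
      case ik: True
      have "(LINT y|lebesgue. ?bk y) = b x * (LINT y|lebesgue. ?k y) - (LINT y|lebesgue. ?d y)"
        unfolding bk Bochner_Integration.integral_diff[OF integrable_mult_right[OF ik] True]
        by (simp only: integral_mult_right_zero)
      then show ?thesis using c by (simp add: comm abs_mult)
    next
      case nik: False
      show ?thesis
      proof (cases "integrable lebesgue ?bk")
        case ibk: True
        have "(\<lambda>y. b x * ?k y) = (\<lambda>y. ?bk y + ?d y)"
          by (rule ext) (simp add: left_diff_distrib diff_divide_distrib)
        then have ibx: "integrable lebesgue (\<lambda>y. b x * ?k y)"
          using Bochner_Integration.integrable_add[OF ibk True] by (simp only:)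
        have "b x = 0"
        proof (rule ccontr)
          assume bx: "b x \<noteq> 0"
          have "integrable lebesgue (\<lambda>y. inverse (b x) * (b x * ?k y))"
            by (rule integrable_mult_right[OF ibx])
          moreover have "(\<lambda>y. inverse (b x) * (b x * ?k y)) = ?k" using bx by (intro ext) simp
          ultimately show False using nik by (simp only:)
        qed
        then have "commutator c \<alpha> b f x = c * (LINT y|lebesgue. ?d y)"
          by (simp add: comm)
        then show ?thesis using c by (simp add: abs_mult)
      next
        case False
        then show ?thesis using nik c by (simp add: comm not_integrable_integral_eq)
      qed
    qed
    also have "\<dots> \<le> c * (LINT y|lebesgue. norm (?d y))"
      using c integral_norm_bound[of lebesgue ?d] by (intro mult_left_mono) auto
    finally have "ennreal \<bar>commutator c \<alpha> b f x\<bar> \<le> ennreal (c * (LINT y|lebesgue. norm (?d y)))"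
      by (rule ennreal_leI)
    also have "\<dots> = ennreal c * ennreal (LINT y|lebesgue. norm (?d y))" using c by (intro ennreal_mult) auto
    also have "ennreal (LINT y|lebesgue. norm (?d y)) = (\<integral>\<^sup>+y. ennreal (norm (?d y)) \<partial>lebesgue)"
      by (rule nn_integral_eq_integral[OF integrable_norm[OF True], symmetric]) simp
    finally show ?thesis unfolding norm_d .
  qed
qed

section \<open>Fractional integrals on Morrey spaces\<close>

lemma powr_add_le:
  fixes a b s :: real
  assumes "0 \<le> a" "0 \<le> b" "0 < s"
  shows "(a + b) powr s \<le> 2 powr s * (a powr s + b powr s)"
proof -
  have "(a + b) powr s \<le> (2 * max a b) powr s" using assms by (intro powr_mono2) auto
  also have "\<dots> = 2 powr s * max a b powr s" using assms by (simp add: powr_mult)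
  also have "max a b powr s \<le> a powr s + b powr s" by (auto simp: max_def)
  finally show ?thesis by simp
qed

text \<open>Assembles local estimates: on a ball \<open>S\<close>, g majorises the contribution of
  the near part of f and the constant c that of the far part; \<open>X\<close> and \<open>Y\<close>
  are their shares of the norm.\<close>

lemma nn_integral_add_const_powr_le:
  fixes g :: "'a \<Rightarrow> real"
  assumes g: "g \<in> borel_measurable M" "\<And>x. 0 \<le> g x" and S: "S \<in> sets M" "emeasure M S < \<infinity>"
    and nonneg: "0 \<le> c" "0 \<le> a" "0 \<le> X" and s: "0 < s"
    and X: "(\<integral>\<^sup>+x. ennreal (g x powr s) \<partial>M) \<le> ennreal X" and Y: "c powr s * measure M S \<le> Y"
  shows "(\<integral>\<^sup>+x. ennreal ((a * (g x + c) * indicator S x) powr s) \<partial>M) \<le> ennreal ((2 * a) powr s * (X + Y))"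
proof -
  note [measurable] = g(1) S(1)
  have Y0: "0 \<le> Y" using Y by (rule order_trans[rotated]) simp
  have eS: "emeasure M S = ennreal (measure M S)" using S by (simp add: emeasure_eq_ennreal_measure less_top)
  have "(\<integral>\<^sup>+x. ennreal ((a * (g x + c) * indicator S x) powr s) \<partial>M)
     \<le> (\<integral>\<^sup>+x. ennreal ((2 * a) powr s) * (ennreal (g x powr s) + ennreal (c powr s) * indicator S x) \<partial>M)"
  proof (rule nn_integral_mono)
    fix x
    show "ennreal ((a * (g x + c) * indicator S x) powr s)
        \<le> ennreal ((2 * a) powr s) * (ennreal (g x powr s) + ennreal (c powr s) * indicator S x)"
    proof (cases "x \<in> S")
      case True
      have "(a * (g x + c)) powr s = a powr s * (g x + c) powr s" using nonneg g by (simp add: powr_mult)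
      also have "\<dots> \<le> a powr s * (2 powr s * (g x powr s + c powr s))"
        using nonneg g s by (intro mult_left_mono powr_add_le) auto
      also have "\<dots> = (2 * a) powr s * (g x powr s + c powr s)" using nonneg by (simp add: powr_mult)
      finally have "ennreal ((a * (g x + c)) powr s) \<le> ennreal ((2 * a) powr s * (g x powr s + c powr s))"
        by (rule ennreal_leI)
      then show ?thesis using True by (simp add: ennreal_mult ennreal_plus)
    qed simp
  qed
  also have "\<dots> = ennreal ((2 * a) powr s) * ((\<integral>\<^sup>+x. ennreal (g x powr s) \<partial>M) + ennreal (c powr s) * emeasure M S)"
    by (simp add: nn_integral_cmult nn_integral_add nn_integral_cmult_indicator)
  also have "\<dots> \<le> ennreal ((2 * a) powr s) * (ennreal X + ennreal Y)"
  proof (intro mult_left_mono add_mono X)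
    show "ennreal (c powr s) * emeasure M S \<le> ennreal Y"
      using Y by (simp add: eS ennreal_mult[symmetric] ennreal_leI)
  qed auto
  also have "\<dots> = ennreal ((2 * a) powr s * (X + Y))"
    using nonneg Y0 by (simp add: ennreal_mult ennreal_plus)
  finally show ?thesis .
qed

text \<open>The A_1 estimate v <= A * d^n * u raised to the power 1 - \<theta> and rearranged. Here
  d = |x-y|, v is the measure of B(x,d), and u may be the density at x or at y, both points being in
  the ball.\<close>

lemma kernel_le_V:
  fixes d u v \<theta> A n :: real
  assumes "0 < d" "0 < u" "0 < v" "0 < A" "\<theta> < 1" and le: "v \<le> A * d powr n * u"
  shows "d powr (n * (\<theta>-1)) \<le> A powr (1-\<theta>) * u powr (1-\<theta>) * v powr (\<theta>-1)"
proof -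
  have "v powr (1-\<theta>) \<le> (A * d powr n * u) powr (1-\<theta>)" using assms by (intro powr_mono2) auto
  also have "\<dots> = A powr (1-\<theta>) * u powr (1-\<theta>) * d powr (n * (1-\<theta>))"
    using assms by (simp add: powr_mult powr_powr)
  finally have *: "v powr (1-\<theta>) \<le> A powr (1-\<theta>) * u powr (1-\<theta>) * d powr (n * (1-\<theta>))" .
  have 1: "v powr (\<theta>-1) = 1 / v powr (1-\<theta>)" by (simp add: powr_minus_divide[symmetric])
  have 2: "d powr (n * (\<theta>-1)) = 1 / d powr (n * (1-\<theta>))"
    by (simp add: powr_minus_divide[symmetric] algebra_simps)
  show ?thesis unfolding 1 2 using * assms by (simp add: field_simps)
qed

lemma nn_integral_truncate_powr_le:
  fixes f :: "'a \<Rightarrow> real"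
  assumes "(\<integral>\<^sup>+y\<in>S. ennreal (f y powr p) \<partial>M) \<le> ennreal (N powr p * v powr \<kappa>)" "0 < N" "0 \<le> v" "0 < p"
  shows "(\<integral>\<^sup>+y. ennreal ((f y * indicator S y) powr p) \<partial>M) \<le> ennreal ((N * v powr (\<kappa>/p)) powr p)"
proof -
  have "(\<integral>\<^sup>+y. ennreal ((f y * indicator S y) powr p) \<partial>M) = (\<integral>\<^sup>+y\<in>S. ennreal (f y powr p) \<partial>M)"
    by (intro nn_integral_cong) (auto simp: indicator_def)
  moreover have "(N * v powr (\<kappa>/p)) powr p = N powr p * v powr \<kappa>"
    using assms by (simp add: powr_mult powr_powr)
  ultimately show ?thesis using assms(1) by simp
qed

context A1_weight begin

text \<open>The kernel is traded with the density taken at x, so that w(x)^(1-\<theta>) leaves the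
  integral and a fractional integral for \<mu> remains. Its near part falls under the strong type
  theorem, applied to f cut off to the ball of radius 2R; its far part is bounded uniformly on
  B(x0,R) by \<open>kernel_far\<close>.\<close>

lemma Morrey_local_bound:
  assumes p: "1 < p" and \<theta>: "0 < \<theta>" "\<theta> < 1/p" and s: "1/s = 1/p - \<theta>"
    and \<kappa>: "0 \<le> \<kappa>" "\<kappa> < p/s"
  shows "\<exists>C>0. \<forall>f N x0 R. f \<in> borel_measurable lebesgue \<longrightarrow> (\<forall>y. 0 \<le> f y) \<longrightarrow> 0 < N \<longrightarrow> 0 < R \<longrightarrow>
     (\<forall>z r. 0 < r \<longrightarrow> (\<integral>\<^sup>+y\<in>cball z r. ennreal (f y powr p) \<partial>wm w) \<le> ennreal (N powr p * V z r powr \<kappa>)) \<longrightarrow>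
     (\<exists>g. g \<in> borel_measurable lebesgue \<and> (\<forall>x. 0 \<le> g x) \<and>
       (AE x in lebesgue. x \<in> cball x0 R \<longrightarrow>
          (\<integral>\<^sup>+y. ennreal (f y * dist x y powr (real CARD('n) * (\<theta>-1))) \<partial>wm w) \<le> ennreal (w x powr (1-\<theta>) * g x)) \<and>
       (\<integral>\<^sup>+x. ennreal (g x powr s) \<partial>wm w) \<le> ennreal (C * N powr s * V x0 R powr (\<kappa> * s / p)))"
proof -
  let ?n = "real CARD('n)"
  let ?k = "\<lambda>x y. dist x y powr (?n * (\<theta>-1))"
  let ?K = "\<lambda>x y. V x (dist x y) powr (\<theta>-1)"
  have s0: "s > 0" using s \<theta> by (metis diff_gt_0_iff_gt zero_less_divide_1_iff)
  have \<theta>1: "\<theta> < 1" using \<theta> p by (smt (verit) divide_less_eq_1)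
  have \<kappa>s: "\<kappa>/p < 1/p - \<theta>" unfolding s[symmetric] using \<kappa> p s0 by (simp add: field_simps)
  define \<epsilon> where "\<epsilon> = 1/s - \<kappa>/p"
  have \<epsilon>: "\<epsilon> > 0" using \<kappa>s s by (simp add: \<epsilon>_def)
  obtain C1 where C1: "C1 > 0" "\<And>f F. f \<in> borel_measurable (wm w) \<Longrightarrow> (\<And>y. 0 \<le> f y) \<Longrightarrow> 0 < F \<Longrightarrow>
     (\<integral>\<^sup>+y. ennreal (f y powr p) \<partial>wm w) \<le> ennreal (F powr p) \<Longrightarrow>
     (\<exists>g. g \<in> borel_measurable (wm w) \<and> (\<forall>x. 0 \<le> g x) \<and>
       (AE x in wm w. (\<integral>\<^sup>+y. ennreal (f y * ?K x y) \<partial>wm w) \<le> ennreal (g x)) \<and>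
       (\<integral>\<^sup>+x. ennreal (g x powr s) \<partial>wm w) \<le> ennreal (C1 * F powr s))"
    using fractional_integral_strong_type[OF p \<theta> s] by blast
  obtain C2 where C2: "C2 > 0" "\<And>f x \<rho> N. f \<in> borel_measurable (wm w) \<Longrightarrow> (\<And>y. 0 \<le> f y) \<Longrightarrow> 0 < \<rho> \<Longrightarrow> 0 \<le> N \<Longrightarrow>
     (\<And>r. 0 < r \<Longrightarrow> (\<integral>\<^sup>+y\<in>cball x r. ennreal (f y powr p) \<partial>wm w) \<le> ennreal (N powr p * V x r powr \<kappa>)) \<Longrightarrow>
     (\<integral>\<^sup>+y\<in>- cball x \<rho>. ennreal (f y * ?K x y) \<partial>wm w)
       \<le> ennreal (C2 * N * V x \<rho> powr (\<kappa>/p + \<theta> - 1/p))"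
    using kernel_far[OF p \<theta>1 \<kappa>(1) \<kappa>s] by blast
  define a where "a = A powr (1-\<theta>)"
  have a: "a > 0" using A_pos by (simp add: a_def)
  define K where "K = C2 * D powr \<epsilon>"
  have K: "K > 0" using C2 D_ge_1 by (simp add: K_def)
  define C where "C = (2 * a) powr s * (C1 * D powr (\<kappa> * s / p) + K powr s)"
  have C: "C > 0" unfolding C_def using a C1 K by (intro mult_pos_pos add_nonneg_pos) auto
  have "\<exists>g. g \<in> borel_measurable lebesgue \<and> (\<forall>x. 0 \<le> g x) \<and>
       (AE x in lebesgue. x \<in> cball x0 R \<longrightarrow>
          (\<integral>\<^sup>+y. ennreal (f y * ?k x y) \<partial>wm w) \<le> ennreal (w x powr (1-\<theta>) * g x)) \<and>
       (\<integral>\<^sup>+x. ennreal (g x powr s) \<partial>wm w) \<le> ennreal (C * N powr s * V x0 R powr (\<kappa> * s / p))"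
    if f [measurable]: "f \<in> borel_measurable lebesgue" and f0: "\<And>y. 0 \<le> f y" and N: "0 < N" and R: "0 < R"
      and mor: "\<And>z r. 0 < r \<Longrightarrow> (\<integral>\<^sup>+y\<in>cball z r. ennreal (f y powr p) \<partial>wm w) \<le> ennreal (N powr p * V z r powr \<kappa>)"
    for f N x0 R
  proof -
    have [measurable]: "f \<in> borel_measurable (wm w)" using f by simp
    \<comment> \<open>It contains B(x,R) for every x in B(x0,R), so cutting off to it leaves the
      near part of each such x untouched.\<close>
    let ?S = "cball x0 (2*R)"
    define f1 where "f1 y = f y * indicator ?S y" for y
    have f1: "f1 \<in> borel_measurable (wm w)" "\<And>y. 0 \<le> f1 y"
      unfolding f1_def using f0 by (measurable, auto simp: indicator_def)
    define F where "F = N * V x0 (2*R) powr (\<kappa>/p)"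
    have F: "0 < F" unfolding F_def using N V_pos[of "2*R" x0] R by simp
    have f1F: "(\<integral>\<^sup>+y. ennreal (f1 y powr p) \<partial>wm w) \<le> ennreal (F powr p)"
      unfolding f1_def F_def using R N p by (intro nn_integral_truncate_powr_le mor) auto
    obtain g0 where g0: "g0 \<in> borel_measurable (wm w)" "\<And>x. 0 \<le> g0 x"
      "AE x in wm w. (\<integral>\<^sup>+y. ennreal (f1 y * ?K x y) \<partial>wm w) \<le> ennreal (g0 x)"
      "(\<integral>\<^sup>+x. ennreal (g0 x powr s) \<partial>wm w) \<le> ennreal (C1 * F powr s)"
      using C1(2)[OF f1 F f1F] by blast
    let ?V0 = "V x0 R"
    have V0: "?V0 > 0" by (rule V_pos[OF R])
    \<comment> \<open>The far bound at x with V(x,R) replaced by V(x0,R)/D, which removes the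
      dependence on x.\<close>
    define c0 where "c0 = K * N * ?V0 powr (-\<epsilon>)"
    have c0: "c0 \<ge> 0" using K N by (simp add: c0_def)
    define g where "g x = a * (g0 x + c0) * indicator (cball x0 R) x" for x
    have gm: "g \<in> borel_measurable lebesgue"
    proof -
      have [measurable]: "g0 \<in> borel_measurable lebesgue" "cball x0 R \<in> sets lebesgue" using g0(1) by auto
      show ?thesis unfolding g_def by measurable
    qed
    have gn: "0 \<le> g x" for x using a g0(2) c0 by (simp add: g_def indicator_def)
    have pw: "AE x in lebesgue. x \<in> cball x0 R \<longrightarrow>
          (\<integral>\<^sup>+y. ennreal (f y * ?k x y) \<partial>wm w) \<le> ennreal (w x powr (1-\<theta>) * g x)"
      using g0(3)[unfolded AE_wm_iff[OF weight]] all_balls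
    proof eventually_elim
      case (elim x)
      show ?case
      proof
        assume x: "x \<in> cball x0 R"
        have kern: "?k x y \<le> a * w x powr (1-\<theta>) * ?K x y" for y
        proof (cases "x = y")
          case False
          have "V x (dist x y) \<le> A * dist x y ^ CARD('n) * w x" using elim(2) False by simp
          then show ?thesis unfolding a_def using False elim(2) A_pos \<theta>1 V_pos[of "dist x y" x]
            by (intro kernel_le_V) (auto simp: powr_realpow)
        qed (use a in simp)
        have near: "(\<integral>\<^sup>+y\<in>cball x R. ennreal (f y * ?K x y) \<partial>wm w) \<le> ennreal (g0 x)"
        proof -
          have "y \<in> ?S" if "y \<in> cball x R" for y
            using dist_triangle[of x0 y x] x that by auto
          then have "(\<integral>\<^sup>+y\<in>cball x R. ennreal (f y * ?K x y) \<partial>wm w)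
              \<le> (\<integral>\<^sup>+y. ennreal (f1 y * ?K x y) \<partial>wm w)"
            unfolding f1_def by (intro nn_integral_mono) (auto simp: indicator_def)
          then show ?thesis using elim(1) by (rule order_trans)
        qed
        have far: "(\<integral>\<^sup>+y\<in>- cball x R. ennreal (f y * ?K x y) \<partial>wm w) \<le> ennreal c0"
        proof -
          have "(\<integral>\<^sup>+y\<in>- cball x R. ennreal (f y * ?K x y) \<partial>wm w)
              \<le> ennreal (C2 * N * V x R powr (\<kappa>/p + \<theta> - 1/p))"
            using f f0 R N mor by (intro C2(2)) auto
          also have "\<kappa>/p + \<theta> - 1/p = -\<epsilon>" using s by (simp add: \<epsilon>_def)
          also have "C2 * N * V x R powr (-\<epsilon>) \<le> C2 * N * (?V0 / D) powr (-\<epsilon>)"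
          proof -
            have "?V0 \<le> D^1 * V x R" using x R by (intro V_compare) (auto simp: dist_commute)
            then have "?V0 / D \<le> V x R" using D_ge_1 by (simp add: field_simps)
            then show ?thesis using C2(1) N V0 D_ge_1 \<epsilon> by (intro mult_left_mono powr_mono2') auto
          qed
          also have "C2 * N * (?V0 / D) powr (-\<epsilon>) = c0"
            using V0 D_ge_1 by (simp add: c0_def K_def powr_divide powr_minus field_simps)
          finally show ?thesis by (simp add: ennreal_leI)
        qed
        have "(\<integral>\<^sup>+y. ennreal (f y * ?k x y) \<partial>wm w)
            \<le> (\<integral>\<^sup>+y. ennreal (a * w x powr (1-\<theta>)) * ennreal (f y * ?K x y) \<partial>wm w)"
        proof (rule nn_integral_mono)
          fix y
          have "f y * ?k x y \<le> f y * (a * w x powr (1-\<theta>) * ?K x y)"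
            by (rule mult_left_mono[OF kern f0])
          then have "ennreal (f y * ?k x y)
              \<le> ennreal ((a * w x powr (1-\<theta>)) * (f y * ?K x y))"
            by (intro ennreal_leI) (simp add: mult_ac)
          also have "\<dots> = ennreal (a * w x powr (1-\<theta>)) * ennreal (f y * ?K x y)"
            using a f0 by (intro ennreal_mult) auto
          finally show "ennreal (f y * ?k x y)
              \<le> ennreal (a * w x powr (1-\<theta>)) * ennreal (f y * ?K x y)" .
        qed
        also have "\<dots> = ennreal (a * w x powr (1-\<theta>)) * (\<integral>\<^sup>+y. ennreal (f y * ?K x y) \<partial>wm w)"
          by (rule nn_integral_cmult) measurable
        also have "(\<integral>\<^sup>+y. ennreal (f y * ?K x y) \<partial>wm w)
          = (\<integral>\<^sup>+y\<in>cball x R. ennreal (f y * ?K x y) \<partial>wm w)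
           + (\<integral>\<^sup>+y\<in>- cball x R. ennreal (f y * ?K x y) \<partial>wm w)"
          by (rule nn_integral_split_near_far[OF _ sets_wm]) measurable
        also have "ennreal (a * w x powr (1-\<theta>)) * \<dots> \<le> ennreal (a * w x powr (1-\<theta>)) * (ennreal (g0 x) + ennreal c0)"
          by (intro mult_left_mono add_mono near far) simp
        also have "\<dots> = ennreal (a * w x powr (1-\<theta>) * (g0 x + c0))"
          using a g0(2) c0 by (simp add: ennreal_mult ennreal_plus)
        also have "a * w x powr (1-\<theta>) * (g0 x + c0) = w x powr (1-\<theta>) * g x"
          using x by (simp add: g_def)
        finally show "(\<integral>\<^sup>+y. ennreal (f y * ?k x y) \<partial>wm w) \<le> ennreal (w x powr (1-\<theta>) * g x)" .
      qed
    qed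
    have "(\<integral>\<^sup>+x. ennreal (g x powr s) \<partial>wm w) \<le> ennreal ((2 * a) powr s * (C1 * F powr s + c0 powr s * ?V0))"
      unfolding g_def using g0 c0 a C1(1) s0 ball_finite
      by (intro nn_integral_add_const_powr_le) auto
    also have "\<dots> \<le> ennreal (C * N powr s * ?V0 powr (\<kappa> * s / p))"
    proof (rule ennreal_leI)
      have "F powr s = N powr s * V x0 (2*R) powr (\<kappa> * s / p)"
        using N by (simp add: F_def powr_mult powr_powr)
      also have "\<dots> \<le> N powr s * (D * ?V0) powr (\<kappa> * s / p)"
        using doubling[OF R] \<kappa> s0 p by (intro mult_left_mono powr_mono2) auto
      also have "\<dots> = D powr (\<kappa> * s / p) * (N powr s * ?V0 powr (\<kappa> * s / p))"
        using D_ge_1 V0 by (simp add: powr_mult)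
      finally have 1: "C1 * F powr s \<le> C1 * D powr (\<kappa> * s / p) * (N powr s * ?V0 powr (\<kappa> * s / p))"
        using C1(1) by simp
      \<comment> \<open>Integrating the constant far bound over the ball gives the same power of the
        ball measure as the near part.\<close>
      have e: "-\<epsilon> * s + 1 = \<kappa> * s / p" using s0 p by (simp add: \<epsilon>_def field_simps)
      have "c0 powr s * ?V0 = K powr s * N powr s * (?V0 powr (-\<epsilon> * s) * ?V0 powr 1)"
        using K N V0 by (simp add: c0_def powr_mult powr_powr)
      also have "?V0 powr (-\<epsilon> * s) * ?V0 powr 1 = ?V0 powr (\<kappa> * s / p)"
        unfolding e[symmetric] by (rule powr_add[symmetric])
      finally have 2: "c0 powr s * ?V0 = K powr s * (N powr s * ?V0 powr (\<kappa> * s / p))" by simp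
      have "C1 * F powr s + c0 powr s * ?V0 \<le> (C1 * D powr (\<kappa> * s / p) + K powr s) * (N powr s * ?V0 powr (\<kappa> * s / p))"
        using 1 2 by (simp add: distrib_right)
      then have "(2 * a) powr s * (C1 * F powr s + c0 powr s * ?V0)
          \<le> (2 * a) powr s * ((C1 * D powr (\<kappa> * s / p) + K powr s) * (N powr s * ?V0 powr (\<kappa> * s / p)))"
        by (rule mult_left_mono) simp
      then show "(2 * a) powr s * (C1 * F powr s + c0 powr s * ?V0) \<le> C * N powr s * ?V0 powr (\<kappa> * s / p)"
        by (simp add: C_def mult.assoc)
    qed
    finally have "(\<integral>\<^sup>+x. ennreal (g x powr s) \<partial>wm w) \<le> ennreal (C * N powr s * ?V0 powr (\<kappa> * s / p))" .
    then show ?thesis using gm gn pw by blast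
  qed
  then show ?thesis using C by blast
qed

end

section \<open>Far parts with respect to Lebesgue measure\<close>

context A1_weight begin

text \<open>By A_1, 1 <= (A * r^n / V) * w(y) almost everywhere on the ball. Inserting this turns
  Lebesgue measure into w dy, and \<open>ball_Holder\<close> applies.\<close>

lemma ball_integral_le:
  assumes f [measurable]: "f \<in> borel_measurable lebesgue" and f0: "\<And>y. 0 \<le> f y" and p: "1 < p" and N: "0 \<le> N"
    and r: "0 < r" and mor: "(\<integral>\<^sup>+y\<in>cball x r. ennreal (f y powr p) \<partial>wm w) \<le> ennreal (N powr p * V x r powr \<kappa>)"
  shows "(\<integral>\<^sup>+y\<in>cball x r. ennreal (f y) \<partial>lebesgue) \<le> ennreal (2 * A * N * r ^ CARD('n) * V x r powr ((\<kappa>-1)/p))"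
proof -
  let ?V = "V x r" and ?t = "A * r ^ CARD('n) / V x r"
  have V: "0 < ?V" by (rule V_pos[OF r])
  have t: "0 < ?t" using V A_pos r by simp
  have [measurable]: "cball x r \<in> sets lebesgue" "w \<in> borel_measurable lebesgue"
    using weight_measurable[OF weight] by auto
  have "(\<integral>\<^sup>+y\<in>cball x r. ennreal (f y) \<partial>lebesgue)
      \<le> (\<integral>\<^sup>+y. ennreal ?t * (ennreal (w y) * (ennreal (f y) * indicator (cball x r) y)) \<partial>lebesgue)"
  proof (rule nn_integral_mono_AE)
    show "AE y in lebesgue. ennreal (f y) * indicator (cball x r) y
        \<le> ennreal ?t * (ennreal (w y) * (ennreal (f y) * indicator (cball x r) y))"
      using all_balls
    proof eventually_elim
      case (elim y)
      show ?case
      proof (cases "y \<in> cball x r")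
        case True
        then have "?V \<le> A * r ^ CARD('n) * w y" using elim r by blast
        then have "1 \<le> ?t * w y" using V by (simp add: field_simps)
        then have "f y \<le> ?t * w y * f y" using mult_right_mono[OF _ f0[of y], of 1 "?t * w y"] by simp
        then have "ennreal (f y) \<le> ennreal (?t * (w y * f y))" by (intro ennreal_leI) (simp add: mult_ac)
        also have "\<dots> = ennreal ?t * (ennreal (w y) * ennreal (f y))"
          using t elim f0[of y] by (simp only: ennreal_mult less_imp_le mult_nonneg_nonneg)
        finally show ?thesis using True by simp
      qed simp
    qed
  qed
  also have "\<dots> = ennreal ?t * (\<integral>\<^sup>+y. ennreal (w y) * (ennreal (f y) * indicator (cball x r) y) \<partial>lebesgue)"
    by (rule nn_integral_cmult) measurable
  also have "(\<integral>\<^sup>+y. ennreal (w y) * (ennreal (f y) * indicator (cball x r) y) \<partial>lebesgue)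
      = (\<integral>\<^sup>+y\<in>cball x r. ennreal (f y) \<partial>wm w)"
    by (rule nn_integral_wm[OF weight, symmetric]) measurable
  also have "ennreal ?t * \<dots> \<le> ennreal ?t * ennreal (2 * N * ?V powr (\<kappa>/p + 1 - 1/p))"
    using f f0 p N mor by (intro mult_left_mono ball_Holder) auto
  also have "\<dots> = ennreal (?t * (2 * N * ?V powr (\<kappa>/p + 1 - 1/p)))"
    using t N by (intro ennreal_mult[symmetric]) auto
  also have "?t * (2 * N * ?V powr (\<kappa>/p + 1 - 1/p)) = 2 * A * N * r ^ CARD('n) * (?V powr (\<kappa>/p + 1 - 1/p) / ?V)"
    by simp
  also have "?V powr (\<kappa>/p + 1 - 1/p) / ?V = ?V powr ((\<kappa>/p + 1 - 1/p) - 1)"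
    using V by (subst powr_diff) simp
  also have "(\<kappa>/p + 1 - 1/p) - 1 = (\<kappa>-1)/p" by (simp add: diff_divide_distrib)
  finally show ?thesis .
qed

text \<open>The sum over the dyadic shells converges because the reverse Hoelder inequality makes
  \<open>V\<close> grow at least like \<open>\<rho>\<close> to the power \<open>n (1 - 1/r)\<close>.\<close>
lemma unweighted_far:
  assumes p: "1 < p" and \<theta>: "\<theta> < 1" and \<kappa>: "\<kappa> < 1" and r: "1 < r" "RH r w"
    and conv: "\<theta> < (1 - 1/r) * (1 - \<kappa>) / p"
  shows "\<exists>C>0. \<forall>f x \<rho> N. f \<in> borel_measurable lebesgue \<longrightarrow> (\<forall>y. 0 \<le> f y) \<longrightarrow> 0 < \<rho> \<longrightarrow> 0 \<le> N \<longrightarrow>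
     (\<forall>r. 0 < r \<longrightarrow> (\<integral>\<^sup>+y\<in>cball x r. ennreal (f y powr p) \<partial>wm w) \<le> ennreal (N powr p * V x r powr \<kappa>)) \<longrightarrow>
     (\<integral>\<^sup>+y\<in>- cball x \<rho>. ennreal (f y * dist x y powr (real CARD('n) * (\<theta>-1))) \<partial>lebesgue)
       \<le> ennreal (C * N * \<rho> powr (real CARD('n) * \<theta>) * V x \<rho> powr ((\<kappa>-1)/p))"
proof -
  let ?n = "real CARD('n)"
  let ?k = "\<lambda>x y. dist x y powr (?n * (\<theta>-1))"
  have n: "?n > 0" by simp
  define e where "e = (1-\<kappa>)/p"
  have e: "e > 0" using \<kappa> p by (simp add: e_def)
  have e': "(\<kappa>-1)/p = -e" by (simp add: e_def minus_divide_left)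
  define d where "d = ?n * (1 - 1/r)"
  have d: "d > 0" using r n by (simp add: d_def)
  have conv': "?n * \<theta> < d * e"
  proof -
    have "?n * \<theta> < ?n * ((1 - 1/r) * (1 - \<kappa>) / p)" using conv n by (intro mult_strict_left_mono)
    then show ?thesis by (simp add: d_def e_def mult.assoc)
  qed
  \<comment> \<open>The ratio between consecutive shells: doubling the radius multiplies
    radius^(n*\<theta>) by 2^(n*\<theta>), while the bound for V^(-e) shrinks by 2^(-d*e).\<close>
  define q where "q = 2 powr (?n * \<theta> - d * e)"
  have q: "0 < q" "q < 1" using conv' powr_less_mono[of "?n * \<theta> - d * e" 0 2] by (auto simp: q_def)
  obtain C0 where C0: "C0 > 0" "\<And>x R R'. 0 < R \<Longrightarrow> R \<le> R' \<Longrightarrow> V x R \<le> C0 * (R / R') powr d * V x R'"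
    using RH_growth[OF r] unfolding d_def by blast
  define C1 where "C1 = 2 * A * 2 ^ CARD('n) * C0 powr e"
  have C1: "C1 > 0" using A_pos C0 by (simp add: C1_def)
  have "(\<integral>\<^sup>+y\<in>- cball x \<rho>. ennreal (f y * ?k x y) \<partial>lebesgue)
       \<le> ennreal (C1 / (1-q) * N * \<rho> powr (?n * \<theta>) * V x \<rho> powr (-e))"
    if f: "f \<in> borel_measurable lebesgue" and f0: "\<And>y. 0 \<le> f y" and \<rho>: "0 < \<rho>" and N: "0 \<le> N"
     and mor: "\<And>r. 0 < r \<Longrightarrow> (\<integral>\<^sup>+y\<in>cball x r. ennreal (f y powr p) \<partial>wm w) \<le> ennreal (N powr p * V x r powr \<kappa>)"
    for f x \<rho> N
  proof -
    let ?r = "\<lambda>j. 2^j * \<rho>"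
    have r: "0 < ?r j" for j using \<rho> by simp
    have "(\<integral>\<^sup>+y\<in>- cball x \<rho>. ennreal (f y * ?k x y) \<partial>lebesgue)
      \<le> (\<Sum>j. ennreal (?r j powr (?n * (\<theta>-1)) * (2 * A * N * ?r (Suc j) ^ CARD('n) * V x (?r (Suc j)) powr (-e))))"
    proof (rule nn_integral_shells_le[where B="\<lambda>j. cball x (?r (Suc j))"])
      fix y assume y: "y \<in> - cball x \<rho>"
      then obtain j where j: "?r j < dist x y" "dist x y \<le> ?r (Suc j)"
        using dyadic_shell_outer[OF \<rho>, of "dist x y"] by auto
      have "?k x y \<le> ?r j powr (?n * (\<theta>-1))"
        using r j \<theta> by (intro powr_mono2') (auto simp: mult_nonneg_nonpos)
      then show "?k x y \<le> 0 \<or> (\<exists>j. y \<in> cball x (?r (Suc j)) \<and>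
          ?k x y \<le> ?r j powr (?n * (\<theta>-1)))" using j by auto
    next
      fix j
      show "(\<integral>\<^sup>+y\<in>cball x (?r (Suc j)). ennreal (f y) \<partial>lebesgue)
          \<le> ennreal (2 * A * N * ?r (Suc j) ^ CARD('n) * V x (?r (Suc j)) powr (-e))"
        unfolding e'[symmetric] by (rule ball_integral_le[OF f f0 p N r mor[OF r]])
    qed (use f f0 in auto)
    also have "\<dots> \<le> ennreal (C1 * N * \<rho> powr (?n * \<theta>) * V x \<rho> powr (-e) / (1 - q))"
    proof (rule ennreal_suminf_geometric_le)
      fix j
      define t where "t = ?r j"
      have t: "0 < t" "?r (Suc j) = 2 * t" using \<rho> by (auto simp: t_def)
      have V0: "0 < V x \<rho>" by (rule V_pos[OF \<rho>])
      have rt: "\<rho> \<le> 2 * t"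
      proof -
        have "1 * \<rho> \<le> 2^Suc j * \<rho>" using \<rho> by (intro mult_right_mono one_le_power) auto
        then show ?thesis using t by simp
      qed
      \<comment> \<open>Growth is applied between \<rho> and the radius 2t of the ball in the
        summand, then weakened from 2t to t so that the powers of t combine.\<close>
      have Vle: "V x (2*t) powr (-e) \<le> C0 powr e * V x \<rho> powr (-e) * (t/\<rho>) powr (-(d*e))"
      proof -
        have "V x \<rho> \<le> C0 * (\<rho> / (2*t)) powr d * V x (2*t)" using \<rho> rt by (rule C0(2))
        also have "\<dots> \<le> C0 * (\<rho> / t) powr d * V x (2*t)"
          using C0 \<rho> t d by (intro mult_right_mono mult_left_mono powr_mono2) (auto simp: field_simps)
        finally have "V x \<rho> / (C0 * (\<rho> / t) powr d) \<le> V x (2*t)"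
          using C0 \<rho> t by (simp add: field_simps)
        then have "V x (2*t) powr (-e) \<le> (V x \<rho> / (C0 * (\<rho> / t) powr d)) powr (-e)"
          using V0 C0 \<rho> t e by (intro powr_mono2') auto
        also have "\<dots> = C0 powr e * V x \<rho> powr (-e) * ((\<rho> / t) powr (d*e))"
          using V0 C0(1) \<rho> t by (simp add: powr_divide powr_mult powr_powr powr_minus field_simps)
        also have "(\<rho> / t) powr (d*e) = (t/\<rho>) powr (-(d*e))"
          using \<rho> t by (simp add: powr_divide powr_minus field_simps)
        finally show ?thesis .
      qed
      have "t powr (?n * (\<theta>-1)) * (2 * A * N * (2*t) ^ CARD('n) * V x (2*t) powr (-e))
          \<le> t powr (?n * (\<theta>-1)) * (2 * A * N * (2*t) ^ CARD('n) *
              (C0 powr e * V x \<rho> powr (-e) * (t/\<rho>) powr (-(d*e))))"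
        using A_pos N t Vle by (intro mult_left_mono) auto
      also have "\<dots> = C1 * N * V x \<rho> powr (-e) * (t powr (?n * (\<theta>-1)) * t ^ CARD('n)) * (t/\<rho>) powr (-(d*e))"
        by (simp add: C1_def power_mult_distrib)
      also have "t powr (?n * (\<theta>-1)) * t ^ CARD('n) = t powr (?n * \<theta>)"
        using t by (simp add: powr_realpow[symmetric] powr_add[symmetric] algebra_simps)
      also have "t powr (?n * \<theta>) = \<rho> powr (?n * \<theta>) * (t/\<rho>) powr (?n * \<theta>)"
        using \<rho> t by (simp add: powr_divide)
      also have "C1 * N * V x \<rho> powr (-e) * (\<rho> powr (?n * \<theta>) * (t/\<rho>) powr (?n * \<theta>)) * (t/\<rho>) powr (-(d*e))
          = C1 * N * \<rho> powr (?n * \<theta>) * V x \<rho> powr (-e) * ((t/\<rho>) powr (?n * \<theta>) * (t/\<rho>) powr (-(d*e)))"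
        by (simp add: mult_ac)
      also have "(t/\<rho>) powr (?n * \<theta>) * (t/\<rho>) powr (-(d*e)) = (t/\<rho>) powr (?n * \<theta> - d * e)"
        by (simp add: powr_add[symmetric])
      also have "\<dots> = q ^ j"
      proof -
        have "t/\<rho> = 2 powr real j" using \<rho> by (simp add: t_def powr_realpow)
        then show ?thesis by (simp add: q_def powr_powr powr_realpow[symmetric] mult.commute)
      qed
      finally show "?r j powr (?n * (\<theta>-1)) * (2 * A * N * ?r (Suc j) ^ CARD('n) * V x (?r (Suc j)) powr (-e))
          \<le> C1 * N * \<rho> powr (?n * \<theta>) * V x \<rho> powr (-e) * q ^ j"
        unfolding t(2) t_def[symmetric] .
    qed (use q N C1 in auto)
    finally show ?thesis by (simp add: mult_ac)
  qed
  moreover have "C1 / (1-q) > 0" using C1 q by simp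
  ultimately show ?thesis unfolding e' by blast
qed

end

text \<open>A_1 for w^q bounds w^q from below on the ball by a multiple of its mean; taking q-th
  roots and integrating bounds the w-measure from below. This is a reverse Hoelder estimate. It
  converts \<nu>-measures of balls into \<mu>-measures, in which the Morrey norm is
  expressed.\<close>

lemma powr_weight_ball_le:
  fixes w :: "real^'n \<Rightarrow> real"
  assumes wA: "A1_weight w A" and WB: "A1_weight (\<lambda>x. w x powr q) B" and q: "0 < q"
  shows "\<exists>K>0. \<forall>x R. 0 < R \<longrightarrow> measure (wm (\<lambda>x. w x powr q)) (cball x R)
     \<le> K * R powr (real CARD('n) * (1 - q)) * measure (wm w) (cball x R) powr q"
proof -
  interpret w: A1_weight w A by (rule wA)
  interpret W: A1_weight "\<lambda>x. w x powr q" B by (rule WB)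
  let ?n = "real CARD('n)" and ?\<omega> = "unit_ball_vol (real CARD('n))"
  have \<omega>: "0 < ?\<omega>" by (simp add: unit_ball_vol_pos)
  define K where "K = B / ?\<omega> powr q"
  have "0 < ?\<omega> powr q" using \<omega> by (metis less_irrefl powr_gt_zero)
  then have K: "K > 0" unfolding K_def by (intro divide_pos_pos W.A_pos)
  have "W.V x R \<le> K * R powr (?n * (1 - q)) * w.V x R powr q" if R: "0 < R" for x R
  proof -
    let ?V = "w.V x R" and ?VW = "W.V x R"
    \<comment> \<open>The lower bound for w that A_1 of w^q gives almost everywhere on the
      ball.\<close>
    define t where "t = (?VW / (B * R ^ CARD('n))) powr (1/q)"
    have VW: "0 < ?VW" by (rule W.V_pos[OF R])
    have V: "0 < ?V" by (rule w.V_pos[OF R])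
    have t0: "0 < t" using VW W.A_pos R by (simp add: t_def)
    have vol: "emeasure lebesgue (cball x R) = ennreal (?\<omega> * R ^ CARD('n))"
      using R by (simp add: emeasure_cball)
    have [measurable]: "w \<in> borel_measurable lebesgue" by (rule weight_measurable[OF w.weight])
    have "ennreal (t * (?\<omega> * R ^ CARD('n))) = (\<integral>\<^sup>+y. ennreal t * indicator (cball x R) y \<partial>lebesgue)"
      using t0 \<omega> R by (subst nn_integral_cmult_indicator) (auto simp: vol ennreal_mult)
    also have "\<dots> \<le> (\<integral>\<^sup>+y\<in>cball x R. ennreal (w y) \<partial>lebesgue)"
    proof (rule nn_integral_mono_AE)
      show "AE y in lebesgue. ennreal t * indicator (cball x R) y \<le> ennreal (w y) * indicator (cball x R) y"
        using W.all_balls w.all_balls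
      proof eventually_elim
        case (elim y)
        show ?case
        proof (cases "y \<in> cball x R")
          case True
          then have "?VW \<le> B * R ^ CARD('n) * w y powr q" using elim R by blast
          then have "?VW / (B * R ^ CARD('n)) \<le> w y powr q" using W.A_pos R by (simp add: field_simps)
          then have "t \<le> (w y powr q) powr (1/q)"
            unfolding t_def using VW W.A_pos R q by (intro powr_mono2) auto
          also have "\<dots> = w y" using elim q by (simp add: powr_powr)
          finally show ?thesis using True by (simp add: ennreal_leI)
        qed simp
      qed
    qed
    also have "\<dots> = emeasure (wm w) (cball x R)"
      unfolding wm_def by (rule emeasure_density[symmetric]) auto
    also have "\<dots> = ennreal ?V" by (rule w.emeasure_cball_eq)
    finally have "t * (?\<omega> * R ^ CARD('n)) \<le> ?V" by (simp add: ennreal_le_iff)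
    then have "t \<le> ?V / (?\<omega> * R ^ CARD('n))" using \<omega> R by (simp add: field_simps)
    then have "t powr q \<le> (?V / (?\<omega> * R ^ CARD('n))) powr q" using t0 q by (intro powr_mono2) auto
    also have "t powr q = ?VW / (B * R ^ CARD('n))" using q VW W.A_pos R by (simp add: t_def powr_powr)
    finally have "?VW \<le> B * R ^ CARD('n) * (?V / (?\<omega> * R ^ CARD('n))) powr q"
      using W.A_pos R by (simp add: field_simps)
    also have "\<dots> = K * (R powr ?n * (R powr ?n) powr (-q)) * ?V powr q"
      using V \<omega> R by (simp add: K_def powr_divide powr_mult powr_realpow powr_minus field_simps)
    also have "R powr ?n * (R powr ?n) powr (-q) = R powr (?n * (1 - q))"
      by (simp add: powr_powr powr_add[symmetric] algebra_simps)
    finally show ?thesis .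
  qed
  then show ?thesis using K by blast
qed

text \<open>As the integral carries no weight, the kernel is traded with the density of \<nu> at y,
  which supplies the missing \<nu>. This is done for the near part only: the Morrey bound concerns
  \<mu>, so the far part stays with Lebesgue measure and goes through
  \<open>unweighted_far\<close>.\<close>

lemma unweighted_Morrey_local_bound:
  fixes w :: "real^'n \<Rightarrow> real"
  defines "W \<equiv> \<lambda>q x. w x powr q"
  assumes wA: "A1_weight w A" and WB: "A1_weight (W (s/p)) B"
    and p: "1 < p" and \<theta>: "0 < \<theta>" "\<theta> < 1/p" and s: "1/s = 1/p - \<theta>"
    and \<kappa>: "0 \<le> \<kappa>" "\<kappa> < p/s" and r: "1 < r" "RH r w" "1/r < p/s - \<kappa>"
  shows "\<exists>C>0. \<forall>f N x0 R. f \<in> borel_measurable lebesgue \<longrightarrow> (\<forall>y. 0 \<le> f y) \<longrightarrow> 0 < N \<longrightarrow> 0 < R \<longrightarrow>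
     (\<forall>z r. 0 < r \<longrightarrow> (\<integral>\<^sup>+y\<in>cball z r. ennreal (f y powr p) \<partial>wm w)
         \<le> ennreal (N powr p * measure (wm w) (cball z r) powr \<kappa>)) \<longrightarrow>
     (\<exists>g. g \<in> borel_measurable lebesgue \<and> (\<forall>x. 0 \<le> g x) \<and>
       (AE x in lebesgue. x \<in> cball x0 R \<longrightarrow>
          (\<integral>\<^sup>+y. ennreal (f y * dist x y powr (real CARD('n) * (\<theta>-1))) \<partial>lebesgue) \<le> ennreal (g x)) \<and>
       (\<integral>\<^sup>+x. ennreal (g x powr s) \<partial>wm (W (s/p)))
          \<le> ennreal (C * N powr s * measure (wm w) (cball x0 R) powr (\<kappa> * s / p)))"
proof -
  define q where "q = s/p"
  interpret w: A1_weight w A by (rule wA)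
  interpret W: A1_weight "W q" B using WB by (simp add: q_def)
  let ?n = "real CARD('n)"
  let ?k = "\<lambda>x y. dist x y powr (?n * (\<theta>-1))"
  let ?K = "\<lambda>x y. W.V x (dist x y) powr (\<theta>-1)"
  have s0: "s > 0" using s \<theta> by (metis diff_gt_0_iff_gt zero_less_divide_1_iff)
  have q0: "q > 0" using s0 p by (simp add: q_def)
  have \<theta>1: "\<theta> < 1" using \<theta> p by (smt (verit) divide_less_eq_1)
  have ps: "p/s = 1 - p*\<theta>"
  proof -
    have "p/s = p * (1/s)" by simp
    also have "\<dots> = 1 - p*\<theta>" unfolding s using p by (simp add: field_simps)
    finally show ?thesis .
  qed
  have p\<theta>: "0 < p*\<theta>" using p \<theta> by simp
  have \<kappa>1: "\<kappa> < 1" using \<kappa> ps p\<theta> by linarith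
  have q\<theta>: "1 - q = - s*\<theta>"
  proof -
    have "q * (p/s) = q * (1 - p*\<theta>)" by (simp add: ps)
    then have "1 = q - q * p * \<theta>" using s0 p by (simp add: q_def algebra_simps)
    moreover have "q * p = s" using p by (simp add: q_def)
    ultimately show ?thesis by simp
  qed
  \<comment> \<open>The condition on r enters here. With t = p/s it says 1 - 1/r > 1 - t + \<kappa>,
    and (1 - t + \<kappa>) * (1 - \<kappa>) exceeds 1 - t = p*\<theta> by \<kappa>*(t - \<kappa>) >=
    0.\<close>
  have conv: "\<theta> < (1 - 1/r) * (1 - \<kappa>) / p"
  proof -
    define t where "t = p/s"
    have "(1 - t) \<le> (1 - t + \<kappa>) * (1 - \<kappa>)"
    proof -
      have "(1 - t + \<kappa>) * (1 - \<kappa>) = 1 - t + \<kappa> * (t - \<kappa>)" by (simp add: algebra_simps)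
      moreover have "0 \<le> \<kappa> * (t - \<kappa>)" using \<kappa> by (simp add: t_def)
      ultimately show ?thesis by simp
    qed
    also have "\<dots> < (1 - 1/r) * (1 - \<kappa>)" using r(3) \<kappa>1 by (intro mult_strict_right_mono) (auto simp: t_def)
    finally have "p * \<theta> < (1 - 1/r) * (1 - \<kappa>)" using ps by (simp add: t_def)
    then show ?thesis using p by (simp add: field_simps)
  qed
  obtain C1 where C1: "C1 > 0" "\<And>f F. f \<in> borel_measurable (wm (W q)) \<Longrightarrow> (\<And>y. 0 \<le> f y) \<Longrightarrow> 0 < F \<Longrightarrow>
     (\<integral>\<^sup>+y. ennreal (f y powr p) \<partial>wm (W q)) \<le> ennreal (F powr p) \<Longrightarrow>
     (\<exists>g. g \<in> borel_measurable (wm (W q)) \<and> (\<forall>x. 0 \<le> g x) \<and>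
       (AE x in wm (W q). (\<integral>\<^sup>+y. ennreal (f y * ?K x y) \<partial>wm (W q)) \<le> ennreal (g x)) \<and>
       (\<integral>\<^sup>+x. ennreal (g x powr s) \<partial>wm (W q)) \<le> ennreal (C1 * F powr s))"
    using W.fractional_integral_strong_type[OF p \<theta> s] by blast
  obtain C2 where C2: "C2 > 0" "\<And>f x \<rho> N. f \<in> borel_measurable lebesgue \<Longrightarrow> (\<And>y. 0 \<le> f y) \<Longrightarrow> 0 < \<rho> \<Longrightarrow> 0 \<le> N \<Longrightarrow>
     (\<And>r. 0 < r \<Longrightarrow> (\<integral>\<^sup>+y\<in>cball x r. ennreal (f y powr p) \<partial>wm w) \<le> ennreal (N powr p * w.V x r powr \<kappa>)) \<Longrightarrow>
     (\<integral>\<^sup>+y\<in>- cball x \<rho>. ennreal (f y * ?k x y) \<partial>lebesgue)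
       \<le> ennreal (C2 * N * \<rho> powr (?n * \<theta>) * w.V x \<rho> powr ((\<kappa>-1)/p))"
    using w.unweighted_far[OF p \<theta>1 \<kappa>1 r(1,2) conv] by blast
  obtain K where K: "K > 0" "\<And>x R. 0 < R \<Longrightarrow> W.V x R \<le> K * R powr (?n * (1 - q)) * w.V x R powr q"
    using powr_weight_ball_le[OF wA, of q B] W.A1_weight_axioms q0 unfolding W_def by blast
  define e where "e = (1-\<kappa>)/p"
  have e: "e > 0" "(\<kappa>-1)/p = -e" using \<kappa>1 p by (auto simp: e_def minus_divide_left)
  \<comment> \<open>One factor for both parts: the near part requires B^(1-\<theta>), the far part
    1.\<close>
  define a where "a = max 1 (B powr (1-\<theta>))"
  have a: "a > 0" "1 \<le> a" "B powr (1-\<theta>) \<le> a" by (auto simp: a_def)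
  define K' where "K' = C2 * w.D powr e"
  have K': "K' > 0" using C2 w.D_ge_1 by (simp add: K'_def)
  define C where "C = (2 * a) powr s * (C1 * w.D powr (\<kappa> * s / p) + K' powr s * K)"
  have C: "C > 0" unfolding C_def using a C1 K K' by (intro mult_pos_pos add_nonneg_pos) auto
  have "\<exists>g. g \<in> borel_measurable lebesgue \<and> (\<forall>x. 0 \<le> g x) \<and>
       (AE x in lebesgue. x \<in> cball x0 R \<longrightarrow>
          (\<integral>\<^sup>+y. ennreal (f y * ?k x y) \<partial>lebesgue) \<le> ennreal (g x)) \<and>
       (\<integral>\<^sup>+x. ennreal (g x powr s) \<partial>wm (W q)) \<le> ennreal (C * N powr s * w.V x0 R powr (\<kappa> * s / p))"
    if f [measurable]: "f \<in> borel_measurable lebesgue" and f0: "\<And>y. 0 \<le> f y" and N: "0 < N" and R: "0 < R"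
      and mor: "\<And>z r. 0 < r \<Longrightarrow> (\<integral>\<^sup>+y\<in>cball z r. ennreal (f y powr p) \<partial>wm w) \<le> ennreal (N powr p * w.V z r powr \<kappa>)"
    for f N x0 R
  proof -
    have [measurable]: "w \<in> borel_measurable lebesgue" "W q \<in> borel_measurable lebesgue"
      using weight_measurable[OF w.weight] weight_measurable[OF W.weight] by auto
    have [measurable]: "cball z t \<in> sets lebesgue" "- cball z t \<in> sets lebesgue" for z :: "real^'n" and t by auto
    let ?S = "cball x0 (2*R)"
    define f1 where "f1 y = f y * indicator ?S y" for y
    have f1 [measurable]: "f1 \<in> borel_measurable lebesgue" unfolding f1_def by measurable
    have f10: "0 \<le> f1 y" for y using f0 by (simp add: f1_def indicator_def)
    define F where "F = N * w.V x0 (2*R) powr (\<kappa>/p)"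
    have F: "0 < F" unfolding F_def using N w.V_pos[of "2*R" x0] R by simp
    have f1F: "(\<integral>\<^sup>+y. ennreal (f1 y powr p) \<partial>wm w) \<le> ennreal (F powr p)"
      unfolding f1_def F_def using R N p by (intro nn_integral_truncate_powr_le mor) auto
    \<comment> \<open>The cost W(y)^(1-\<theta>) of the kernel splits into W(y), which becomes
      d\<nu>, and W(y)^(-\<theta>), absorbed here. As q*(1 - \<theta>*p) = 1, W * \<phi>^p = w *
      f1^p, so the norm of \<phi> in L^p(\<nu>) is that of f1 in L^p(\<mu>).\<close>
    define \<phi> where "\<phi> y = f1 y * W q y powr (-\<theta>)" for y
    have \<phi>m [measurable]: "\<phi> \<in> borel_measurable lebesgue" unfolding \<phi>_def by measurable
    have \<phi>m': "\<phi> \<in> borel_measurable (wm (W q))" by simp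
    have \<phi>0: "0 \<le> \<phi> y" for y using f10 by (simp add: \<phi>_def)
    have \<phi>F: "(\<integral>\<^sup>+y. ennreal (\<phi> y powr p) \<partial>wm (W q)) \<le> ennreal (F powr p)"
    proof -
      have "(\<integral>\<^sup>+y. ennreal (\<phi> y powr p) \<partial>wm (W q)) = (\<integral>\<^sup>+y. ennreal (W q y) * ennreal (\<phi> y powr p) \<partial>lebesgue)"
        by (rule nn_integral_wm[OF W.weight]) measurable
      also have "\<dots> = (\<integral>\<^sup>+y. ennreal (w y) * ennreal (f1 y powr p) \<partial>lebesgue)"
      proof (rule nn_integral_cong_AE)
        show "AE y in lebesgue. ennreal (W q y) * ennreal (\<phi> y powr p) = ennreal (w y) * ennreal (f1 y powr p)"
          using w.all_balls
        proof eventually_elim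
          case (elim y)
          have "q * (1 - \<theta> * p) = 1" using ps s0 p by (simp add: q_def mult.commute field_simps)
          then have "w y = (w y powr q) powr (1 - \<theta> * p)" using elim by (simp add: powr_powr)
          also have "\<dots> = W q y * W q y powr (- \<theta> * p)"
            using elim by (simp add: W_def powr_diff powr_minus field_simps)
          finally have 1: "w y = W q y * W q y powr (- \<theta> * p)" .
          have "\<phi> y powr p = f1 y powr p * W q y powr (- \<theta> * p)"
            using f10 by (simp add: \<phi>_def powr_mult powr_powr W_def mult.assoc)
          then have "W q y * \<phi> y powr p = w y * f1 y powr p" using 1 by (simp add: mult_ac)
          moreover have "0 \<le> W q y" by (simp add: W_def)
          ultimately show ?case using elim by (simp add: ennreal_mult[symmetric])
        qed
      qed
      also have "\<dots> = (\<integral>\<^sup>+y. ennreal (f1 y powr p) \<partial>wm w)"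
        by (rule nn_integral_wm[OF w.weight, symmetric]) measurable
      finally show ?thesis using f1F by simp
    qed
    obtain g0 where g0: "g0 \<in> borel_measurable (wm (W q))" "\<And>x. 0 \<le> g0 x"
      "AE x in wm (W q). (\<integral>\<^sup>+y. ennreal (\<phi> y * ?K x y) \<partial>wm (W q)) \<le> ennreal (g0 x)"
      "(\<integral>\<^sup>+x. ennreal (g0 x powr s) \<partial>wm (W q)) \<le> ennreal (C1 * F powr s)"
      using C1(2)[OF \<phi>m' \<phi>0 F \<phi>F] by blast
    let ?V0 = "w.V x0 R"
    have V0: "?V0 > 0" by (rule w.V_pos[OF R])
    \<comment> \<open>The bound of \<open>unweighted_far\<close> at radius R, made uniform over x in
      B(x0,R) by one doubling.\<close>
    define c0 where "c0 = K' * N * R powr (?n * \<theta>) * ?V0 powr (-e)"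
    have c0: "c0 \<ge> 0" using K' N by (simp add: c0_def)
    define g where "g x = a * (g0 x + c0) * indicator (cball x0 R) x" for x
    have gm: "g \<in> borel_measurable lebesgue"
    proof -
      have [measurable]: "g0 \<in> borel_measurable lebesgue" using g0(1) by auto
      show ?thesis unfolding g_def by measurable
    qed
    have gn: "0 \<le> g x" for x using a g0(2) c0 by (simp add: g_def indicator_def)
    have pw: "AE x in lebesgue. x \<in> cball x0 R \<longrightarrow>
          (\<integral>\<^sup>+y. ennreal (f y * ?k x y) \<partial>lebesgue) \<le> ennreal (g x)"
      using g0(3)[unfolded AE_wm_iff[OF W.weight]]
    proof eventually_elim
      case (elim x)
      show ?case
      proof
        assume x: "x \<in> cball x0 R"
        have [measurable]: "(\<lambda>y. W.V x (dist x y)) \<in> borel_measurable lebesgue"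
          using W.V_dist_measurable[of x] by simp
        have near: "(\<integral>\<^sup>+y\<in>cball x R. ennreal (f y * ?k x y) \<partial>lebesgue) \<le> ennreal (a * g0 x)"
        proof -
          have inS: "y \<in> ?S" if "y \<in> cball x R" for y
            using dist_triangle[of x0 y x] x that by auto
          have "(\<integral>\<^sup>+y\<in>cball x R. ennreal (f y * ?k x y) \<partial>lebesgue)
              \<le> (\<integral>\<^sup>+y. ennreal a * (ennreal (W q y) * ennreal (\<phi> y * ?K x y)) \<partial>lebesgue)"
          proof (rule nn_integral_mono_AE)
            show "AE y in lebesgue. ennreal (f y * ?k x y) * indicator (cball x R) y
              \<le> ennreal a * (ennreal (W q y) * ennreal (\<phi> y * ?K x y))"
              using W.all_balls
            proof eventually_elim
              case (elim y)
              show ?case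
              proof (cases "y \<in> cball x R \<and> x \<noteq> y")
                case True
                have "W.V x (dist x y) \<le> B * dist x y ^ CARD('n) * W q y" using elim True by auto
                then have "?k x y \<le> B powr (1-\<theta>) * W q y powr (1-\<theta>) * ?K x y"
                  using True elim W.A_pos \<theta>1 W.V_pos[of "dist x y" x]
                  by (intro kernel_le_V) (auto simp: powr_realpow)
                also have "\<dots> \<le> a * W q y powr (1-\<theta>) * ?K x y"
                  using a by (intro mult_right_mono) auto
                finally have "f y * ?k x y \<le> f y * (a * W q y powr (1-\<theta>) * ?K x y)"
                  by (rule mult_left_mono[OF _ f0])
                also have "W q y powr (1-\<theta>) = W q y * W q y powr (-\<theta>)"
                  using elim by (simp add: powr_diff powr_minus field_simps)
                also have "f y * (a * (W q y * W q y powr (-\<theta>)) * ?K x y)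
                    = a * (W q y * (\<phi> y * ?K x y))"
                  using True inS by (simp add: \<phi>_def f1_def)
                finally have "ennreal (f y * ?k x y)
                    \<le> ennreal (a * (W q y * (\<phi> y * ?K x y)))" by (rule ennreal_leI)
                also have "\<dots> = ennreal a * (ennreal (W q y) * ennreal (\<phi> y * ?K x y))"
                  using a elim \<phi>0 by (simp add: ennreal_mult)
                finally show ?thesis using True by simp
              next
                case False
                then show ?thesis by (auto simp: indicator_def)
              qed
            qed
          qed
          also have "\<dots> = ennreal a * (\<integral>\<^sup>+y. ennreal (W q y) * ennreal (\<phi> y * ?K x y) \<partial>lebesgue)"
            by (rule nn_integral_cmult) measurable
          also have "(\<integral>\<^sup>+y. ennreal (W q y) * ennreal (\<phi> y * ?K x y) \<partial>lebesgue)
              = (\<integral>\<^sup>+y. ennreal (\<phi> y * ?K x y) \<partial>wm (W q))"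
            by (rule nn_integral_wm[OF W.weight, symmetric]) measurable
          also have "ennreal a * \<dots> \<le> ennreal a * ennreal (g0 x)" using elim by (rule mult_left_mono) simp
          also have "\<dots> = ennreal (a * g0 x)" using a g0(2) by (simp add: ennreal_mult)
          finally show ?thesis .
        qed
        have far: "(\<integral>\<^sup>+y\<in>- cball x R. ennreal (f y * ?k x y) \<partial>lebesgue) \<le> ennreal (a * c0)"
        proof -
          have "(\<integral>\<^sup>+y\<in>- cball x R. ennreal (f y * ?k x y) \<partial>lebesgue)
              \<le> ennreal (C2 * N * R powr (?n * \<theta>) * w.V x R powr (-e))"
            unfolding e(2)[symmetric] using f f0 R N mor by (intro C2(2)) auto
          also have "\<dots> \<le> ennreal (C2 * N * R powr (?n * \<theta>) * (?V0 / w.D) powr (-e))"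
          proof -
            have "?V0 \<le> w.D^1 * w.V x R" using x R by (intro w.V_compare) (auto simp: dist_commute)
            then have "?V0 / w.D \<le> w.V x R" using w.D_ge_1 by (simp add: field_simps)
            then show ?thesis using C2(1) N V0 w.D_ge_1 e by (intro ennreal_leI mult_left_mono powr_mono2') auto
          qed
          also have "C2 * N * R powr (?n * \<theta>) * (?V0 / w.D) powr (-e) = c0"
            using V0 w.D_ge_1 by (simp add: c0_def K'_def powr_divide powr_minus field_simps)
          also have "ennreal c0 \<le> ennreal (a * c0)"
            using a(2) c0 mult_right_mono[of 1 a c0] by (intro ennreal_leI) simp
          finally show ?thesis .
        qed
        have "(\<integral>\<^sup>+y. ennreal (f y * ?k x y) \<partial>lebesgue)
          = (\<integral>\<^sup>+y\<in>cball x R. ennreal (f y * ?k x y) \<partial>lebesgue)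
           + (\<integral>\<^sup>+y\<in>- cball x R. ennreal (f y * ?k x y) \<partial>lebesgue)"
          by (rule nn_integral_split_near_far[OF _ refl]) measurable
        also have "\<dots> \<le> ennreal (a * g0 x) + ennreal (a * c0)" by (intro add_mono near far)
        also have "\<dots> = ennreal (g x)"
          using a g0(2) c0 x by (simp add: g_def ennreal_plus[symmetric] distrib_left del: ennreal_plus)
        finally show "(\<integral>\<^sup>+y. ennreal (f y * ?k x y) \<partial>lebesgue) \<le> ennreal (g x)" .
      qed
    qed
    have c0s: "c0 powr s * W.V x0 R \<le> K' powr s * K * (N powr s * ?V0 powr (\<kappa> * s / p))"
    proof -
      have "c0 powr s * W.V x0 R \<le> c0 powr s * (K * R powr (?n * (1 - q)) * ?V0 powr q)"
        using K(2)[OF R] by (intro mult_left_mono) auto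
      also have "\<dots> = K' powr s * K * N powr s * (R powr (?n * \<theta> * s) * R powr (?n * (1 - q))) * (?V0 powr (-e * s) * ?V0 powr q)"
      proof -
        have "c0 powr s = K' powr s * N powr s * R powr (?n * \<theta> * s) * ?V0 powr (-e * s)"
          using K' N V0 R by (simp add: c0_def powr_mult powr_powr)
        then show ?thesis by (simp add: mult_ac)
      qed
      also have "R powr (?n * \<theta> * s) * R powr (?n * (1 - q)) = R powr (?n * \<theta> * s + ?n * (1 - q))"
        by (rule powr_add[symmetric])
      \<comment> \<open>The power of R in the far bound cancels against the one in the comparison of
        \<nu> with \<mu>^q, since q = 1 + s*\<theta>; a pure power of the \<mu>-measure is
        left.\<close>
      also have "?n * \<theta> * s + ?n * (1 - q) = 0" unfolding q\<theta> by simp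
      also have "?V0 powr (-e * s) * ?V0 powr q = ?V0 powr (-e * s + q)" by (rule powr_add[symmetric])
      also have "-e * s + q = \<kappa> * s / p" using p by (simp add: e_def q_def field_simps)
      finally show ?thesis using R by (simp add: mult_ac)
    qed
    have "(\<integral>\<^sup>+x. ennreal (g x powr s) \<partial>wm (W q)) \<le> ennreal ((2 * a) powr s *
        (C1 * F powr s + K' powr s * K * (N powr s * ?V0 powr (\<kappa> * s / p))))"
      unfolding g_def using g0 c0 a C1(1) s0 W.ball_finite c0s
      by (intro nn_integral_add_const_powr_le) auto
    also have "\<dots> \<le> ennreal (C * N powr s * ?V0 powr (\<kappa> * s / p))"
    proof (rule ennreal_leI)
      have "F powr s = N powr s * w.V x0 (2*R) powr (\<kappa> * s / p)"
        using N by (simp add: F_def powr_mult powr_powr)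
      also have "\<dots> \<le> N powr s * (w.D * ?V0) powr (\<kappa> * s / p)"
        using w.doubling[OF R] \<kappa> s0 p by (intro mult_left_mono powr_mono2) auto
      also have "\<dots> = w.D powr (\<kappa> * s / p) * (N powr s * ?V0 powr (\<kappa> * s / p))"
        using w.D_ge_1 V0 by (simp add: powr_mult)
      finally have "C1 * F powr s \<le> C1 * w.D powr (\<kappa> * s / p) * (N powr s * ?V0 powr (\<kappa> * s / p))"
        using C1(1) by simp
      then have "C1 * F powr s + K' powr s * K * (N powr s * ?V0 powr (\<kappa> * s / p))
          \<le> (C1 * w.D powr (\<kappa> * s / p) + K' powr s * K) * (N powr s * ?V0 powr (\<kappa> * s / p))"
        by (simp add: distrib_right)
      then have "(2 * a) powr s * (C1 * F powr s + K' powr s * K * (N powr s * ?V0 powr (\<kappa> * s / p)))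
          \<le> (2 * a) powr s * ((C1 * w.D powr (\<kappa> * s / p) + K' powr s * K) * (N powr s * ?V0 powr (\<kappa> * s / p)))"
        by (rule mult_left_mono) simp
      then show "(2 * a) powr s * (C1 * F powr s + K' powr s * K * (N powr s * ?V0 powr (\<kappa> * s / p)))
          \<le> C * N powr s * ?V0 powr (\<kappa> * s / p)"
        by (simp add: C_def mult.assoc)
    qed
    finally have "(\<integral>\<^sup>+x. ennreal (g x powr s) \<partial>wm (W q)) \<le> ennreal (C * N powr s * ?V0 powr (\<kappa> * s / p))" .
    then show ?thesis using gm gn pw by blast
  qed
  then show ?thesis using C unfolding q_def by blast
qed

section \<open>Boundedness of the commutator\<close>

context A1_weight begin

lemma Morrey_cube_bound:
  assumes f: "f \<in> Morrey p \<kappa> w w" and le: "morrey_norm p \<kappa> w w f \<le> ereal N" and p: "1 < p" and h: "0 < h"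
  shows "(\<integral>\<^sup>+y\<in>cube a h. ennreal (\<bar>f y\<bar> powr p) \<partial>wm w) \<le> ennreal (N powr p * measure (wm w) (cube a h) powr \<kappa>)"
proof -
  let ?Q = "cube a h"
  let ?I = "\<integral>\<^sup>+y\<in>?Q. ennreal (\<bar>f y\<bar> powr p * w y) \<partial>lebesgue"
  have [measurable]: "f \<in> borel_measurable lebesgue" "?Q \<in> sets lebesgue" using f by (auto simp: Morrey_def)
  have "(let I = ?I in if I = \<infinity> then \<infinity> else ereal ((enn2real I / wmeas w ?Q powr \<kappa>) powr (1/p))) \<le> ereal N"
    using le SUP_upper[OF cube_in_cubes[OF h, of a], of "\<lambda>Q. let I = (\<integral>\<^sup>+ x\<in>Q. ennreal (\<bar>f x\<bar> powr p * w x) \<partial>lebesgue) in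
       if I = \<infinity> then \<infinity> else ereal ((enn2real I / wmeas w Q powr \<kappa>) powr (1 / p))"]
    unfolding morrey_norm_def by (rule order_trans[rotated])
  then have fin: "?I \<noteq> \<infinity>" and le1: "(enn2real ?I / wmeas w ?Q powr \<kappa>) powr (1/p) \<le> N"
    by (auto simp: Let_def split: if_splits)
  have m: "0 < wmeas w ?Q" using measure_cube_pos[OF h, of a] weight by (simp add: measure_wm)
  have "enn2real ?I / wmeas w ?Q powr \<kappa> = ((enn2real ?I / wmeas w ?Q powr \<kappa>) powr (1/p)) powr p"
    using p by (simp add: powr_powr)
  also have "\<dots> \<le> N powr p" using le1 p by (intro powr_mono2) auto
  finally have "enn2real ?I \<le> N powr p * wmeas w ?Q powr \<kappa>" using m by (simp add: field_simps)
  then have "ennreal (enn2real ?I) \<le> ennreal (N powr p * wmeas w ?Q powr \<kappa>)" by (rule ennreal_leI)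
  then have "?I \<le> ennreal (N powr p * wmeas w ?Q powr \<kappa>)"
    using fin by (subst (asm) ennreal_enn2real) (auto simp: less_top)
  moreover have "(\<integral>\<^sup>+y\<in>?Q. ennreal (\<bar>f y\<bar> powr p) \<partial>wm w) = ?I"
  proof -
    have "(\<integral>\<^sup>+y\<in>?Q. ennreal (\<bar>f y\<bar> powr p) \<partial>wm w)
        = (\<integral>\<^sup>+y. ennreal (w y) * (ennreal (\<bar>f y\<bar> powr p) * indicator ?Q y) \<partial>lebesgue)"
      by (rule nn_integral_wm[OF weight]) measurable
    also have "\<dots> = ?I"
    proof (rule nn_integral_cong_AE)
      show "AE y in lebesgue. ennreal (w y) * (ennreal (\<bar>f y\<bar> powr p) * indicator ?Q y)
          = ennreal (\<bar>f y\<bar> powr p * w y) * indicator ?Q y"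
        using all_balls by eventually_elim (auto simp: ennreal_mult mult_ac)
    qed
    finally show ?thesis .
  qed
  ultimately show ?thesis using weight by (simp add: measure_wm)
qed

text \<open>Enclosing a ball in a cube and the cube in a larger ball costs D^n inside the power
  \<kappa>. Moving this factor into N restores the shape of the hypothesis of the local
  bounds.\<close>

lemma Morrey_ball_bound:
  assumes f: "f \<in> Morrey p \<kappa> w w" and le: "morrey_norm p \<kappa> w w f \<le> ereal N" and p: "1 < p" and \<kappa>: "0 \<le> \<kappa>"
    and N: "0 < N" and r: "0 < r"
  shows "(\<integral>\<^sup>+y\<in>cball z r. ennreal (\<bar>f y\<bar> powr p) \<partial>wm w)
     \<le> ennreal (((D ^ CARD('n)) powr (\<kappa>/p) * N) powr p * V z r powr \<kappa>)"
proof -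
  let ?Q = "cube (z - r *\<^sub>R One) (2 * r)"
  have "(\<integral>\<^sup>+y\<in>cball z r. ennreal (\<bar>f y\<bar> powr p) \<partial>wm w) \<le> (\<integral>\<^sup>+y\<in>?Q. ennreal (\<bar>f y\<bar> powr p) \<partial>wm w)"
    using cball_subset_centered_cube[of z r] by (intro nn_integral_mono) (auto simp: indicator_def)
  also have "\<dots> \<le> ennreal (N powr p * measure (wm w) ?Q powr \<kappa>)"
    using r by (intro Morrey_cube_bound f le p) auto
  also have "\<dots> \<le> ennreal (N powr p * (D ^ CARD('n) * V z r) powr \<kappa>)"
  proof -
    have "measure (wm w) ?Q \<le> V z (real CARD('n) * r)"
      using r by (intro measure_le_V centered_cube_subset_cball) auto
    also have "\<dots> \<le> D ^ CARD('n) * V z r" by (rule V_card[OF r])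
    finally show ?thesis using \<kappa> by (intro ennreal_leI mult_left_mono powr_mono2) auto
  qed
  also have "N powr p * (D ^ CARD('n) * V z r) powr \<kappa> = ((D ^ CARD('n)) powr (\<kappa>/p) * N) powr p * V z r powr \<kappa>"
    using N p D_ge_1 by (simp add: powr_mult powr_powr)
  finally show ?thesis .
qed

text \<open>The return from balls to cubes. From the centre of the cube, whose inscribed ball has
  radius h/2, the far ball reaches at most n*h/2 + n*h <= 2^(n+1)*h = 2^(n+2) * (h/2), whence n + 2
  doublings.\<close>

lemma cube_comparable_ball:
  assumes h: "0 < h"
  shows "V a (real CARD('n) * h) \<le> D ^ (CARD('n) + 2) * measure (wm w) (cube a h)"
proof -
  let ?c = "a + (h/2) *\<^sub>R One"
  have "V a (real CARD('n) * h) \<le> D ^ (CARD('n) + 2) * V ?c (h/2)"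
  proof (rule V_compare)
    have "dist ?c a \<le> real CARD('n) * (h/2)"
      using h by (intro dist_le_coordinates) (auto simp: inner_add_left)
    moreover have "real CARD('n) * h \<le> 2 ^ CARD('n) * h"
      using h of_nat_less_two_power[of "CARD('n)", where 'a=real] by (intro mult_right_mono) auto
    moreover have "2 ^ (CARD('n) + 2) * (h/2) = 2 * (2 ^ CARD('n) * h)" by (simp add: power_add)
    ultimately show "dist ?c a + real CARD('n) * h \<le> 2 ^ (CARD('n) + 2) * (h/2)"
      using h mult_nonneg_nonneg[of "real CARD('n)" h] by linarith
  qed (use h in simp)
  also have "\<dots> \<le> D ^ (CARD('n) + 2) * measure (wm w) (cube a h)"
  proof (rule mult_left_mono)
    have "cball ?c (h/2) \<subseteq> cube a h" by (rule cball_subset_cube) (auto simp: inner_add_left)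
    then show "V ?c (h/2) \<le> measure (wm w) (cube a h)"
      using weight by (intro measure_mono_fmeasurable) (auto simp: fmeasurable_def emeasure_wm)
  qed (use D_ge_1 in simp)
  finally show ?thesis .
qed

text \<open>The factor |x-y|^\<beta> from \<open>Lip_pointwise\<close> raises the order of the
  kernel from \<alpha> to \<alpha> + \<beta> = n*\<theta>. The sum w(x) + w(y) separates into w(x)
  times a Lebesgue integral and an integral against w dy.\<close>

lemma commutator_pointwise:
  fixes \<alpha> \<beta> \<theta> c :: real
  assumes \<beta>: "0 < \<beta>" and c: "0 < c" and \<theta>: "real CARD('n) * \<theta> = \<alpha> + \<beta>" and b: "b \<in> Lip \<beta> w"
  shows "\<exists>C>0. \<forall>f. f \<in> borel_measurable lebesgue \<longrightarrow> (AE x in lebesgue. ennreal \<bar>commutator c \<alpha> b f x\<bar> \<le>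
     ennreal (C * lip_norm \<beta> w b * w x powr (\<beta> / real CARD('n))) *
      (ennreal (w x) * (\<integral>\<^sup>+y. ennreal (\<bar>f y\<bar> * dist x y powr (real CARD('n) * (\<theta>-1))) \<partial>lebesgue)
        + (\<integral>\<^sup>+y. ennreal (\<bar>f y\<bar> * dist x y powr (real CARD('n) * (\<theta>-1))) \<partial>wm w)))"
proof -
  let ?n = "real CARD('n)" and ?L = "lip_norm \<beta> w b"
  have L: "0 \<le> ?L" by (rule lip_norm_nonneg[OF b])
  obtain C0 where C0: "C0 > 0" and "\<exists>G. (AE z in lebesgue. z \<in> G) \<and> (\<forall>x\<in>G. \<forall>y\<in>G.
     \<bar>b x - b y\<bar> \<le> C0 * ?L * dist x y powr \<beta> * w x powr (\<beta> / ?n) * (w x + w y))"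
    using Lip_pointwise[OF \<beta>] b by blast
  then obtain G where G: "AE z in lebesgue. z \<in> G" "\<And>x y. x \<in> G \<Longrightarrow> y \<in> G \<Longrightarrow>
     \<bar>b x - b y\<bar> \<le> C0 * ?L * dist x y powr \<beta> * w x powr (\<beta> / ?n) * (w x + w y)"
    by blast
  have [measurable]: "b \<in> borel_measurable lebesgue" using b by (simp add: Lip_def loc_integrable_def)
  have [measurable]: "w \<in> borel_measurable lebesgue" by (rule weight_measurable[OF weight])
  have "AE x in lebesgue. ennreal \<bar>commutator c \<alpha> b f x\<bar> \<le>
     ennreal (c * C0 * ?L * w x powr (\<beta> / ?n)) *
      (ennreal (w x) * (\<integral>\<^sup>+y. ennreal (\<bar>f y\<bar> * dist x y powr (?n * (\<theta>-1))) \<partial>lebesgue)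
        + (\<integral>\<^sup>+y. ennreal (\<bar>f y\<bar> * dist x y powr (?n * (\<theta>-1))) \<partial>wm w))"
    if f [measurable]: "f \<in> borel_measurable lebesgue" for f
    using G(1) all_balls
  proof eventually_elim
    case (elim x)
    let ?k = "\<lambda>y. \<bar>f y\<bar> * dist x y powr (?n * (\<theta>-1))"
    define t where "t = C0 * ?L * w x powr (\<beta> / ?n)"
    have t: "0 \<le> t" using C0 L by (simp add: t_def)
    have x: "x \<in> G" "0 < w x" using elim by auto
    have "(\<integral>\<^sup>+y. ennreal (\<bar>b x - b y\<bar> * \<bar>f y\<bar> / dist x y powr (?n - \<alpha>)) \<partial>lebesgue)
       \<le> (\<integral>\<^sup>+y. ennreal t * (ennreal (w x) * ennreal (?k y) + ennreal (w y) * ennreal (?k y)) \<partial>lebesgue)"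
    proof (rule nn_integral_mono_AE)
      show "AE y in lebesgue. ennreal (\<bar>b x - b y\<bar> * \<bar>f y\<bar> / dist x y powr (?n - \<alpha>))
         \<le> ennreal t * (ennreal (w x) * ennreal (?k y) + ennreal (w y) * ennreal (?k y))"
        using G(1) all_balls
      proof eventually_elim
        case (elim y)
        have y: "0 < w y" using elim by simp
        show ?case
        proof (cases "x = y")
          case False
          then have d: "0 < dist x y" by simp
          have "\<bar>b x - b y\<bar> * \<bar>f y\<bar> / dist x y powr (?n - \<alpha>)
             \<le> (C0 * ?L * dist x y powr \<beta> * w x powr (\<beta> / ?n) * (w x + w y)) * \<bar>f y\<bar> / dist x y powr (?n - \<alpha>)"
            using G(2)[OF x(1) elim(1)] by (intro divide_right_mono mult_right_mono) auto
          also have "\<dots> = t * (w x + w y) * \<bar>f y\<bar> * (dist x y powr \<beta> / dist x y powr (?n - \<alpha>))"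
            by (simp add: t_def)
          also have "dist x y powr \<beta> / dist x y powr (?n - \<alpha>) = dist x y powr (\<beta> - (?n - \<alpha>))"
            by (rule powr_diff[symmetric])
          also have "\<beta> - (?n - \<alpha>) = ?n * (\<theta>-1)" using \<theta> by (simp add: algebra_simps)
          finally have "\<bar>b x - b y\<bar> * \<bar>f y\<bar> / dist x y powr (?n - \<alpha>) \<le> t * (w x * ?k y + w y * ?k y)"
            by (simp add: algebra_simps)
          then have "ennreal (\<bar>b x - b y\<bar> * \<bar>f y\<bar> / dist x y powr (?n - \<alpha>)) \<le> ennreal (t * (w x * ?k y + w y * ?k y))"
            by (rule ennreal_leI)
          also have "\<dots> = ennreal t * (ennreal (w x) * ennreal (?k y) + ennreal (w y) * ennreal (?k y))"
          proof -
            have k0: "0 \<le> ?k y" by simp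
            show ?thesis using t x(2) y k0
              by (simp only: ennreal_mult ennreal_plus mult_nonneg_nonneg add_nonneg_nonneg less_imp_le)
          qed
          finally show ?thesis .
        qed simp
      qed
    qed
    also have "\<dots> = ennreal t * ((\<integral>\<^sup>+y. ennreal (w x) * ennreal (?k y) \<partial>lebesgue) + (\<integral>\<^sup>+y. ennreal (w y) * ennreal (?k y) \<partial>lebesgue))"
      by (subst nn_integral_cmult, measurable, subst nn_integral_add, measurable) 
    also have "(\<integral>\<^sup>+y. ennreal (w x) * ennreal (?k y) \<partial>lebesgue) = ennreal (w x) * (\<integral>\<^sup>+y. ennreal (?k y) \<partial>lebesgue)"
      by (rule nn_integral_cmult) measurable
    also have "(\<integral>\<^sup>+y. ennreal (w y) * ennreal (?k y) \<partial>lebesgue) = (\<integral>\<^sup>+y. ennreal (?k y) \<partial>wm w)"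
      by (rule nn_integral_wm[OF weight, symmetric]) measurable
    finally have "ennreal c * (\<integral>\<^sup>+y. ennreal (\<bar>b x - b y\<bar> * \<bar>f y\<bar> / dist x y powr (?n - \<alpha>)) \<partial>lebesgue)
      \<le> ennreal c * (ennreal t * (ennreal (w x) * (\<integral>\<^sup>+y. ennreal (?k y) \<partial>lebesgue) + (\<integral>\<^sup>+y. ennreal (?k y) \<partial>wm w)))"
      by (rule mult_left_mono) simp
    also have "\<dots> = ennreal (c * t) * (ennreal (w x) * (\<integral>\<^sup>+y. ennreal (?k y) \<partial>lebesgue) + (\<integral>\<^sup>+y. ennreal (?k y) \<partial>wm w))"
      using c t by (simp only: ennreal_mult less_imp_le mult.assoc)
    finally have "ennreal \<bar>commutator c \<alpha> b f x\<bar> \<le> ennreal (c * t) *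
       (ennreal (w x) * (\<integral>\<^sup>+y. ennreal (?k y) \<partial>lebesgue) + (\<integral>\<^sup>+y. ennreal (?k y) \<partial>wm w))"
      using commutator_le[of f b c \<alpha> x] c by (meson order_trans f \<open>b \<in> borel_measurable lebesgue\<close>)
    then show ?case by (simp only: t_def mult.assoc)
  qed
  moreover have "c * C0 > 0" using c C0 by simp
  ultimately show ?thesis by blast
qed

end

text \<open>The estimates for Morrey functions ask for a positive bound N of the norm, and the norm
  may vanish; so N is let decrease to it.\<close>

lemma ereal_le_cmult_if_le_all_above:
  fixes x :: ereal
  assumes "\<And>N. 0 < N \<Longrightarrow> ereal m \<le> ereal N \<Longrightarrow> x \<le> ereal (c * N)" "0 \<le> c" "0 \<le> m"
  shows "x \<le> ereal c * ereal m"
proof (rule ereal_le_epsilon2)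
  fix e :: real assume e: "0 < e"
  define N where "N = m + e / (c + 1)"
  have N: "0 < N" "m \<le> N" using e assms(2,3) by (auto simp: N_def add_nonneg_pos)
  have "c * N \<le> c * m + e" using e assms(2) by (simp add: N_def field_simps)
  then have "ereal (c * N) \<le> ereal c * ereal m + ereal e" by simp
  then show "x \<le> ereal c * ereal m + ereal e" using assms(1)[of N] N by (meson ereal_less_eq(3) order_trans)
qed

theorem theorem3:
  fixes w b :: "real^'n \<Rightarrow> real" and \<alpha> \<beta> p s \<kappa> c :: real
  defines "n \<equiv> real CARD('n)"
  assumes "0 < \<beta>" "\<beta> < 1" "0 < \<alpha>" "\<alpha> < n" "\<alpha> + \<beta> < n"
    and "1 < p" "p < n / (\<alpha> + \<beta>)"
    and "1 / s = 1 / p - (\<alpha> + \<beta>) / n"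
    and "0 < \<kappa>" "\<kappa> < p / s"
    and "weight w"
    and "A1 (\<lambda>x. w x powr (s / p))"
    and "r_w w > ereal (1 / (p / s - \<kappa>))"
    and "c > 0"
    and "b \<in> Lip \<beta> w"
  shows "\<exists>C. \<forall>f \<in> Morrey p \<kappa> w w.
     morrey_norm s (\<kappa> * s / p) (\<lambda>x. w x powr (1 - (1 - \<alpha> / n) * s)) w (commutator c \<alpha> b f)
       \<le> ereal (C * lip_norm \<beta> w b) * morrey_norm p \<kappa> w w f"
proof -
  note \<beta> = assms(2,3) and \<alpha> = assms(4-6) and p = assms(7) and s = assms(9) and \<kappa> = assms(10,11)
    and weight = assms(12) and c = assms(15) and b = assms(16)
  have n: "0 < n" by (simp add: n_def)
  define \<theta> where "\<theta> = (\<alpha> + \<beta>) / n"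
  have n\<theta>: "n * \<theta> = \<alpha> + \<beta>" using n by (simp add: \<theta>_def)
  have \<theta>: "0 < \<theta>" "\<theta> < 1/p" using \<alpha> \<beta> n p assms(8) by (auto simp: \<theta>_def field_simps)
  have s\<theta>: "1/s = 1/p - \<theta>" using s by (simp add: \<theta>_def)
  have s0: "0 < s" using s\<theta> \<theta> by (metis diff_gt_0_iff_gt zero_less_divide_1_iff)
  define q where "q = s/p"
  have "1/s < 1/p" using s\<theta> \<theta> by linarith
  then have q1: "1 < q" using s0 p by (simp add: q_def field_simps)
  have q: "q = 1 + s * \<theta>"
  proof -
    have "q = s * (1/p)" by (simp add: q_def)
    also have "1/p = 1/s + \<theta>" using s\<theta> by simp
    finally show ?thesis using s0 by (simp add: distrib_left)
  qed
  obtain B where B: "A1_weight (\<lambda>x. w x powr (s/p)) B" using A1_weight_exists[OF assms(13)] by blast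
  obtain A where A: "A1_weight w A"
    using A1_weight_exists[OF A1_of_A1_powr[OF weight q1]] assms(13) unfolding q_def by blast
  interpret w: A1_weight w A by (rule A)
  interpret W: A1_weight "\<lambda>x. w x powr (s/p)" B by (rule B)
  \<comment> \<open>The strict inequality for the supremum \<open>r_w\<close> provides an actual
    member of the reverse Hoelder range above the threshold.\<close>
  obtain r where r: "1 < r" "RH r w" "1 / (p/s - \<kappa>) < r"
    using assms(14) unfolding r_w_def less_SUP_iff by auto
  have r': "1/r < p/s - \<kappa>" using r \<kappa> by (simp add: field_simps)
  let ?L = "lip_norm \<beta> w b"
  have L: "0 \<le> ?L" by (rule w.lip_norm_nonneg[OF b])
  have \<kappa>0: "0 \<le> \<kappa>" using \<kappa> by simp
  let ?k = "\<lambda>x y. dist x y powr (n * (\<theta>-1))"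
  let ?W = "\<lambda>x. w x powr (s/p)"
  obtain C0 where C0: "C0 > 0" "\<And>f. f \<in> borel_measurable lebesgue \<Longrightarrow> AE x in lebesgue. ennreal \<bar>commutator c \<alpha> b f x\<bar> \<le>
     ennreal (C0 * ?L * w x powr (\<beta> / n)) * (ennreal (w x) * (\<integral>\<^sup>+y. ennreal (\<bar>f y\<bar> * ?k x y) \<partial>lebesgue)
        + (\<integral>\<^sup>+y. ennreal (\<bar>f y\<bar> * ?k x y) \<partial>wm w))"
    using w.commutator_pointwise[OF \<beta>(1) c n\<theta>[unfolded n_def] b] unfolding n_def by blast
  obtain C1 where C1: "C1 > 0" "\<And>f N x0 R. f \<in> borel_measurable lebesgue \<Longrightarrow> (\<And>y. 0 \<le> f y) \<Longrightarrow> 0 < N \<Longrightarrow> 0 < R \<Longrightarrow>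
     (\<And>z r. 0 < r \<Longrightarrow> (\<integral>\<^sup>+y\<in>cball z r. ennreal (f y powr p) \<partial>wm w) \<le> ennreal (N powr p * w.V z r powr \<kappa>)) \<Longrightarrow>
     (\<exists>g. g \<in> borel_measurable lebesgue \<and> (\<forall>x. 0 \<le> g x) \<and>
       (AE x in lebesgue. x \<in> cball x0 R \<longrightarrow> (\<integral>\<^sup>+y. ennreal (f y * ?k x y) \<partial>lebesgue) \<le> ennreal (g x)) \<and>
       (\<integral>\<^sup>+x. ennreal (g x powr s) \<partial>wm ?W) \<le> ennreal (C1 * N powr s * w.V x0 R powr (\<kappa> * s / p)))"
    using unweighted_Morrey_local_bound[OF A B p \<theta> s\<theta> \<kappa>0 \<kappa>(2) r(1,2) r'] unfolding n_def by blast
  obtain C2 where C2: "C2 > 0" "\<And>f N x0 R. f \<in> borel_measurable lebesgue \<Longrightarrow> (\<And>y. 0 \<le> f y) \<Longrightarrow> 0 < N \<Longrightarrow> 0 < R \<Longrightarrow>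
     (\<And>z r. 0 < r \<Longrightarrow> (\<integral>\<^sup>+y\<in>cball z r. ennreal (f y powr p) \<partial>wm w) \<le> ennreal (N powr p * w.V z r powr \<kappa>)) \<Longrightarrow>
     (\<exists>g. g \<in> borel_measurable lebesgue \<and> (\<forall>x. 0 \<le> g x) \<and>
       (AE x in lebesgue. x \<in> cball x0 R \<longrightarrow>
          (\<integral>\<^sup>+y. ennreal (f y * ?k x y) \<partial>wm w) \<le> ennreal (w x powr (1-\<theta>) * g x)) \<and>
       (\<integral>\<^sup>+x. ennreal (g x powr s) \<partial>wm w) \<le> ennreal (C2 * N powr s * w.V x0 R powr (\<kappa> * s / p)))"
    using w.Morrey_local_bound[OF p \<theta> s\<theta> \<kappa>0 \<kappa>(2)] unfolding n_def by blast
  define D1 where "D1 = (w.D ^ CARD('n)) powr (\<kappa>/p)"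
  have D1: "D1 > 0" using w.D_ge_1 by (simp add: D1_def)
  define D2 where "D2 = (w.D ^ (CARD('n) + 2)) powr (\<kappa> * s / p)"
  have D2: "D2 > 0" using w.D_ge_1 by (simp add: D2_def)
  \<comment> \<open>\<open>D1\<close> is the price of replacing cubes by balls in the norm of f,
    \<open>D2\<close> of returning to cubes in the output, and 2 is from
    \<open>powr_add_le\<close>.\<close>
  define C where "C = 2 * C0 * ((C1 + C2) * D2) powr (1/s) * D1"
  have C: "C > 0" unfolding C_def using C0(1) C1(1) C2(1) D1 D2 by (intro mult_pos_pos) auto
  define E where "E = 1 - (1 - \<alpha> / n) * s"
  have cube_bound: "(\<integral>\<^sup>+x\<in>cube a h. ennreal (\<bar>commutator c \<alpha> b f x\<bar> powr s * w x powr E) \<partial>lebesgue)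
      \<le> ennreal ((C * ?L * N) powr s * measure (wm w) (cube a h) powr (\<kappa> * s / p))"
    if f: "f \<in> Morrey p \<kappa> w w" and N: "0 < N" and le: "morrey_norm p \<kappa> w w f \<le> ereal N" and h: "0 < h" for f N a h
  proof -
    have fm [measurable]: "f \<in> borel_measurable lebesgue" using f by (simp add: Morrey_def)
    have afm: "(\<lambda>y. \<bar>f y\<bar>) \<in> borel_measurable lebesgue" by measurable
    have [measurable]: "w \<in> borel_measurable lebesgue" by (rule weight_measurable[OF weight])
    \<comment> \<open>A ball about the lower corner a, not the centre, encloses the cube.\<close>
    define R where "R = n * h"
    have R: "0 < R" using n h by (simp add: R_def)
    have N': "0 < D1 * N" using D1 N by simp
    have QR: "cube a h \<subseteq> cball a R" unfolding R_def n_def using h by (intro cube_subset_cball) auto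
    have mor: "(\<integral>\<^sup>+y\<in>cball z r. ennreal (\<bar>f y\<bar> powr p) \<partial>wm w) \<le> ennreal ((D1 * N) powr p * w.V z r powr \<kappa>)"
      if "0 < r" for z r
      unfolding D1_def by (rule w.Morrey_ball_bound[OF f le p \<kappa>0 N that])
    obtain g1 where g1: "g1 \<in> borel_measurable lebesgue" "\<And>x. 0 \<le> g1 x"
       "AE x in lebesgue. x \<in> cball a R \<longrightarrow> (\<integral>\<^sup>+y. ennreal (\<bar>f y\<bar> * ?k x y) \<partial>lebesgue) \<le> ennreal (g1 x)"
       "(\<integral>\<^sup>+x. ennreal (g1 x powr s) \<partial>wm ?W) \<le> ennreal (C1 * (D1 * N) powr s * w.V a R powr (\<kappa> * s / p))"
      using C1(2)[OF afm abs_ge_zero N' R mor] by blast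
    obtain g2 where g2: "g2 \<in> borel_measurable lebesgue" "\<And>x. 0 \<le> g2 x"
       "AE x in lebesgue. x \<in> cball a R \<longrightarrow> (\<integral>\<^sup>+y. ennreal (\<bar>f y\<bar> * ?k x y) \<partial>wm w) \<le> ennreal (w x powr (1-\<theta>) * g2 x)"
       "(\<integral>\<^sup>+x. ennreal (g2 x powr s) \<partial>wm w) \<le> ennreal (C2 * (D1 * N) powr s * w.V a R powr (\<kappa> * s / p))"
      using C2(2)[OF afm abs_ge_zero N' R mor] by blast
    note [measurable] = g1(1) g2(1)
    define T where "T = C0 * ?L"
    have T: "0 \<le> T" using C0(1) L by (simp add: T_def)
    have pw: "AE x in lebesgue. ennreal (\<bar>commutator c \<alpha> b f x\<bar> powr s * w x powr E) * indicator (cube a h) x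
       \<le> ennreal ((2 * T) powr s) * (ennreal (w x powr (s/p)) * ennreal (g1 x powr s) + ennreal (w x) * ennreal (g2 x powr s))"
      using C0(2)[OF fm] g1(3) g2(3) w.all_balls
    proof eventually_elim
      case (elim x)
      show ?case
      proof (cases "x \<in> cube a h")
        case True
        then have xR: "x \<in> cball a R" using QR by blast
        have wx: "0 < w x" using elim by simp
        let ?\<beta> = "\<beta> / n"
        have "ennreal \<bar>commutator c \<alpha> b f x\<bar> \<le> ennreal (T * w x powr ?\<beta>) *
            (ennreal (w x) * ennreal (g1 x) + ennreal (w x powr (1-\<theta>) * g2 x))"
        proof -
          have "ennreal (w x) * (\<integral>\<^sup>+y. ennreal (\<bar>f y\<bar> * ?k x y) \<partial>lebesgue) \<le> ennreal (w x) * ennreal (g1 x)"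
            using elim xR by (intro mult_left_mono) auto
          moreover have "(\<integral>\<^sup>+y. ennreal (\<bar>f y\<bar> * ?k x y) \<partial>wm w) \<le> ennreal (w x powr (1-\<theta>) * g2 x)"
            using elim xR by auto
          ultimately show ?thesis unfolding T_def
            by (intro order_trans[OF elim(1) mult_left_mono[OF add_mono]]) auto
        qed
        also have "\<dots> = ennreal (T * w x powr ?\<beta> * (w x * g1 x + w x powr (1-\<theta>) * g2 x))"
          using T wx g1(2) g2(2) by (simp add: ennreal_mult ennreal_plus)
        finally have "\<bar>commutator c \<alpha> b f x\<bar> \<le> T * w x powr ?\<beta> * (w x * g1 x + w x powr (1-\<theta>) * g2 x)"
          using T wx g1(2) g2(2) by (subst (asm) ennreal_le_iff) auto
        also have "\<dots> = T * (w x powr (?\<beta> + 1) * g1 x + w x powr (?\<beta> + (1-\<theta>)) * g2 x)"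
          using wx by (simp only: powr_add powr_one less_imp_le) (simp add: algebra_simps)
        finally have "\<bar>commutator c \<alpha> b f x\<bar> powr s \<le> (T * (w x powr (?\<beta> + 1) * g1 x + w x powr (?\<beta> + (1-\<theta>)) * g2 x)) powr s"
          using s0 by (intro powr_mono2) auto
        also have "\<dots> = T powr s * (w x powr (?\<beta> + 1) * g1 x + w x powr (?\<beta> + (1-\<theta>)) * g2 x) powr s"
          using T g1(2) g2(2) by (simp add: powr_mult)
        also have "\<dots> \<le> T powr s * (2 powr s * ((w x powr (?\<beta> + 1) * g1 x) powr s + (w x powr (?\<beta> + (1-\<theta>)) * g2 x) powr s))"
          using g1(2) g2(2) s0 by (intro mult_left_mono powr_add_le) auto
        also have "\<dots> = (2 * T) powr s * (w x powr ((?\<beta> + 1) * s) * g1 x powr s + w x powr ((?\<beta> + (1-\<theta>)) * s) * g2 x powr s)"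
          using T g1(2) g2(2) by (simp add: powr_mult powr_powr)
        finally have "\<bar>commutator c \<alpha> b f x\<bar> powr s * w x powr E \<le> (2 * T) powr s *
            (w x powr ((?\<beta> + 1) * s) * g1 x powr s + w x powr ((?\<beta> + (1-\<theta>)) * s) * g2 x powr s) * w x powr E"
          by (rule mult_right_mono) simp
        also have "\<dots> = (2 * T) powr s * (w x powr ((?\<beta> + 1) * s + E) * g1 x powr s
            + w x powr ((?\<beta> + (1-\<theta>)) * s + E) * g2 x powr s)"
        proof -
          have distrib: "X * (u * y + v * z) * t = X * (u * t * y + v * t * z)" for X u v t y z :: real
            by (simp add: algebra_simps)
          show ?thesis unfolding powr_add by (rule distrib)
        qed
        \<comment> \<open>The output exponent E makes the two terms meet their measures: here 1 +
          s*\<theta> = s/p, the density of \<nu>, and in the other term exponent 1, the density of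
          \<mu>.\<close>
        also have "(?\<beta> + 1) * s + E = s/p"
        proof -
          have "(?\<beta> + 1) * s + E = 1 + s * \<theta>" using n by (simp add: E_def \<theta>_def field_simps)
          then show ?thesis using q by (simp add: q_def)
        qed
        also have "(?\<beta> + (1-\<theta>)) * s + E = 1" using n by (simp add: E_def \<theta>_def field_simps)
        finally have "ennreal (\<bar>commutator c \<alpha> b f x\<bar> powr s * w x powr E)
            \<le> ennreal ((2 * T) powr s * (w x powr (s/p) * g1 x powr s + w x * g2 x powr s))"
          using wx by (intro ennreal_leI) simp
        then show ?thesis using True wx by (simp add: ennreal_mult ennreal_plus)
      qed simp
    qed
    have "(\<integral>\<^sup>+x\<in>cube a h. ennreal (\<bar>commutator c \<alpha> b f x\<bar> powr s * w x powr E) \<partial>lebesgue)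
      \<le> (\<integral>\<^sup>+x. ennreal ((2 * T) powr s) * (ennreal (w x powr (s/p)) * ennreal (g1 x powr s)
            + ennreal (w x) * ennreal (g2 x powr s)) \<partial>lebesgue)"
      by (rule nn_integral_mono_AE[OF pw])
    also have "\<dots> = ennreal ((2 * T) powr s) * ((\<integral>\<^sup>+x. ennreal (w x powr (s/p)) * ennreal (g1 x powr s) \<partial>lebesgue)
            + (\<integral>\<^sup>+x. ennreal (w x) * ennreal (g2 x powr s) \<partial>lebesgue))"
      by (subst nn_integral_cmult, measurable, subst nn_integral_add, measurable)
    also have "(\<integral>\<^sup>+x. ennreal (w x powr (s/p)) * ennreal (g1 x powr s) \<partial>lebesgue) = (\<integral>\<^sup>+x. ennreal (g1 x powr s) \<partial>wm ?W)"
      by (rule nn_integral_wm[OF W.weight, symmetric]) measurable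
    also have "(\<integral>\<^sup>+x. ennreal (w x) * ennreal (g2 x powr s) \<partial>lebesgue) = (\<integral>\<^sup>+x. ennreal (g2 x powr s) \<partial>wm w)"
      by (rule nn_integral_wm[OF weight, symmetric]) measurable
    also have "ennreal ((2 * T) powr s) * ((\<integral>\<^sup>+x. ennreal (g1 x powr s) \<partial>wm ?W) + (\<integral>\<^sup>+x. ennreal (g2 x powr s) \<partial>wm w))
      \<le> ennreal ((2 * T) powr s) * (ennreal (C1 * (D1 * N) powr s * w.V a R powr (\<kappa> * s / p))
           + ennreal (C2 * (D1 * N) powr s * w.V a R powr (\<kappa> * s / p)))"
      by (intro mult_left_mono add_mono g1(4) g2(4)) simp
    also have "\<dots> = ennreal ((2 * T) powr s * ((C1 + C2) * (D1 * N) powr s * w.V a R powr (\<kappa> * s / p)))"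
      using C1(1) C2(1) by (simp add: ennreal_mult[symmetric] ennreal_plus[symmetric] distrib_right del: ennreal_plus)
    also have "\<dots> \<le> ennreal ((C * ?L * N) powr s * measure (wm w) (cube a h) powr (\<kappa> * s / p))"
    proof (rule ennreal_leI)
      let ?m = "measure (wm w) (cube a h)"
      have "w.V a R powr (\<kappa> * s / p) \<le> (w.D ^ (CARD('n) + 2) * ?m) powr (\<kappa> * s / p)"
        unfolding R_def n_def using w.cube_comparable_ball[OF h, of a] \<kappa> s0 p by (intro powr_mono2) auto
      also have "\<dots> = D2 * ?m powr (\<kappa> * s / p)" using w.D_ge_1 by (simp only: powr_mult D2_def)
      finally have "(2 * T) powr s * ((C1 + C2) * (D1 * N) powr s * w.V a R powr (\<kappa> * s / p))
         \<le> (2 * T) powr s * ((C1 + C2) * (D1 * N) powr s * (D2 * ?m powr (\<kappa> * s / p)))"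
        using C1(1) C2(1) by (intro mult_left_mono) auto
      also have "\<dots> = (C * ?L * N) powr s * ?m powr (\<kappa> * s / p)"
      proof -
        have "(C * ?L * N) powr s = ((2 * T) * ((C1 + C2) * D2) powr (1/s) * (D1 * N)) powr s"
          by (simp add: C_def T_def mult_ac)
        also have "\<dots> = (2 * T) powr s * (((C1 + C2) * D2) powr (1/s)) powr s * (D1 * N) powr s"
          by (simp only: powr_mult)
        also have "(((C1 + C2) * D2) powr (1/s)) powr s = (C1 + C2) * D2"
          using C1(1) C2(1) D2 s0 by (simp add: powr_powr)
        finally show ?thesis by (simp add: mult_ac)
      qed
      finally show "(2 * T) powr s * ((C1 + C2) * (D1 * N) powr s * w.V a R powr (\<kappa> * s / p))
          \<le> (C * ?L * N) powr s * ?m powr (\<kappa> * s / p)" .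
    qed
    finally show ?thesis .
  qed
  have norm_bound: "morrey_norm s (\<kappa> * s / p) (\<lambda>x. w x powr E) w (commutator c \<alpha> b f) \<le> ereal (C * ?L * N)"
    if f: "f \<in> Morrey p \<kappa> w w" and N: "0 < N" and le: "morrey_norm p \<kappa> w w f \<le> ereal N" for f N
    unfolding morrey_norm_def
  proof (rule SUP_least)
    fix Q :: "(real^'n) set" assume "Q \<in> cubes"
    then obtain a h where h: "0 < h" and Q: "Q = cube a h" unfolding cubes_def by blast
    define I where "I = (\<integral>\<^sup>+x\<in>Q. ennreal (\<bar>commutator c \<alpha> b f x\<bar> powr s * w x powr E) \<partial>lebesgue)"
    have m: "0 < wmeas w Q" using w.measure_cube_pos[OF h, of a] weight by (simp add: Q measure_wm)
    have Ile: "I \<le> ennreal ((C * ?L * N) powr s * wmeas w Q powr (\<kappa> * s / p))"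
      unfolding I_def Q using cube_bound[OF f N le h, of a] weight by (simp add: measure_wm)
    \<comment> \<open>Excludes the infinite branch of \<open>morrey_norm\<close>, so that
      \<open>enn2real\<close> is faithful.\<close>
    have fin: "I \<noteq> \<infinity>" using Ile by (auto simp: top_unique)
    have "enn2real I \<le> (C * ?L * N) powr s * wmeas w Q powr (\<kappa> * s / p)"
      using Ile by (intro enn2real_leI) auto
    then have "enn2real I / wmeas w Q powr (\<kappa> * s / p) \<le> (C * ?L * N) powr s"
      using m by (simp add: field_simps)
    then have "(enn2real I / wmeas w Q powr (\<kappa> * s / p)) powr (1/s) \<le> ((C * ?L * N) powr s) powr (1/s)"
      using s0 by (intro powr_mono2) auto
    also have "\<dots> = C * ?L * N" using C L N s0 by (simp add: powr_powr)
    finally show "(let I = (\<integral>\<^sup>+x\<in>Q. ennreal (\<bar>commutator c \<alpha> b f x\<bar> powr s * w x powr E) \<partial>lebesgue)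
        in if I = \<infinity> then \<infinity> else ereal ((enn2real I / wmeas w Q powr (\<kappa> * s / p)) powr (1 / s))) \<le> ereal (C * ?L * N)"
      unfolding I_def[symmetric] using fin by (simp add: Let_def)
  qed
  have "morrey_norm s (\<kappa> * s / p) (\<lambda>x. w x powr E) w (commutator c \<alpha> b f) \<le> ereal (C * ?L) * morrey_norm p \<kappa> w w f"
    if f: "f \<in> Morrey p \<kappa> w w" for f
  proof -
    have "0 \<le> morrey_norm p \<kappa> w w f"
      unfolding morrey_norm_def using cube_in_cubes[of 1 0] by (intro SUP_upper2) (auto simp: Let_def)
    moreover have "morrey_norm p \<kappa> w w f < \<infinity>" using f by (simp add: Morrey_def)
    ultimately obtain m where m: "morrey_norm p \<kappa> w w f = ereal m" "0 \<le> m"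
      by (cases "morrey_norm p \<kappa> w w f") auto
    show ?thesis unfolding m(1)
    proof (rule ereal_le_cmult_if_le_all_above)
      fix N :: real assume "0 < N" "ereal m \<le> ereal N"
      then show "morrey_norm s (\<kappa> * s / p) (\<lambda>x. w x powr E) w (commutator c \<alpha> b f) \<le> ereal (C * ?L * N)"
        using norm_bound[OF f] m(1) by simp
    qed (use C L m(2) in auto)
  qed
  then show ?thesis unfolding E_def by blast
qed

end
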